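(* Let $\gamma$ be a closed guarded formula of the modal mu-calculus $\mu M$ in positive normal form. Then $\gamma$ is valid ($\models\gamma$) if and only if there is a proof tree for $\gamma$ (in the tableau proof system with names whose sequents are $w\vdash\Gamma$, as defined in the context).
   Context: **Syntax.** Fix an infinite set $\mathrm{Var}$ of variables, a set $\mathrm{Prop}$ of atomic propositions and a set $\mathrm{Act}$ of actions. Formulas of $\mu M$: $\phi ::= Z \mid P \mid \neg\phi \mid \phi_1\wedge\phi_2 \mid [a]\phi \mid \nu Z.\phi$ with $Z\in\mathrm{Var}$, $P\in\mathrm{Prop}$, $a\in\mathrm{Act}$, where in $\nu Z.\phi$ every free occurrence of $Z$ in $\phi$ is in the scope of an even number of negations. Derived operators: $\phi_1\vee\phi_2:=\neg(\neg\phi_1\wedge\neg\phi_2)$, $\langle a\rangle\phi:=\neg[a]\neg\phi$, $\mu Z.\phi(Z):=\neg\nu Z.\neg\phi(\neg Z)$, and the constants $\mathtt{tt}$ (for $P\vee\neg P$) and $\mathtt{ff}$ (for $P\wedge\neg P$). Here $\phi(\psi)$ denotes $\phi(Z)$ with $\psi$ substituted for all free occurrences of $Z$. A formula is in *positive form* if it is written with the derived operators so that $\neg$ is applied only to atomic propositions, and in *positive normal form* if in addition all bound variables are distinct. We write $\sigma Z.\phi$ for $\mu Z.\phi$ or $\nu Z.\phi$. A formula is *closed* if it has no free variables. It is *guarded* if for each of its subformulas $\sigma Z.\phi$, every occurrence of $Z$ in $\phi$ is within the scope of a modal operator ($[a]$ or $\langle a\rangle$). **Semantics.** A structure $\mathsf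 T$ consists of a set $\mathsf S$ of states, relations $\stackrel{a}{\longrightarrow}\subseteq \mathsf S\times\mathsf S$ for $a\in\mathrm{Act}$, and $\mathsf V_{\mathrm{Prop}}:\mathrm{Prop}\to 2^{\mathsf S}$. For $\mathsf V:\mathrm{Var}\to 2^{\mathsf S}$ define $\|P\|_{\mathsf V}=\mathsf V_{\mathrm{Prop}}(P)$, $\|Z\|_{\mathsf V}=\mathsf V(Z)$, $\|\neg\phi\|_{\mathsf V}=\mathsf S\setminus\|\phi\|_{\mathsf V}$, $\|\phi_1\wedge\phi_2\|_{\mathsf V}=\|\phi_1\|_{\mathsf V}\cap\|\phi_2\|_{\mathsf V}$, $\|[a]\phi\|_{\mathsf V}=\{s\mid \forall t.\ s\stackrel{a}{\longrightarrow}t\Rightarrow t\in\|\phi\|_{\mathsf V}\}$, $\|\nu Z.\phi\|_{\mathsf V}=\bigcup\{S\subseteq\mathsf S\mid S\subseteq\|\phi\|_{\mathsf V[Z:=S]}\}$. Derived operators are interpreted dually; in particular $\|\mu Z.\phi\|_{\mathsf V}=\bigcap\{S\subseteq\mathsf S\mid \|\phi\|_{\mathsf V[Z:=S]}\subseteq S\}$, $\|\mathtt{tt}\|_{\mathsf V}=\mathsf S$, $\|\mathtt{ff}\|_{\mathsf V}=\emptyset$. A formula $\phi$ is *valid*, $\models\phi$, if $\|\phi\|_{\mathsf V}=\mathsf S$ for all structures $\mathsf T$ and all $\mathsf V$. **Names.** Fix the closed guarded formula $\gamma$ in positive normal form. A variable $X$ is a *variable in $\gamma$* if some $\sigma X.\psi$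 is a subformula of $\gamma$; it is a *$\nu$-variable* if $\sigma=\nu$. If $\sigma_1Z.\psi$ is a proper subformula of $\sigma_2Y.\phi$ in $\gamma$, then $Y$ is *more outermost* than $Z$. Fix a linear ordering $X_1,\dots,X_m$ of the distinct variables in $\gamma$ such that if $X_i$ is more outermost than $X_j$ then $i<j$. For each $\nu$-variable $Z$ in $\gamma$ fix a finite set (enumerated in order) $\{z_1,\dots,z_l\}$ of *names* for $Z$, where $l$ is the length of $\gamma$ (different variables have different names). **Sequents.** A sequent is $w\vdash\Gamma$ where $w$ is a finite sequence of distinct names for $\nu$-variables and $\Gamma$ is a set of elements $\phi^u$, with $\phi$ a formula in the closure of $\gamma$ (the formulas obtainable from $\gamma$ by passing to immediate components of $\wedge,\vee,[a],\langle a\rangle$ and by unfolding $\sigma Z.\phi(Z)$ to $\phi(\sigma Z.\phi(Z))$) and $u$ a subsequence of $w$. $\Gamma,\phi^u,\psi^v$ denotes $\Gamma\cup\{\phi^u,\psi^v\}$. The initial sequent $\vdash\gamma$ has the empty sequence of names (both for $w$ and as the index of $\gamma$). **Orderings.** Write $v(i)$ for the $i$-th element of a sequence $v$. Let $u,v$ be subsequences of $w$. - $u<_w v$ if for some $j$: $u(j)$ and $v(j)$ are names of the same variable, $u(j)$ occurs before $v(j)$ in $w$, and $u(i)=v(i)$ for all $i<j$. - $u\restriction X_i$ is the subsequence of $u$ that omits all names of the variables $X_{i+1},\dots,X_m$. - $u\sqsubset_w v$ if $u<_w v$ or there is a $\nu$-variable $X_i$ such that $v\restriction X_i$ is a proper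 prefix of $u\restriction X_i$. **Rules** (goal directed: from a premise, labelling a parent node, to the conclusion(s), labelling its child node(s)). In each rule $w'$ denotes the subsequence of $w$ consisting of those names that still occur in (the indices of) the formulas of the conclusion. - Axioms: $w\vdash\Gamma,P^u,\neg P^v$ and $w\vdash\Gamma,\mathtt{tt}^u$. - ($\vee$) from $w\vdash\Gamma,(\phi\vee\psi)^u$ to $w\vdash\Gamma,\phi^u,\psi^u$. - ($\wedge$) from $w\vdash\Gamma,(\phi\wedge\psi)^u$ to the two conclusions $w\vdash\Gamma,\phi^u$ and $w\vdash\Gamma,\psi^u$. - (modal) from $w\vdash\Gamma,\langle a\rangle\Sigma,[a]\psi^u$ to $w'\vdash\Sigma,\psi^u$, where $\langle a\rangle\Sigma=\{\langle a\rangle\phi^v\mid\phi^v\in\Sigma\}$ and $\Sigma$ may be empty. - ($\mu$) from $w\vdash\Gamma,\mu Z.\phi(Z)^u$ to $w'\vdash\Gamma,\phi(\mu Z.\phi(Z))^{u\restriction Z}$. - ($\nu$) from $w\vdash\Gamma,\nu Z.\phi(Z)^u$ to $w'z_i\vdash\Gamma,\phi(\nu Z.\phi(Z))^{(u\restriction Z)z_i}$, where $z_i$ is the first name for $Z$ not occurring in $w$ (and $w'$ is the subsequence of names of $w$ occurring in $\Gamma$ or in $u\restriction Z$). - (Thin, structural) from $w\vdash\Gamma,\phi^u,\phi^v$ to $w'\vdash\Gamma,\phi^u$, provided $u\sqsubset_w v$. - (Reset$_z$, structural) from $w\vdash\Gamma,\phi_1^{uzz_1u_1},\dots,\phi_k^{uzz_ku_k}$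 ($k\ge1$) to $w'\vdash\Gamma,\phi_1^{uz},\dots,\phi_k^{uz}$, provided $z$ does not occur in $\Gamma$; here $z,z_1,\dots,z_k$ are names for the same variable, and $z_i$ could be the same as $z_j$. The structural rules have priority over the other (logical) rules: a logical rule is applied only when no structural rule is applicable. **Leaves.** In a tree labelled with sequents, a node $n$ labelled $w\vdash\Gamma$ is a (repeat) leaf if there is a node $m$ above it, its *companion*, labelled with the same sequent $w\vdash\Gamma$. This leaf is *successful* if between $m$ and $n$ there is an application of Reset$_z$ for some $z$ such that for every node between and including $m$ and $n$, labelled say $w''\vdash\Sigma$, the name $z$ occurs in $w''$. **Proof trees.** A *proof tree* for $\gamma$ is a (finite) tree such that (1) the root is labelled $\vdash\gamma$; (2) any other node is labelled with a sequent that is the result of applying one of the rules above to the sequent at its parent node (the children of a node being the conclusions of the rule applied there); (3) each leaf is labelled with an instance of an axiom or is a successful repeat leaf. *)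

theory Defs
  imports "HOL-Library.Sublist"
begin

section \<open>The modal mu-calculus\<close>

datatype ('v, 'p, 'a) form =
    Var 'v
  | Prop 'p
  | Neg "('v, 'p, 'a) form"
  | Conj "('v, 'p, 'a) form" "('v, 'p, 'a) form"
  | Box 'a "('v, 'p, 'a) form"
  | NuF 'v "('v, 'p, 'a) form"

text \<open>\<open>occs_parity e Z \<phi>\<close>: every free occurrence of \<open>Z\<close> in \<open>\<phi>\<close> is in the scope of an even
  (if \<open>e\<close>) resp. odd (if \<open>\<not> e\<close>) number of negations.\<close>

primrec occs_parity :: "bool \<Rightarrow> 'v \<Rightarrow> ('v, 'p, 'a) form \<Rightarrow> bool" where
  "occs_parity e Z (Var Y) \<longleftrightarrow> (Y = Z \<longrightarrow> e)"
| "occs_parity e Z (Prop P) \<longleftrightarrow> True"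
| "occs_parity e Z (Neg \<phi>) \<longleftrightarrow> occs_parity (\<not> e) Z \<phi>"
| "occs_parity e Z (Conj \<phi> \<psi>) \<longleftrightarrow> occs_parity e Z \<phi> \<and> occs_parity e Z \<psi>"
| "occs_parity e Z (Box a \<phi>) \<longleftrightarrow> occs_parity e Z \<phi>"
| "occs_parity e Z (NuF Y \<phi>) \<longleftrightarrow> (Y = Z \<or> occs_parity e Z \<phi>)"

primrec wf_form :: "('v, 'p, 'a) form \<Rightarrow> bool" where
  "wf_form (Var Y) \<longleftrightarrow> True"
| "wf_form (Prop P) \<longleftrightarrow> True"
| "wf_form (Neg \<phi>) \<longleftrightarrow> wf_form \<phi>"
| "wf_form (Conj \<phi> \<psi>) \<longleftrightarrow> wf_form \<phi> \<and> wf_form \<psi>"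
| "wf_form (Box a \<phi>) \<longleftrightarrow> wf_form \<phi>"
| "wf_form (NuF Z \<phi>) \<longleftrightarrow> wf_form \<phi> \<and> occs_parity True Z \<phi>"

text \<open>Not capture-avoiding; it is only used to replace \<open>Z\<close> by \<open>\<not> Z\<close>, where no capture can occur.\<close>

primrec subst_form :: "'v \<Rightarrow> ('v, 'p, 'a) form \<Rightarrow> ('v, 'p, 'a) form \<Rightarrow> ('v, 'p, 'a) form" where
  "subst_form Z \<psi> (Var Y) = (if Y = Z then \<psi> else Var Y)"
| "subst_form Z \<psi> (Prop P) = Prop P"
| "subst_form Z \<psi> (Neg \<phi>) = Neg (subst_form Z \<psi> \<phi>)"
| "subst_form Z \<psi> (Conj \<phi>1 \<phi>2) = Conj (subst_form Z \<psi> \<phi>1) (subst_form Z \<psi> \<phi>2)"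
| "subst_form Z \<psi> (Box a \<phi>) = Box a (subst_form Z \<psi> \<phi>)"
| "subst_form Z \<psi> (NuF Y \<phi>) = NuF Y (if Y = Z then \<phi> else subst_form Z \<psi> \<phi>)"

definition Disj :: "('v, 'p, 'a) form \<Rightarrow> ('v, 'p, 'a) form \<Rightarrow> ('v, 'p, 'a) form" where
  "Disj \<phi> \<psi> = Neg (Conj (Neg \<phi>) (Neg \<psi>))"

definition Dia :: "'a \<Rightarrow> ('v, 'p, 'a) form \<Rightarrow> ('v, 'p, 'a) form" where
  "Dia a \<phi> = Neg (Box a (Neg \<phi>))"

definition MuF :: "'v \<Rightarrow> ('v, 'p, 'a) form \<Rightarrow> ('v, 'p, 'a) form" where
  "MuF Z \<phi> = Neg (NuF Z (Neg (subst_form Z (Neg (Var Z)) \<phi>)))"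

text \<open>The atomic proposition used in \<open>tt\<close> and \<open>ff\<close> is arbitrary but fixed.\<close>

definition Tru :: "('v, 'p, 'a) form" where
  "Tru = Disj (Prop undefined) (Neg (Prop undefined))"

definition Fls :: "('v, 'p, 'a) form" where
  "Fls = Conj (Prop undefined) (Neg (Prop undefined))"

record ('s, 'p, 'a) kripke =
  states :: "'s set"
  steps :: "'a \<Rightarrow> ('s \<times> 's) set"
  vprop :: "'p \<Rightarrow> 's set"

definition kripke_structure :: "('s, 'p, 'a) kripke \<Rightarrow> bool" where
  "kripke_structure T \<longleftrightarrow>
     (\<forall>a. steps T a \<subseteq> states T \<times> states T) \<and> (\<forall>P. vprop T P \<subseteq> states T)"

primrec sem :: "('s, 'p, 'a) kripke \<Rightarrow> ('v \<Rightarrow> 's set) \<Rightarrow> ('v, 'p, 'a) form \<Rightarrow> 's set" where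
  "sem T V (Var Z) = V Z"
| "sem T V (Prop P) = vprop T P"
| "sem T V (Neg \<phi>) = states T - sem T V \<phi>"
| "sem T V (Conj \<phi> \<psi>) = sem T V \<phi> \<inter> sem T V \<psi>"
| "sem T V (Box a \<phi>) = {s \<in> states T. \<forall>t. (s, t) \<in> steps T a \<longrightarrow> t \<in> sem T V \<phi>}"
| "sem T V (NuF Z \<phi>) = \<Union> {S. S \<subseteq> states T \<and> S \<subseteq> sem T (V(Z := S)) \<phi>}"

text \<open>A constant cannot quantify over types, so validity is relative to a type \<open>'s\<close> from which
  the states are drawn; the state set of a structure is an arbitrary subset of \<open>'s\<close>.\<close>

definition valid :: "'s itself \<Rightarrow> ('v, 'p, 'a) form \<Rightarrow> bool" where
  "valid _ \<phi> \<longleftrightarrow>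
     (\<forall>(T :: ('s, 'p, 'a) kripke) V.
        kripke_structure T \<longrightarrow> (\<forall>Z. V Z \<subseteq> states T) \<longrightarrow> sem T V \<phi> = states T)"


section \<open>Positive form\<close>

text \<open>Formulas in positive form are formulas \<^emph>\<open>as written\<close> with the derived operators, hence a
  syntax of its own; \<open>form_of\<close> expands the derived operators.\<close>

datatype fixop = Mu | Nu

datatype ('v, 'p, 'a) pform =
    PVar 'v
  | PProp 'p
  | PNeg 'p
  | PTrue
  | PFalse
  | PConj "('v, 'p, 'a) pform" "('v, 'p, 'a) pform"
  | PDisj "('v, 'p, 'a) pform" "('v, 'p, 'a) pform"
  | PBox 'a "('v, 'p, 'a) pform"
  | PDia 'a "('v, 'p, 'a) pform"
  | PFix fixop 'v "('v, 'p, 'a) pform"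

primrec form_of :: "('v, 'p, 'a) pform \<Rightarrow> ('v, 'p, 'a) form" where
  "form_of (PVar Z) = Var Z"
| "form_of (PProp P) = Prop P"
| "form_of (PNeg P) = Neg (Prop P)"
| "form_of PTrue = Tru"
| "form_of PFalse = Fls"
| "form_of (PConj \<phi> \<psi>) = Conj (form_of \<phi>) (form_of \<psi>)"
| "form_of (PDisj \<phi> \<psi>) = Disj (form_of \<phi>) (form_of \<psi>)"
| "form_of (PBox a \<phi>) = Box a (form_of \<phi>)"
| "form_of (PDia a \<phi>) = Dia a (form_of \<phi>)"
| "form_of (PFix \<sigma> Z \<phi>) = (case \<sigma> of Mu \<Rightarrow> MuF Z (form_of \<phi>) | Nu \<Rightarrow> NuF Z (form_of \<phi>))"

primrec subformulas :: "('v, 'p, 'a) pform \<Rightarrow> ('v, 'p, 'a) pform set" where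
  "subformulas (PVar Z) = {PVar Z}"
| "subformulas (PProp P) = {PProp P}"
| "subformulas (PNeg P) = {PNeg P, PProp P}"
| "subformulas PTrue = {PTrue}"
| "subformulas PFalse = {PFalse}"
| "subformulas (PConj \<phi> \<psi>) = insert (PConj \<phi> \<psi>) (subformulas \<phi> \<union> subformulas \<psi>)"
| "subformulas (PDisj \<phi> \<psi>) = insert (PDisj \<phi> \<psi>) (subformulas \<phi> \<union> subformulas \<psi>)"
| "subformulas (PBox a \<phi>) = insert (PBox a \<phi>) (subformulas \<phi>)"
| "subformulas (PDia a \<phi>) = insert (PDia a \<phi>) (subformulas \<phi>)"
| "subformulas (PFix \<sigma> Z \<phi>) = insert (PFix \<sigma> Z \<phi>) (subformulas \<phi>)"

primrec free_vars :: "('v, 'p, 'a) pform \<Rightarrow> 'v set" where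
  "free_vars (PVar Z) = {Z}"
| "free_vars (PProp P) = {}"
| "free_vars (PNeg P) = {}"
| "free_vars PTrue = {}"
| "free_vars PFalse = {}"
| "free_vars (PConj \<phi> \<psi>) = free_vars \<phi> \<union> free_vars \<psi>"
| "free_vars (PDisj \<phi> \<psi>) = free_vars \<phi> \<union> free_vars \<psi>"
| "free_vars (PBox a \<phi>) = free_vars \<phi>"
| "free_vars (PDia a \<phi>) = free_vars \<phi>"
| "free_vars (PFix \<sigma> Z \<phi>) = free_vars \<phi> - {Z}"

definition closed_pform :: "('v, 'p, 'a) pform \<Rightarrow> bool" where
  "closed_pform \<phi> \<longleftrightarrow> free_vars \<phi> = {}"

primrec binders :: "('v, 'p, 'a) pform \<Rightarrow> 'v list" where
  "binders (PVar Z) = []"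
| "binders (PProp P) = []"
| "binders (PNeg P) = []"
| "binders PTrue = []"
| "binders PFalse = []"
| "binders (PConj \<phi> \<psi>) = binders \<phi> @ binders \<psi>"
| "binders (PDisj \<phi> \<psi>) = binders \<phi> @ binders \<psi>"
| "binders (PBox a \<phi>) = binders \<phi>"
| "binders (PDia a \<phi>) = binders \<phi>"
| "binders (PFix \<sigma> Z \<phi>) = Z # binders \<phi>"

definition positive_normal_form :: "('v, 'p, 'a) pform \<Rightarrow> bool" where
  "positive_normal_form \<phi> \<longleftrightarrow> distinct (binders \<phi>)"

text \<open>\<open>guarded_in Z \<phi>\<close>: every free occurrence of \<open>Z\<close> in \<open>\<phi>\<close> is in the scope of a modality.\<close>

primrec guarded_in :: "'v \<Rightarrow> ('v, 'p, 'a) pform \<Rightarrow> bool" where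
  "guarded_in Z (PVar Y) \<longleftrightarrow> Y \<noteq> Z"
| "guarded_in Z (PProp P) \<longleftrightarrow> True"
| "guarded_in Z (PNeg P) \<longleftrightarrow> True"
| "guarded_in Z PTrue \<longleftrightarrow> True"
| "guarded_in Z PFalse \<longleftrightarrow> True"
| "guarded_in Z (PConj \<phi> \<psi>) \<longleftrightarrow> guarded_in Z \<phi> \<and> guarded_in Z \<psi>"
| "guarded_in Z (PDisj \<phi> \<psi>) \<longleftrightarrow> guarded_in Z \<phi> \<and> guarded_in Z \<psi>"
| "guarded_in Z (PBox a \<phi>) \<longleftrightarrow> True"
| "guarded_in Z (PDia a \<phi>) \<longleftrightarrow> True"
| "guarded_in Z (PFix \<sigma> Y \<phi>) \<longleftrightarrow> (Y = Z \<or> guarded_in Z \<phi>)"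

definition guarded :: "('v, 'p, 'a) pform \<Rightarrow> bool" where
  "guarded \<gamma> \<longleftrightarrow> (\<forall>\<sigma> Z \<phi>. PFix \<sigma> Z \<phi> \<in> subformulas \<gamma> \<longrightarrow> guarded_in Z \<phi>)"

text \<open>Not capture-avoiding; in the proof system the substituted formula is always closed.\<close>

primrec subst :: "'v \<Rightarrow> ('v, 'p, 'a) pform \<Rightarrow> ('v, 'p, 'a) pform \<Rightarrow> ('v, 'p, 'a) pform" where
  "subst Z \<psi> (PVar Y) = (if Y = Z then \<psi> else PVar Y)"
| "subst Z \<psi> (PProp P) = PProp P"
| "subst Z \<psi> (PNeg P) = PNeg P"
| "subst Z \<psi> PTrue = PTrue"
| "subst Z \<psi> PFalse = PFalse"
| "subst Z \<psi> (PConj \<phi>1 \<phi>2) = PConj (subst Z \<psi> \<phi>1) (subst Z \<psi> \<phi>2)"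
| "subst Z \<psi> (PDisj \<phi>1 \<phi>2) = PDisj (subst Z \<psi> \<phi>1) (subst Z \<psi> \<phi>2)"
| "subst Z \<psi> (PBox a \<phi>) = PBox a (subst Z \<psi> \<phi>)"
| "subst Z \<psi> (PDia a \<phi>) = PDia a (subst Z \<psi> \<phi>)"
| "subst Z \<psi> (PFix \<sigma> Y \<phi>) = PFix \<sigma> Y (if Y = Z then \<phi> else subst Z \<psi> \<phi>)"

definition unfold_fix :: "fixop \<Rightarrow> 'v \<Rightarrow> ('v, 'p, 'a) pform \<Rightarrow> ('v, 'p, 'a) pform" where
  "unfold_fix \<sigma> Z \<phi> = subst Z (PFix \<sigma> Z \<phi>) \<phi>"

inductive_set clos :: "('v, 'p, 'a) pform \<Rightarrow> ('v, 'p, 'a) pform set" for \<gamma> where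
  "\<gamma> \<in> clos \<gamma>"
| "PConj \<phi> \<psi> \<in> clos \<gamma> \<Longrightarrow> \<phi> \<in> clos \<gamma>"
| "PConj \<phi> \<psi> \<in> clos \<gamma> \<Longrightarrow> \<psi> \<in> clos \<gamma>"
| "PDisj \<phi> \<psi> \<in> clos \<gamma> \<Longrightarrow> \<phi> \<in> clos \<gamma>"
| "PDisj \<phi> \<psi> \<in> clos \<gamma> \<Longrightarrow> \<psi> \<in> clos \<gamma>"
| "PBox a \<phi> \<in> clos \<gamma> \<Longrightarrow> \<phi> \<in> clos \<gamma>"
| "PDia a \<phi> \<in> clos \<gamma> \<Longrightarrow> \<phi> \<in> clos \<gamma>"
| "PFix \<sigma> Z \<phi> \<in> clos \<gamma> \<Longrightarrow> unfold_fix \<sigma> Z \<phi> \<in> clos \<gamma>"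

text \<open>The number of symbols; \<open>[a]\<close> and \<open>\<langle>a\<rangle>\<close> count as one symbol, \<open>\<sigma>Z\<close> as two.\<close>

primrec len :: "('v, 'p, 'a) pform \<Rightarrow> nat" where
  "len (PVar Z) = 1"
| "len (PProp P) = 1"
| "len (PNeg P) = 2"
| "len PTrue = 1"
| "len PFalse = 1"
| "len (PConj \<phi> \<psi>) = 1 + len \<phi> + len \<psi>"
| "len (PDisj \<phi> \<psi>) = 1 + len \<phi> + len \<psi>"
| "len (PBox a \<phi>) = 1 + len \<phi>"
| "len (PDia a \<phi>) = 1 + len \<phi>"
| "len (PFix \<sigma> Z \<phi>) = 2 + len \<phi>"


section \<open>Variables, names and orderings\<close>

definition vars_in :: "('v, 'p, 'a) pform \<Rightarrow> 'v set" where
  "vars_in \<gamma> = {X. \<exists>\<sigma> \<psi>. PFix \<sigma> X \<psi> \<in> subformulas \<gamma>}"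

definition nu_vars :: "('v, 'p, 'a) pform \<Rightarrow> 'v set" where
  "nu_vars \<gamma> = {X. \<exists>\<psi>. PFix Nu X \<psi> \<in> subformulas \<gamma>}"

definition more_outermost :: "('v, 'p, 'a) pform \<Rightarrow> 'v \<Rightarrow> 'v \<Rightarrow> bool" where
  "more_outermost \<gamma> Y Z \<longleftrightarrow>
     (\<exists>\<sigma>1 \<psi> \<sigma>2 \<phi>. PFix \<sigma>2 Y \<phi> \<in> subformulas \<gamma> \<and>
        PFix \<sigma>1 Z \<psi> \<in> subformulas (PFix \<sigma>2 Y \<phi>) \<and> PFix \<sigma>1 Z \<psi> \<noteq> PFix \<sigma>2 Y \<phi>)"

definition precedes :: "'b list \<Rightarrow> 'b \<Rightarrow> 'b \<Rightarrow> bool" where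
  "precedes xs x y \<longleftrightarrow> (\<exists>i j. i < j \<and> j < length xs \<and> xs ! i = x \<and> xs ! j = y)"

definition var_order :: "('v, 'p, 'a) pform \<Rightarrow> 'v list \<Rightarrow> bool" where
  "var_order \<gamma> xs \<longleftrightarrow> distinct xs \<and> set xs = vars_in \<gamma> \<and>
     (\<forall>Y Z. more_outermost \<gamma> Y Z \<longrightarrow> precedes xs Y Z)"

text \<open>The name \<open>(Z, i)\<close> is the \<open>i\<close>-th name \<open>z\<^sub>i\<close> of the variable \<open>Z\<close>.\<close>

type_synonym 'v name = "'v \<times> nat"

definition names :: "('v, 'p, 'a) pform \<Rightarrow> 'v name set" where
  "names \<gamma> = nu_vars \<gamma> \<times> {1..len \<gamma>}"

definition first_unused :: "('v, 'p, 'a) pform \<Rightarrow> 'v name list \<Rightarrow> 'v \<Rightarrow> 'v name \<Rightarrow> bool" where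
  "first_unused \<gamma> w Z z \<longleftrightarrow>
     (\<exists>i. z = (Z, i) \<and> z \<in> names \<gamma> \<and> z \<notin> set w \<and> (\<forall>j. 1 \<le> j \<and> j < i \<longrightarrow> (Z, j) \<in> set w))"

definition restrict_names :: "'v list \<Rightarrow> 'v name list \<Rightarrow> 'v \<Rightarrow> 'v name list" where
  "restrict_names xs u X = filter (\<lambda>z. \<not> precedes xs X (fst z)) u"

definition less_names :: "'v name list \<Rightarrow> 'v name list \<Rightarrow> 'v name list \<Rightarrow> bool" where
  "less_names w u v \<longleftrightarrow>
     (\<exists>j. j < length u \<and> j < length v \<and> fst (u ! j) = fst (v ! j) \<and>
        precedes w (u ! j) (v ! j) \<and> (\<forall>i<j. u ! i = v ! i))"

definition sq_less ::
  "('v, 'p, 'a) pform \<Rightarrow> 'v list \<Rightarrow> 'v name list \<Rightarrow> 'v name list \<Rightarrow> 'v name list \<Rightarrow> bool" where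
  "sq_less \<gamma> xs w u v \<longleftrightarrow> less_names w u v \<or>
     (\<exists>X \<in> nu_vars \<gamma>. strict_prefix (restrict_names xs v X) (restrict_names xs u X))"


section \<open>The proof system\<close>

text \<open>The pair \<open>(\<phi>, u)\<close> stands for \<open>\<phi>\<^sup>u\<close> and \<open>(w, \<Gamma>)\<close> for \<open>w \<turnstile> \<Gamma>\<close>.\<close>

type_synonym ('v, 'p, 'a) iform = "('v, 'p, 'a) pform \<times> 'v name list"
type_synonym ('v, 'p, 'a) sequent = "'v name list \<times> ('v, 'p, 'a) iform set"

definition is_sequent :: "('v, 'p, 'a) pform \<Rightarrow> ('v, 'p, 'a) sequent \<Rightarrow> bool" where
  "is_sequent \<gamma> = (\<lambda>(w, \<Gamma>). distinct w \<and> set w \<subseteq> names \<gamma> \<and>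
     (\<forall>(\<phi>, u) \<in> \<Gamma>. \<phi> \<in> clos \<gamma> \<and> subseq u w))"

definition names_of :: "('v, 'p, 'a) iform set \<Rightarrow> 'v name set" where
  "names_of \<Gamma> = (\<Union>(\<phi>, u) \<in> \<Gamma>. set u)"

definition still_occurring :: "'v name list \<Rightarrow> ('v, 'p, 'a) iform set \<Rightarrow> 'v name list" where
  "still_occurring w \<Gamma> = filter (\<lambda>z. z \<in> names_of \<Gamma>) w"

definition is_axiom :: "('v, 'p, 'a) sequent \<Rightarrow> bool" where
  "is_axiom = (\<lambda>(w, \<Gamma>). (\<exists>P u v. (PProp P, u) \<in> \<Gamma> \<and> (PNeg P, v) \<in> \<Gamma>) \<or> (\<exists>u. (PTrue, u) \<in> \<Gamma>))"

datatype 'v rule = OrR | AndR | ModalR | MuR | NuR | ThinR | ResetR "'v name"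

text \<open>As \<open>\<Gamma>, \<phi>\<^sup>u\<close> denotes \<open>\<Gamma> \<union> {\<phi>\<^sup>u}\<close>, the side formulas \<open>\<Gamma>\<close> may contain the principal one.\<close>

inductive structural ::
  "('v, 'p, 'a) pform \<Rightarrow> 'v list \<Rightarrow> 'v rule \<Rightarrow> ('v, 'p, 'a) sequent \<Rightarrow> ('v, 'p, 'a) sequent \<Rightarrow> bool"
  for \<gamma> xs where
  Thin: "sq_less \<gamma> xs w u v \<Longrightarrow> \<Delta> = \<Gamma> \<union> {(\<phi>, u)} \<Longrightarrow>
    structural \<gamma> xs ThinR (w, \<Gamma> \<union> {(\<phi>, u), (\<phi>, v)}) (still_occurring w \<Delta>, \<Delta>)"
| Reset: "fs \<noteq> [] \<Longrightarrow> z \<notin> names_of \<Gamma> \<Longrightarrow> \<forall>(\<phi>, z', v) \<in> set fs. fst z' = fst z \<Longrightarrow>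
    \<Delta> = \<Gamma> \<union> {(\<phi>, u @ [z]) | \<phi> z' v. (\<phi>, z', v) \<in> set fs} \<Longrightarrow>
    structural \<gamma> xs (ResetR z)
      (w, \<Gamma> \<union> {(\<phi>, u @ [z, z'] @ v) | \<phi> z' v. (\<phi>, z', v) \<in> set fs}) (still_occurring w \<Delta>, \<Delta>)"

inductive logical ::
  "('v, 'p, 'a) pform \<Rightarrow> 'v list \<Rightarrow> 'v rule \<Rightarrow> ('v, 'p, 'a) sequent \<Rightarrow> ('v, 'p, 'a) sequent list \<Rightarrow> bool"
  for \<gamma> xs where
  Or: "logical \<gamma> xs OrR (w, \<Gamma> \<union> {(PDisj \<phi> \<psi>, u)}) [(w, \<Gamma> \<union> {(\<phi>, u), (\<psi>, u)})]"
| And: "logical \<gamma> xs AndR (w, \<Gamma> \<union> {(PConj \<phi> \<psi>, u)}) [(w, \<Gamma> \<union> {(\<phi>, u)}), (w, \<Gamma> \<union> {(\<psi>, u)})]"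
| Modal: "\<Delta> = \<Sigma> \<union> {(\<psi>, u)} \<Longrightarrow>
    logical \<gamma> xs ModalR (w, \<Gamma> \<union> {(PDia a \<phi>, v) | \<phi> v. (\<phi>, v) \<in> \<Sigma>} \<union> {(PBox a \<psi>, u)})
      [(still_occurring w \<Delta>, \<Delta>)]"
| Mu: "\<Delta> = \<Gamma> \<union> {(unfold_fix Mu Z \<phi>, restrict_names xs u Z)} \<Longrightarrow>
    logical \<gamma> xs MuR (w, \<Gamma> \<union> {(PFix Mu Z \<phi>, u)}) [(still_occurring w \<Delta>, \<Delta>)]"
| Nu: "first_unused \<gamma> w Z z \<Longrightarrow> \<Delta> = \<Gamma> \<union> {(unfold_fix Nu Z \<phi>, restrict_names xs u Z @ [z])} \<Longrightarrow>
    logical \<gamma> xs NuR (w, \<Gamma> \<union> {(PFix Nu Z \<phi>, u)}) [(still_occurring w \<Delta> @ [z], \<Delta>)]"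

definition applies ::
  "('v, 'p, 'a) pform \<Rightarrow> 'v list \<Rightarrow> 'v rule \<Rightarrow> ('v, 'p, 'a) sequent \<Rightarrow> ('v, 'p, 'a) sequent list \<Rightarrow> bool"
where
  "applies \<gamma> xs r s ss \<longleftrightarrow>
     (\<exists>s'. structural \<gamma> xs r s s' \<and> ss = [s']) \<or>
     (\<not> (\<exists>r' s'. structural \<gamma> xs r' s s') \<and> logical \<gamma> xs r s ss)"

text \<open>Inner nodes carry the rule that is applied at them.\<close>

datatype ('v, 'p, 'a) ptree =
    Leaf "('v, 'p, 'a) sequent"
  | Node "('v, 'p, 'a) sequent" "'v rule" "('v, 'p, 'a) ptree list"

primrec label :: "('v, 'p, 'a) ptree \<Rightarrow> ('v, 'p, 'a) sequent" where
  "label (Leaf s) = s"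
| "label (Node s r ts) = s"

text \<open>In the following, \<open>h\<close> lists the labels and rules of the proper ancestors of a node, beginning
  with the root; a node labelled \<open>s\<close> with these ancestors repeats the companion shown in
  \<open>h = h1 @ (s, r) # h2\<close>. The rule at the companion itself is applied between companion and leaf.\<close>

definition is_repeat :: "(('v, 'p, 'a) sequent \<times> 'v rule) list \<Rightarrow> ('v, 'p, 'a) sequent \<Rightarrow> bool" where
  "is_repeat h s \<longleftrightarrow> s \<in> fst ` set h"

definition successful_repeat ::
  "(('v, 'p, 'a) sequent \<times> 'v rule) list \<Rightarrow> ('v, 'p, 'a) sequent \<Rightarrow> bool" where
  "successful_repeat h s \<longleftrightarrow>
     (\<exists>h1 r h2 z. h = h1 @ (s, r) # h2 \<and>
        ResetR z \<in> snd ` set ((s, r) # h2) \<and>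
        (\<forall>(w, \<Sigma>) \<in> insert s (fst ` set h2). z \<in> set w))"

text \<open>A node with a repeated label is a leaf, so inner nodes must not be repeats.\<close>

inductive proof_below ::
  "('v, 'p, 'a) pform \<Rightarrow> 'v list \<Rightarrow> (('v, 'p, 'a) sequent \<times> 'v rule) list \<Rightarrow> ('v, 'p, 'a) ptree \<Rightarrow> bool"
  for \<gamma> xs where
  leaf: "is_sequent \<gamma> s \<Longrightarrow> is_axiom s \<or> successful_repeat h s \<Longrightarrow> proof_below \<gamma> xs h (Leaf s)"
| node: "is_sequent \<gamma> s \<Longrightarrow> \<not> is_repeat h s \<Longrightarrow> applies \<gamma> xs r s (map label ts) \<Longrightarrow>
    (\<And>t. t \<in> set ts \<Longrightarrow> proof_below \<gamma> xs (h @ [(s, r)]) t) \<Longrightarrow>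
    proof_below \<gamma> xs h (Node s r ts)"

definition proof_tree :: "('v, 'p, 'a) pform \<Rightarrow> 'v list \<Rightarrow> ('v, 'p, 'a) ptree \<Rightarrow> bool" where
  "proof_tree \<gamma> xs t \<longleftrightarrow> label t = ([], {(\<gamma>, [])}) \<and> proof_below \<gamma> xs [] t"


section \<open>Basic facts on the derived operators\<close>

lemma occs_parity_subst_Neg_same:
  "occs_parity e Z (subst_form Z (Neg (Var Z)) \<phi>) \<longleftrightarrow> occs_parity (\<not> e) Z \<phi>"
  by (induction \<phi> arbitrary: e) simp_all

lemma occs_parity_subst_Neg_other:
  "Y \<noteq> Z \<Longrightarrow> occs_parity e Y (subst_form Z (Neg (Var Z)) \<phi>) \<longleftrightarrow> occs_parity e Y \<phi>"
  by (induction \<phi> arbitrary: e) simp_all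

lemma wf_form_subst_Neg: "wf_form (subst_form Z (Neg (Var Z)) \<phi>) \<longleftrightarrow> wf_form \<phi>"
proof (induction \<phi>)
  case (NuF Y \<phi>)
  then show ?case by (cases "Y = Z") (simp_all add: occs_parity_subst_Neg_other)
qed simp_all

lemma occs_parity_form_of: "occs_parity True Z (form_of \<phi>)"
proof (induction \<phi>)
  case (PFix \<sigma> Y \<phi>)
  then show ?case
    by (cases \<sigma>; cases "Y = Z") (simp_all add: MuF_def occs_parity_subst_Neg_other)
qed (simp_all add: Disj_def Dia_def Tru_def Fls_def)

lemma wf_form_form_of: "wf_form (form_of \<phi>)"
proof (induction \<phi>)
  case (PFix \<sigma> Y \<phi>)
  then show ?case
    by (cases \<sigma>)
      (simp_all add: MuF_def wf_form_subst_Neg occs_parity_subst_Neg_same occs_parity_form_of)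
qed (simp_all add: Disj_def Dia_def Tru_def Fls_def)

lemma sem_subset:
  assumes "kripke_structure T" and "\<forall>Z. V Z \<subseteq> states T"
  shows "sem T V \<phi> \<subseteq> states T"
  using assms by (induction \<phi>) (auto simp: kripke_structure_def)

lemma sem_subst_Neg:
  "sem T V (subst_form Z (Neg (Var Z)) \<phi>) = sem T (V(Z := states T - V Z)) \<phi>"
proof (induction \<phi> arbitrary: V)
  case (NuF Y \<phi>)
  show ?case
  proof (cases "Y = Z")
    case False
    then have "(V(Y := S))(Z := states T - (V(Y := S)) Z) = (V(Z := states T - V Z))(Y := S)" for S
      by (auto simp: fun_eq_iff)
    then show ?thesis using False by (simp only: subst_form.simps sem.simps NuF.IH if_False)
  next
    case True
    then show ?thesis by (simp only: subst_form.simps sem.simps fun_upd_upd simp_thms if_True)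
  qed
qed auto

lemma sem_derived:
  assumes T: "kripke_structure T" and V: "\<forall>Z. V Z \<subseteq> states T"
  shows "sem T V Tru = states T"
    and "sem T V Fls = {}"
    and "sem T V (Disj \<phi> \<psi>) = sem T V \<phi> \<union> sem T V \<psi>"
    and "sem T V (Dia a \<phi>) = {s \<in> states T. \<exists>t. (s, t) \<in> steps T a \<and> t \<in> sem T V \<phi>}"
    and "sem T V (MuF Z \<phi>) = \<Inter> {S. S \<subseteq> states T \<and> sem T (V(Z := S)) \<phi> \<subseteq> S}"
proof -
  show "sem T V Tru = states T" "sem T V Fls = {}"
    using T by (auto simp: Tru_def Fls_def Disj_def kripke_structure_def)
  show "sem T V (Disj \<phi> \<psi>) = sem T V \<phi> \<union> sem T V \<psi>"
    using sem_subset[OF assms] by (auto simp: Disj_def)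
  show "sem T V (Dia a \<phi>) = {s \<in> states T. \<exists>t. (s, t) \<in> steps T a \<and> t \<in> sem T V \<phi>}"
    using T by (auto simp: Dia_def kripke_structure_def)
  let ?S = "states T" and ?F = "\<lambda>S. sem T (V(Z := S)) \<phi>"
  have sub: "?F S \<subseteq> ?S" if "S \<subseteq> ?S" for S
    using sem_subset[OF T, of "V(Z := S)"] V that by auto
  have "sem T V (MuF Z \<phi>) = ?S - \<Union> {S. S \<subseteq> ?S \<and> S \<subseteq> ?S - ?F (?S - S)}"
    by (simp add: MuF_def sem_subst_Neg)
  also have "\<dots> = \<Inter> {S. S \<subseteq> ?S \<and> ?F S \<subseteq> S}" (is "?L = ?R")
  proof
    show "?L \<subseteq> ?R"
    proof
      fix s assume s: "s \<in> ?L"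
      have "s \<in> S" if S: "S \<subseteq> ?S" "?F S \<subseteq> S" for S
      proof (rule ccontr)
        assume "s \<notin> S"
        have "?S - (?S - S) = S" using S by auto
        with S have "?S - S \<in> {S. S \<subseteq> ?S \<and> S \<subseteq> ?S - ?F (?S - S)}" by auto
        with s \<open>s \<notin> S\<close> show False by blast
      qed
      then show "s \<in> ?R" by blast
    qed
    show "?R \<subseteq> ?L"
    proof
      fix s assume s: "s \<in> ?R"
      have "s \<in> ?S" using s sub[of ?S] by auto
      moreover have "s \<notin> S" if S: "S \<subseteq> ?S" "S \<subseteq> ?S - ?F (?S - S)" for S
      proof -
        have "?F (?S - S) \<subseteq> ?S - S" using S sub[of "?S - S"] by auto
        then show ?thesis using s by auto
      qed
      ultimately show "s \<in> ?L" by blast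
    qed
  qed
  finally show "sem T V (MuF Z \<phi>) = \<Inter> {S. S \<subseteq> ?S \<and> ?F S \<subseteq> S}" .
qed

end

theory Submission
  imports Defs "HOL-Library.While_Combinator" "HOL-Library.List_Lexorder"
begin

text \<open>
  Soundness: suppose all formulas of a sequent in a proof tree are false at a state. Approximating the
  greatest fixed points by ordinal stages, we attach a stage to every name, such that a formula
  with index \<open>u\<close> is false already when the variables of the names in \<open>u\<close> are interpreted by these
  stages. Falsity is passed on to some child, where stages of persisting names do not increase and
  the stage of \<open>z\<close> decreases strictly at \<open>Reset\<^sub>z\<close>. At a successful leaf the stages of the names of its
  companion are therefore lexicographically smaller than they were there, so that a well-founded
  induction at every inner node excludes that any formula set in the tree is refuted.

  Completeness: without a proof tree, an unprovable child exists for every rule application, and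
  jumping from each unsuccessful repeat back to its companion turns the unprovable sequents into a
  finite graph. Its irreducible sequents, where only the modal rule applies, are the states of a model.
  If \<open>\<gamma>\<close> were true at the root, following a true formula would give an infinite walk in which the
  outermost variable that is unfolded infinitely often is a \<open>\<nu>\<close>-variable. Considering the longest
  eventually stable prefix of the indices on this walk, the last name \<open>z\<close> of this prefix is never
  removed but reset infinitely often, and then some jump would have been from a successful repeat.
\<close>


section \<open>Stages of least fixed points\<close>

text \<open>Several subformulas of \<gamma> can expand to the same closure formula, in particular a
  variable and the fixed point that binds it. Stages must tell the two apart: unfolding at the
  variable lowers its stage, whereas entering the fixed point chooses the stage afresh. Both
  directions therefore follow subformulas of \<gamma> rather than closure formulas. One semantics
  \<open>gsem b\<close> serves both: stages of \<nu>-variables justify falsity, stages of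
  \<mu>-variables justify truth. Completeness has two finiteness obstacles. The supply of
  \<open>len \<gamma>\<close> names per variable must not run out: once no structural rule applies,
  Thin has left one index per formula and Reset has left every name as the last one of its variable
  in some index, so the names of a variable in use can be charged to different closure formulas.
  Moreover, reduction to irreducible sequents must end; guardedness ensures this, because an
  unfolding then adds nothing outside the modalities. The resulting graph is finite, so the
  countermodel can be embedded into any infinite type of states.\<close>

text \<open>Since there are more sets of states than states, iterating a monotone operator along a
  well-order of the sets of states reaches its least fixed point.\<close>

typedef 's stage = "UNIV :: 's set set" by simp

instantiation stage :: (type) wellorder
begin

definition less_eq_stage :: "'a stage \<Rightarrow> 'a stage \<Rightarrow> bool" where
  "(a :: 'a stage) \<le> b \<longleftrightarrow> (Rep_stage a, Rep_stage b) \<in> (SOME r. well_order_on UNIV r)"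

definition less_stage :: "'a stage \<Rightarrow> 'a stage \<Rightarrow> bool" where
  "(a :: 'a stage) < b \<longleftrightarrow> a \<le> b \<and> a \<noteq> b"

instance
proof
  define r where "r = (SOME r. well_order_on (UNIV :: 'a set set) r)"
  have r: "well_order_on UNIV r"
    unfolding r_def by (rule someI_ex) (rule well_order_on)
  have le: "a \<le> b \<longleftrightarrow> (Rep_stage a, Rep_stage b) \<in> r" for a b :: "'a stage"
    by (simp add: less_eq_stage_def r_def)
  have lin: "refl_on UNIV r" "trans r" "antisym r" "total_on UNIV r" "wf (r - Id)"
    using r by (auto simp: well_order_on_def linear_order_on_def partial_order_on_def preorder_on_def)
  fix x y z :: "'a stage"
  show "x \<le> x" using lin(1) by (auto simp: le refl_on_def)
  show "x \<le> y \<Longrightarrow> y \<le> z \<Longrightarrow> x \<le> z" using lin(2) by (auto simp: le trans_def)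
  show anti: "x \<le> y \<Longrightarrow> y \<le> x \<Longrightarrow> x = y" for x y :: "'a stage"
    using lin(3) unfolding le antisym_def by (metis Rep_stage_inject)
  show "(x < y) = (x \<le> y \<and> \<not> y \<le> x)"
    using anti by (auto simp: less_stage_def)
  show "x \<le> y \<or> y \<le> x"
    using lin(1,4) by (cases "x = y") (auto simp: le total_on_def refl_on_def Rep_stage_inject)
  fix P and a :: "'a stage"
  assume step: "\<And>x :: 'a stage. (\<And>y. y < x \<Longrightarrow> P y) \<Longrightarrow> P x"
  have "P (Abs_stage A)" for A
    using lin(5)
  proof (induction A rule: wf_induct_rule)
    case (less A)
    show ?case
    proof (rule step)
      fix y assume "y < Abs_stage A"
      then have "(Rep_stage y, A) \<in> r - Id"
        by (auto simp: less_stage_def le Abs_stage_inverse Rep_stage_inverse)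
      then show "P y" using less[of "Rep_stage y"] by (simp add: Rep_stage_inverse)
    qed
  qed
  then show "P a" by (metis Rep_stage_inverse)
qed

end

text \<open>This form of the iteration needs no distinction between successor and limit stages.
  Membership at stage \<open>a\<close> directly provides a smaller stage \<open>b\<close>; this is
  the strict descent that every unfolding of a variable relies on.\<close>

function approx :: "('s set \<Rightarrow> 's set) \<Rightarrow> 's stage \<Rightarrow> 's set" where
  "approx f a = (\<Union>b\<in>{b. b < a}. f (approx f b))"
  by auto
termination
  by (relation "inv_image {(x, y). x < y} snd") (auto intro: wf)

declare approx.simps [simp del]

lemma approx_iff: "s \<in> approx f a \<longleftrightarrow> (\<exists>b<a. s \<in> f (approx f b))"
  by (subst approx.simps) auto

lemma lfp_approx:
  fixes f :: "'s set \<Rightarrow> 's set"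
  assumes "mono f"
  shows "lfp f = (\<Union>a. f (approx f a))"
proof
  have "approx f a \<subseteq> lfp f" for a
  proof (induction a rule: less_induct)
    case (less a)
    show ?case
    proof
      fix s assume "s \<in> approx f a"
      then obtain b where "b < a" "s \<in> f (approx f b)" by (auto simp: approx_iff)
      then have "s \<in> f (lfp f)" using less monoD[OF assms] by blast
      then show "s \<in> lfp f" using lfp_fixpoint[OF assms] by simp
    qed
  qed
  then show "(\<Union>a. f (approx f a)) \<subseteq> lfp f"
    using lfp_fixpoint[OF assms] monoD[OF assms] by blast
  have "\<exists>a. f (approx f a) \<subseteq> approx f a"
  proof (rule ccontr)
    assume "\<not> ?thesis"
    then have "\<forall>a. \<exists>s. s \<in> f (approx f a) \<and> s \<notin> approx f a" by blast
    then obtain g where g: "\<And>a. g a \<in> f (approx f a)" "\<And>a. g a \<notin> approx f a" by metis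
    \<comment> \<open>For \<open>a < b\<close> the element \<open>g a\<close> already belongs to
      \<open>approx f b\<close>, while \<open>g b\<close> does not. Hence \<open>g\<close> would
      embed the sets of states into the states, against Cantor.\<close>
    have "g a \<noteq> g b" if "a < b" for a b
      using g[of a] g[of b] that by (auto simp: approx_iff)
    then have "inj g" by (metis injI linorder_neqE)
    then have "inj (g \<circ> Abs_stage)"
      by (intro inj_compose) (auto intro!: injI simp: Abs_stage_inject)
    then have "surj (inv (g \<circ> Abs_stage))" by (rule inj_imp_surj_inv)
    then have "inv (g \<circ> Abs_stage) ` UNIV = Pow UNIV" by simp
    then show False using Cantors_theorem by blast
  qed
  then obtain a where "f (approx f a) \<subseteq> approx f a" by blast
  then have "lfp f \<subseteq> approx f a" by (rule lfp_lowerbound)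
  then show "lfp f \<subseteq> (\<Union>a. f (approx f a))" by (fastforce simp: approx_iff)
qed


section \<open>Truth and falsity of formulas in positive form\<close>

text \<open>By duality, falsity of a greatest fixed point is a least fixed point. The operator
  selected by \<open>b\<close> is the one whose truth value \<open>b\<close> has a well-founded
  justification.\<close>

definition least_op :: "bool \<Rightarrow> fixop" where
  "least_op b = (if b then Mu else Nu)"

text \<open>The states where a formula has the truth value \<open>b\<close>; accordingly, \<open>V\<close> gives the states where
  the variables have this value.\<close>

primrec gsem :: "bool \<Rightarrow> ('s, 'p, 'a) kripke \<Rightarrow> ('v \<Rightarrow> 's set) \<Rightarrow> ('v, 'p, 'a) pform \<Rightarrow> 's set" where
  "gsem b T V (PVar Z) = states T \<inter> V Z"
| "gsem b T V (PProp P) = {s \<in> states T. s \<in> vprop T P \<longleftrightarrow> b}"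
| "gsem b T V (PNeg P) = {s \<in> states T. s \<notin> vprop T P \<longleftrightarrow> b}"
| "gsem b T V PTrue = {s \<in> states T. b}"
| "gsem b T V PFalse = {s \<in> states T. \<not> b}"
| "gsem b T V (PConj \<phi> \<psi>) =
    (if b then gsem b T V \<phi> \<inter> gsem b T V \<psi> else gsem b T V \<phi> \<union> gsem b T V \<psi>)"
| "gsem b T V (PDisj \<phi> \<psi>) =
    (if b then gsem b T V \<phi> \<union> gsem b T V \<psi> else gsem b T V \<phi> \<inter> gsem b T V \<psi>)"
| "gsem b T V (PBox a \<phi>) =
    {s \<in> states T. if b then \<forall>t. (s, t) \<in> steps T a \<longrightarrow> t \<in> gsem b T V \<phi>
      else \<exists>t. (s, t) \<in> steps T a \<and> t \<in> gsem b T V \<phi>}"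
| "gsem b T V (PDia a \<phi>) =
    {s \<in> states T. if b then \<exists>t. (s, t) \<in> steps T a \<and> t \<in> gsem b T V \<phi>
      else \<forall>t. (s, t) \<in> steps T a \<longrightarrow> t \<in> gsem b T V \<phi>}"
| "gsem b T V (PFix \<sigma> Z \<phi>) =
    (if \<sigma> = least_op b then lfp (\<lambda>S. gsem b T (V(Z := S)) \<phi>)
     else gfp (\<lambda>S. gsem b T (V(Z := S)) \<phi>))"

text \<open>Negation is confined to atomic propositions, and \<open>V\<close> records where
  variables have the value \<open>b\<close> itself, so falsity depends monotonically on
  \<open>V\<close> just as truth does.\<close>

lemma gsem_mono: "(\<And>Z. V Z \<subseteq> V' Z) \<Longrightarrow> gsem b T V \<phi> \<subseteq> gsem b T V' \<phi>"
proof (induction \<phi> arbitrary: V V')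
  case (PFix \<sigma> Z \<phi>)
  have "gsem b T (V(Z := S)) \<phi> \<subseteq> gsem b T (V'(Z := S)) \<phi>" for S
    by (rule PFix.IH) (simp add: PFix.prems)
  then show ?case by (auto intro!: lfp_mono gfp_mono simp del: fun_upd_apply)
next
  case (PConj \<phi> \<psi>)
  have "gsem b T V \<phi> \<subseteq> gsem b T V' \<phi>" "gsem b T V \<psi> \<subseteq> gsem b T V' \<psi>"
    by (auto intro!: PConj.IH PConj.prems del: subsetI)
  then show ?case by (cases b) auto
next
  case (PDisj \<phi> \<psi>)
  have "gsem b T V \<phi> \<subseteq> gsem b T V' \<phi>" "gsem b T V \<psi> \<subseteq> gsem b T V' \<psi>"
    by (auto intro!: PDisj.IH PDisj.prems del: subsetI)
  then show ?case by (cases b) auto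
next
  case (PBox a \<phi>)
  have "gsem b T V \<phi> \<subseteq> gsem b T V' \<phi>" by (auto intro!: PBox.IH PBox.prems del: subsetI)
  then show ?case by (cases b) auto
next
  case (PDia a \<phi>)
  have "gsem b T V \<phi> \<subseteq> gsem b T V' \<phi>" by (auto intro!: PDia.IH PDia.prems del: subsetI)
  then show ?case by (cases b) auto
qed auto

lemma mono_gsem: "mono (\<lambda>S. gsem b T (V(Z := S)) \<phi>)"
  by (intro monoI gsem_mono) simp

lemma gsem_subset: "gsem b T V \<phi> \<subseteq> states T"
proof (induction \<phi> arbitrary: V)
  case (PFix \<sigma> Z \<phi>)
  have "lfp (\<lambda>S. gsem b T (V(Z := S)) \<phi>) \<subseteq> states T"
    by (rule lfp_lowerbound) (rule PFix)
  moreover have "gfp (\<lambda>S. gsem b T (V(Z := S)) \<phi>) \<subseteq> states T"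
    by (subst gfp_fixpoint[OF mono_gsem, symmetric]) (rule PFix)
  ultimately show ?case by simp
next
  case (PConj \<phi> \<psi>)
  from PConj.IH[of V] show ?case by (cases b) auto
next
  case (PDisj \<phi> \<psi>)
  from PDisj.IH[of V] show ?case by (cases b) auto
qed (simp_all add: Collect_mono_iff subset_iff)

lemma gsem_cong:
  "(\<And>Z. Z \<in> free_vars \<phi> \<Longrightarrow> states T \<inter> V Z = states T \<inter> V' Z) \<Longrightarrow> gsem b T V \<phi> = gsem b T V' \<phi>"
proof (induction \<phi> arbitrary: V V')
  case (PFix \<sigma> Z \<phi>)
  have "gsem b T (V(Z := S)) \<phi> = gsem b T (V'(Z := S)) \<phi>" for S
    by (rule PFix.IH) (simp add: PFix.prems)
  then show ?case by (simp del: fun_upd_apply)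
next
  case (PConj \<phi> \<psi>)
  have "gsem b T V \<phi> = gsem b T V' \<phi>" "gsem b T V \<psi> = gsem b T V' \<psi>"
    by (auto intro!: PConj.IH PConj.prems)
  then show ?case by (cases b) simp_all
next
  case (PDisj \<phi> \<psi>)
  have "gsem b T V \<phi> = gsem b T V' \<phi>" "gsem b T V \<psi> = gsem b T V' \<psi>"
    by (auto intro!: PDisj.IH PDisj.prems)
  then show ?case by (cases b) simp_all
next
  case (PBox a \<phi>)
  have "gsem b T V \<phi> = gsem b T V' \<phi>" by (auto intro!: PBox.IH PBox.prems)
  then show ?case by (cases b) simp_all
next
  case (PDia a \<phi>)
  have "gsem b T V \<phi> = gsem b T V' \<phi>" by (auto intro!: PDia.IH PDia.prems)
  then show ?case by (cases b) simp_all
qed auto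

text \<open>De Morgan duality of fixed points relative to a carrier \<open>A\<close>. The operators
  act on all sets over the state type, so it has to be known that \<open>F\<close> sees only the
  part of its argument inside \<open>A\<close>.\<close>

lemma gfp_complement:
  fixes F G :: "'s set \<Rightarrow> 's set"
  assumes "\<And>S. F S \<subseteq> A" "\<And>S. F (A \<inter> S) = F S" "\<And>S. G S = A - F (A - S)"
  shows "gfp G = A - lfp F"
proof
  show "gfp G \<subseteq> A - lfp F"
  proof
    fix x assume "x \<in> gfp G"
    then obtain S where S: "x \<in> S" "S \<subseteq> A - F (A - S)"
      using assms(3) by (auto simp: gfp_def)
    then have "F (A - S) \<subseteq> A - S" using assms(1) by blast
    then have "lfp F \<subseteq> A - S" by (rule lfp_lowerbound)
    then show "x \<in> A - lfp F" using S by blast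
  qed
  show "A - lfp F \<subseteq> gfp G"
  proof
    fix x assume "x \<in> A - lfp F"
    then obtain S where S: "x \<in> A" "F S \<subseteq> S" "x \<notin> S" by (auto simp: lfp_def)
    have "A - (A - S) = A \<inter> S" by blast
    then have "A - S \<subseteq> G (A - S)" using S assms(2,3) by auto
    then have "A - S \<subseteq> gfp G" by (rule gfp_upperbound)
    then show "x \<in> gfp G" using S by blast
  qed
qed

lemma gsem_False:
  assumes "kripke_structure T"
  shows "gsem False T (\<lambda>Z. states T - V Z) \<phi> = states T - gsem True T V \<phi>"
proof (induction \<phi> arbitrary: V)
  case (PFix \<sigma> Z \<phi>)
  let ?A = "states T"
  define F where "F = (\<lambda>S. gsem True T (V(Z := S)) \<phi>)"
  define G where "G = (\<lambda>S. gsem False T ((\<lambda>Z. ?A - V Z)(Z := S)) \<phi>)"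
  have G: "G S = ?A - F (?A - S)" for S
  proof -
    have "G S = gsem False T (\<lambda>Y. ?A - (V(Z := ?A - S)) Y) \<phi>"
      unfolding G_def by (rule gsem_cong) auto
    then show ?thesis by (simp add: PFix.IH F_def del: fun_upd_apply)
  qed
  have F: "F S = ?A - G (?A - S)" for S
  proof -
    have "F (?A - (?A - S)) = F S" unfolding F_def by (rule gsem_cong) auto
    then show ?thesis using G[of "?A - S"] gsem_subset[of True T "V(Z := S)" \<phi>]
      by (auto simp: F_def)
  qed
  have sub: "F S \<subseteq> ?A" "G S \<subseteq> ?A" for S
    by (simp_all add: F_def G_def gsem_subset del: fun_upd_apply)
  have int: "F (?A \<inter> S) = F S" "G (?A \<inter> S) = G S" for S
    unfolding F_def G_def by (auto intro!: gsem_cong)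
  have "gfp G = ?A - lfp F" by (rule gfp_complement) (use sub int G in auto)
  moreover have "gfp F = ?A - lfp G" by (rule gfp_complement) (use sub int F in auto)
  moreover have "lfp G \<subseteq> ?A" using sub by (intro lfp_lowerbound)
  ultimately show ?case
    by (cases \<sigma>) (auto simp: least_op_def F_def G_def simp del: fun_upd_apply)
next
  case (PBox a \<phi>)
  have "t \<in> states T" if "(s, t) \<in> steps T a" for s t
    using assms that by (auto simp: kripke_structure_def)
  then show ?case by (auto simp: PBox)
qed (use assms in \<open>auto 0 3 simp: kripke_structure_def\<close>)

text \<open>The given semantics quantifies over subsets of the state set, \<open>lfp\<close> and
  \<open>gfp\<close> over all sets. Cutting a pre-fixed point down to the state set leaves it one,
  and post-fixed points lie inside the state set anyway.\<close>

lemma gsem_True: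
  assumes "kripke_structure T"
  shows "\<forall>Z. V Z \<subseteq> states T \<Longrightarrow> gsem True T V \<phi> = sem T V (form_of \<phi>)"
proof (induction \<phi> arbitrary: V)
  case (PFix \<sigma> Z \<phi>)
  let ?A = "states T"
  define F where "F = (\<lambda>S. gsem True T (V(Z := S)) \<phi>)"
  have F: "F S = sem T (V(Z := S)) (form_of \<phi>)" if "S \<subseteq> ?A" for S
    unfolding F_def by (rule PFix.IH) (use PFix.prems that in auto)
  have sub: "F S \<subseteq> ?A" for S unfolding F_def by (rule gsem_subset)
  have int: "F (?A \<inter> S) = F S" for S unfolding F_def by (auto intro!: gsem_cong)
  show ?case
  proof (cases \<sigma>)
    case Mu
    have "lfp F = \<Inter> {S. S \<subseteq> ?A \<and> F S \<subseteq> S}"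
    proof
      show "lfp F \<subseteq> \<Inter> {S. S \<subseteq> ?A \<and> F S \<subseteq> S}" by (auto simp: lfp_def)
      show "\<Inter> {S. S \<subseteq> ?A \<and> F S \<subseteq> S} \<subseteq> lfp F"
      proof
        fix x assume x: "x \<in> \<Inter> {S. S \<subseteq> ?A \<and> F S \<subseteq> S}"
        have "x \<in> S" if "F S \<subseteq> S" for S
        proof -
          have "F (?A \<inter> S) \<subseteq> ?A \<inter> S" using that int sub by blast
          then show ?thesis using x by auto
        qed
        then show "x \<in> lfp F" by (auto simp: lfp_def)
      qed
    qed
    moreover have "{S. S \<subseteq> ?A \<and> F S \<subseteq> S} = {S. S \<subseteq> ?A \<and> sem T (V(Z := S)) (form_of \<phi>) \<subseteq> S}"
      using F by auto
    ultimately show ?thesis using Mu sem_derived(5)[OF assms PFix.prems, of Z "form_of \<phi>"]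
      by (simp add: least_op_def F_def)
  next
    case Nu
    have "{S. S \<subseteq> ?A \<and> S \<subseteq> F S} = {S. S \<subseteq> F S}" using sub by blast
    then have "gfp F = \<Union> {S. S \<subseteq> ?A \<and> S \<subseteq> F S}" by (simp add: gfp_def)
    moreover have "{S. S \<subseteq> ?A \<and> S \<subseteq> F S} = {S. S \<subseteq> ?A \<and> S \<subseteq> sem T (V(Z := S)) (form_of \<phi>)}"
      using F by auto
    ultimately show ?thesis using Nu by (simp add: least_op_def F_def)
  qed
qed (use assms in \<open>auto simp: sem_derived kripke_structure_def\<close>)

section \<open>Positions in lists\<close>

text \<open>An element that is absent from \<open>ys\<close> gets position \<open>length ys\<close>,
  behind all those present.\<close>

definition pos :: "'b list \<Rightarrow> 'b \<Rightarrow> nat" where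
  "pos ys x = length (takeWhile (\<lambda>y. y \<noteq> x) ys)"

lemma pos_less: "x \<in> set ys \<Longrightarrow> pos ys x < length ys"
  unfolding pos_def by (induction ys) auto

lemma nth_pos: "x \<in> set ys \<Longrightarrow> ys ! pos ys x = x"
  unfolding pos_def by (induction ys) auto

lemma pos_nth: "distinct ys \<Longrightarrow> i < length ys \<Longrightarrow> pos ys (ys ! i) = i"
  by (metis nth_eq_iff_index_eq nth_mem nth_pos pos_less)

lemma pos_append: "x \<in> set ys \<Longrightarrow> pos (ys @ zs) x = pos ys x"
  unfolding pos_def by (induction ys) auto

lemma pos_snoc: "x \<notin> set ys \<Longrightarrow> pos (ys @ [x]) x = length ys"
  unfolding pos_def by (induction ys) auto

lemma pos_eq_iff: "x \<in> set ys \<Longrightarrow> y \<in> set ys \<Longrightarrow> pos ys x = pos ys y \<longleftrightarrow> x = y"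
  by (metis nth_pos)

lemma precedes_iff:
  assumes "distinct ys"
  shows "precedes ys x y \<longleftrightarrow> x \<in> set ys \<and> y \<in> set ys \<and> pos ys x < pos ys y"
proof
  assume "precedes ys x y"
  then obtain i j where "i < j" "j < length ys" "ys ! i = x" "ys ! j = y"
    unfolding precedes_def by blast
  then show "x \<in> set ys \<and> y \<in> set ys \<and> pos ys x < pos ys y"
    using pos_nth[OF assms, of i] pos_nth[OF assms, of j] by auto
next
  assume "x \<in> set ys \<and> y \<in> set ys \<and> pos ys x < pos ys y"
  then show "precedes ys x y"
    unfolding precedes_def using nth_pos[of x ys] nth_pos[of y ys] pos_less[of y ys] by blast
qed


section \<open>Systems of equations with acyclic dependencies\<close>

text \<open>Solves a triangular system of equations \<open>V X = G X V\<close> by one pass in list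
  order. It is used twice: for the closed formulas that the variables of \<gamma> stand for, and for
  the interpretations of these variables.\<close>

definition sol :: "('b \<Rightarrow> ('b \<Rightarrow> 'c) \<Rightarrow> 'c) \<Rightarrow> 'b list \<Rightarrow> 'b \<Rightarrow> 'c" where
  "sol G ys = foldl (\<lambda>V X. V(X := G X V)) (\<lambda>_. undefined) ys"

definition acyclic_deps :: "('b \<Rightarrow> ('b \<Rightarrow> 'c) \<Rightarrow> 'c) \<Rightarrow> 'b list \<Rightarrow> bool" where
  "acyclic_deps G ys \<longleftrightarrow> (\<forall>X\<in>set ys. \<forall>V V'.
     (\<forall>Y\<in>set ys. pos ys Y < pos ys X \<longrightarrow> V Y = V' Y) \<longrightarrow> G X V = G X V')"

lemma acyclic_depsD:
  fixes G :: "'b \<Rightarrow> ('b \<Rightarrow> 'c) \<Rightarrow> 'c"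
  shows "acyclic_deps G ys \<Longrightarrow> X \<in> set ys \<Longrightarrow> (\<And>Y. Y \<in> set ys \<Longrightarrow> pos ys Y < pos ys X \<Longrightarrow> V Y = V' Y)
    \<Longrightarrow> G X V = G X V'"
  unfolding acyclic_deps_def by blast

text \<open>Appending a variable changes the solution only at this variable, and no right-hand side
  looks at the last variable, since dependencies point to strictly smaller positions.\<close>

lemma sol_eq:
  fixes G :: "'b \<Rightarrow> ('b \<Rightarrow> 'c) \<Rightarrow> 'c"
  shows "distinct ys \<Longrightarrow> acyclic_deps G ys \<Longrightarrow> X \<in> set ys \<Longrightarrow> sol G ys X = G X (sol G ys)"
proof (induction ys arbitrary: X rule: rev_induct)
  case (snoc y ys)
  let ?V = "sol G ys" and ?W = "sol G (ys @ [y])"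
  have W: "?W = ?V(y := G y ?V)" by (simp add: sol_def)
  have dep: "acyclic_deps G ys"
    unfolding acyclic_deps_def
  proof (intro ballI allI impI)
    fix X and V V' :: "'b \<Rightarrow> 'c" assume X: "X \<in> set ys" and eq: "\<forall>Y\<in>set ys. pos ys Y < pos ys X \<longrightarrow> V Y = V' Y"
    show "G X V = G X V'"
    proof (rule acyclic_depsD[OF snoc.prems(2)])
      fix Y assume Y: "Y \<in> set (ys @ [y])" and lt: "pos (ys @ [y]) Y < pos (ys @ [y]) X"
      have "Y \<in> set ys"
      proof (rule ccontr)
        assume "Y \<notin> set ys"
        then have "Y = y" "y \<notin> set ys" using Y by auto
        then have "pos (ys @ [y]) Y = length ys" by (simp add: pos_snoc)
        with lt X pos_less[OF X] show False by (simp add: pos_append)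
      qed
      then show "V Y = V' Y" using eq lt X by (simp add: pos_append)
    qed (use X in simp)
  qed
  have y: "y \<notin> set ys" using snoc.prems(1) by simp
  have agree: "?V Y = ?W Y" if "X \<in> set (ys @ [y])" "Y \<in> set (ys @ [y])"
    "pos (ys @ [y]) Y < pos (ys @ [y]) X" for X Y
  proof -
    have "Y \<noteq> y"
    proof
      assume "Y = y"
      then have "pos (ys @ [y]) Y = length ys" using y by (simp add: pos_snoc)
      moreover have "pos (ys @ [y]) X < length (ys @ [y])" using that(1) by (rule pos_less)
      ultimately show False using that(3) by simp
    qed
    then show ?thesis by (simp add: W)
  qed
  have G: "G X ?V = G X ?W" by (rule acyclic_depsD[OF snoc.prems(2,3)]) (rule agree[OF snoc.prems(3)])
  show ?case
  proof (cases "X = y")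
    case True
    then show ?thesis using G by (simp add: W fun_upd_same del: fun_upd_apply)
  next
    case False
    then have "?W X = ?V X" by (simp add: W)
    also have "\<dots> = G X ?V" using snoc.prems False by (intro snoc.IH dep) auto
    finally show ?thesis using G by simp
  qed
qed simp

lemma sol_cong:
  assumes "distinct ys" "acyclic_deps G ys" "acyclic_deps G' ys"
    and "\<And>X V. X \<in> set ys \<Longrightarrow> pos ys X \<le> k \<Longrightarrow> G X V = G' X V"
  shows "X \<in> set ys \<Longrightarrow> pos ys X \<le> k \<Longrightarrow> sol G ys X = sol G' ys X"
proof (induction "pos ys X" arbitrary: X rule: less_induct)
  case less
  have "sol G ys X = G X (sol G ys)" using assms less by (intro sol_eq)
  also have "\<dots> = G X (sol G' ys)" 
    by (rule acyclic_depsD[OF assms(2) less.prems(1)]) (use less in simp)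
  also have "\<dots> = G' X (sol G' ys)" using assms(4) less by auto
  also have "\<dots> = sol G' ys X" using assms less by (intro sol_eq[symmetric])
  finally show ?case .
qed


section \<open>Subformulas, scopes and substitution\<close>

lemma subformulas_refl [simp]: "\<phi> \<in> subformulas \<phi>"
  by (cases \<phi>) auto

lemma subformulas_trans: "\<psi> \<in> subformulas \<phi> \<Longrightarrow> \<chi> \<in> subformulas \<psi> \<Longrightarrow> \<chi> \<in> subformulas \<phi>"
  by (induction \<phi>) auto

lemma len_subformulas: "\<psi> \<in> subformulas \<phi> \<Longrightarrow> len \<psi> \<le> len \<phi>"
  by (induction \<phi>) auto

lemma finite_subformulas: "finite (subformulas \<phi>)"
  by (induction \<phi>) auto

text \<open>Charge one symbol to every subformula. As \<open>len\<close> counts a binder as two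
  symbols, one symbol per binder is left over; this surplus later makes the names of a variable
  outnumber the closure.\<close>

lemma card_subformulas: "card (subformulas \<phi>) + length (binders \<phi>) \<le> len \<phi>"
proof (induction \<phi>)
  case (PConj \<phi> \<psi>)
  have "card (subformulas (PConj \<phi> \<psi>)) \<le> Suc (card (subformulas \<phi> \<union> subformulas \<psi>))"
    by (simp add: card_insert_le_m1 card_insert_if finite_subformulas)
  then show ?case using PConj card_Un_le[of "subformulas \<phi>" "subformulas \<psi>"] by simp
next
  case (PDisj \<phi> \<psi>)
  have "card (subformulas (PDisj \<phi> \<psi>)) \<le> Suc (card (subformulas \<phi> \<union> subformulas \<psi>))"
    by (simp add: card_insert_le_m1 card_insert_if finite_subformulas)
  then show ?case using PDisj card_Un_le[of "subformulas \<phi>" "subformulas \<psi>"] by simp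
qed (simp_all add: card_insert_if finite_subformulas)

lemma set_binders: "X \<in> set (binders \<phi>) \<longleftrightarrow> (\<exists>\<sigma> \<psi>. PFix \<sigma> X \<psi> \<in> subformulas \<phi>)"
  by (induction \<phi>) auto

lemma PFix_unique:
  "distinct (binders \<phi>) \<Longrightarrow> PFix \<sigma> X \<psi> \<in> subformulas \<phi> \<Longrightarrow> PFix \<sigma>' X \<psi>' \<in> subformulas \<phi> \<Longrightarrow>
    \<sigma> = \<sigma>' \<and> \<psi> = \<psi>'"
proof (induction \<phi>)
  case (PConj \<phi>1 \<phi>2)
  then show ?case using set_binders[of X \<phi>1] set_binders[of X \<phi>2] by auto
next
  case (PDisj \<phi>1 \<phi>2)
  then show ?case using set_binders[of X \<phi>1] set_binders[of X \<phi>2] by auto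
next
  case (PFix \<sigma>'' Y \<phi>)
  then show ?case using set_binders[of X \<phi>] by auto
qed auto

lemma free_var_scope:
  "\<psi> \<in> subformulas \<phi> \<Longrightarrow> Y \<in> free_vars \<psi> \<Longrightarrow>
    Y \<in> free_vars \<phi> \<or> (\<exists>\<sigma> \<chi>. PFix \<sigma> Y \<chi> \<in> subformulas \<phi> \<and> \<psi> \<in> subformulas \<chi>)"
proof (induction \<phi>)
  case (PFix \<sigma> Z \<phi>)
  then show ?case by (cases "Y = Z") auto
qed auto

text \<open>Not capture-avoiding either; only closed formulas and the bound variables themselves are inserted.\<close>

primrec msubst :: "('v \<Rightarrow> ('v, 'p, 'a) pform) \<Rightarrow> ('v, 'p, 'a) pform \<Rightarrow> ('v, 'p, 'a) pform" where
  "msubst \<theta> (PVar Y) = \<theta> Y"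
| "msubst \<theta> (PProp P) = PProp P"
| "msubst \<theta> (PNeg P) = PNeg P"
| "msubst \<theta> PTrue = PTrue"
| "msubst \<theta> PFalse = PFalse"
| "msubst \<theta> (PConj \<phi> \<psi>) = PConj (msubst \<theta> \<phi>) (msubst \<theta> \<psi>)"
| "msubst \<theta> (PDisj \<phi> \<psi>) = PDisj (msubst \<theta> \<phi>) (msubst \<theta> \<psi>)"
| "msubst \<theta> (PBox a \<phi>) = PBox a (msubst \<theta> \<phi>)"
| "msubst \<theta> (PDia a \<phi>) = PDia a (msubst \<theta> \<phi>)"
| "msubst \<theta> (PFix \<sigma> Y \<phi>) = PFix \<sigma> Y (msubst (\<theta>(Y := PVar Y)) \<phi>)"

lemma msubst_cong: "(\<And>Y. Y \<in> free_vars \<phi> \<Longrightarrow> \<theta> Y = \<theta>' Y) \<Longrightarrow> msubst \<theta> \<phi> = msubst \<theta>' \<phi>"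
proof (induction \<phi> arbitrary: \<theta> \<theta>')
  case (PConj \<phi>1 \<phi>2)
  show ?case using PConj.IH[of \<theta> \<theta>'] PConj.prems by simp
next
  case (PDisj \<phi>1 \<phi>2)
  show ?case using PDisj.IH[of \<theta> \<theta>'] PDisj.prems by simp
next
  case (PFix \<sigma> Z \<phi>)
  have "msubst (\<theta>(Z := PVar Z)) \<phi> = msubst (\<theta>'(Z := PVar Z)) \<phi>"
    by (rule PFix.IH) (simp add: PFix.prems)
  then show ?case by (simp del: fun_upd_apply)
next
  case (PBox a \<phi>)
  show ?case using PBox.IH[of \<theta> \<theta>'] PBox.prems by simp
next
  case (PDia a \<phi>)
  show ?case using PDia.IH[of \<theta> \<theta>'] PDia.prems by simp
qed auto

lemma msubst_closed: "free_vars \<phi> = {} \<Longrightarrow> msubst \<theta> \<phi> = \<phi>"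
proof -
  have "msubst PVar \<phi> = \<phi>" by (induction \<phi>) (simp_all add: fun_upd_idem)
  then show "free_vars \<phi> = {} \<Longrightarrow> msubst \<theta> \<phi> = \<phi>" using msubst_cong[of \<phi> \<theta> PVar] by simp
qed

lemma free_vars_msubst: "free_vars (msubst \<theta> \<phi>) \<subseteq> (\<Union>Y\<in>free_vars \<phi>. free_vars (\<theta> Y))"
proof (induction \<phi> arbitrary: \<theta>)
  case (PFix \<sigma> Z \<phi>)
  show ?case
  proof
    fix x assume x: "x \<in> free_vars (msubst \<theta> (PFix \<sigma> Z \<phi>))"
    then have "x \<in> free_vars (msubst (\<theta>(Z := PVar Z)) \<phi>)" by (simp del: fun_upd_apply)
    then obtain Y where "Y \<in> free_vars \<phi>" "x \<in> free_vars ((\<theta>(Z := PVar Z)) Y)"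
      using PFix[of "\<theta>(Z := PVar Z)"] by blast
    then show "x \<in> (\<Union>Y\<in>free_vars (PFix \<sigma> Z \<phi>). free_vars (\<theta> Y))"
      using x by (auto split: if_splits)
  qed
qed fastforce+

lemma subst_not_free: "Z \<notin> free_vars \<phi> \<Longrightarrow> subst Z \<chi> \<phi> = \<phi>"
  by (induction \<phi>) auto

text \<open>Expanding a fixed point leaves its bound variable in place; unfolding fills it in
  afterwards. The result is the same as a single simultaneous substitution.\<close>

lemma subst_msubst:
  "(\<And>Y. Y \<in> free_vars \<phi> \<Longrightarrow> Y \<noteq> Z \<Longrightarrow> Z \<notin> free_vars (\<theta> Y)) \<Longrightarrow>
    subst Z \<chi> (msubst (\<theta>(Z := PVar Z)) \<phi>) = msubst (\<theta>(Z := \<chi>)) \<phi>"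
proof (induction \<phi> arbitrary: \<theta>)
  case (PVar Y)
  then show ?case by (simp add: subst_not_free)
next
  case (PConj \<phi>1 \<phi>2)
  show ?case using PConj.IH[of \<theta>] PConj.prems by simp
next
  case (PDisj \<phi>1 \<phi>2)
  show ?case using PDisj.IH[of \<theta>] PDisj.prems by simp
next
  case (PBox a \<phi>)
  show ?case using PBox.IH[of \<theta>] PBox.prems by simp
next
  case (PDia a \<phi>)
  show ?case using PDia.IH[of \<theta>] PDia.prems by simp
next
  case (PFix \<sigma> Y \<phi>)
  show ?case
  proof (cases "Y = Z")
    case True
    then show ?thesis by (simp del: fun_upd_apply)
  next
    case False
    have "subst Z \<chi> (msubst ((\<theta>(Y := PVar Y))(Z := PVar Z)) \<phi>) = msubst ((\<theta>(Y := PVar Y))(Z := \<chi>)) \<phi>"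
      by (rule PFix.IH) (use PFix.prems False in auto)
    then show ?thesis using False by (simp add: fun_upd_twist del: fun_upd_apply)
  qed
qed auto

text \<open>The number of connectives outside the scope of modalities bounds the number of logical rules
  applied to a guarded formula and its descendants before a modal rule.\<close>

primrec outer_size :: "('v, 'p, 'a) pform \<Rightarrow> nat" where
  "outer_size (PVar Y) = 0"
| "outer_size (PProp P) = 0"
| "outer_size (PNeg P) = 0"
| "outer_size PTrue = 0"
| "outer_size PFalse = 0"
| "outer_size (PConj \<phi> \<psi>) = Suc (outer_size \<phi> + outer_size \<psi>)"
| "outer_size (PDisj \<phi> \<psi>) = Suc (outer_size \<phi> + outer_size \<psi>)"
| "outer_size (PBox a \<phi>) = 0"
| "outer_size (PDia a \<phi>) = 0"
| "outer_size (PFix \<sigma> Y \<phi>) = Suc (outer_size \<phi>)"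

text \<open>\<open>outer_size\<close> does not look below modalities, and all free occurrences of a
  guarded variable are there.\<close>

lemma outer_size_subst: "guarded_in Z \<phi> \<Longrightarrow> outer_size (subst Z \<chi> \<phi>) = outer_size \<phi>"
  by (induction \<phi>) auto

lemma guarded_in_not_free: "Z \<notin> free_vars \<phi> \<Longrightarrow> guarded_in Z \<phi>"
  by (induction \<phi>) auto

lemma guarded_in_msubst:
  "guarded_in Z \<phi> \<Longrightarrow> (\<And>Y. Y \<in> free_vars \<phi> \<Longrightarrow> Y \<noteq> Z \<Longrightarrow> Z \<notin> free_vars (\<theta> Y)) \<Longrightarrow>
    guarded_in Z (msubst \<theta> \<phi>)"
proof (induction \<phi> arbitrary: \<theta>)
  case (PFix \<sigma> Y \<phi>)
  show ?case
  proof (cases "Y = Z")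
    case False
    have "guarded_in Z (msubst (\<theta>(Y := PVar Y)) \<phi>)"
      by (rule PFix.IH) (use PFix.prems False in auto)
    then show ?thesis by simp
  qed simp
qed (auto simp: guarded_in_not_free)


section \<open>The closure\<close>

locale mu_formula =
  fixes \<gamma> :: "('v, 'p, 'a) pform" and xs :: "'v list"
  assumes closed: "closed_pform \<gamma>"
    and guarded: "guarded \<gamma>"
    and pnf: "positive_normal_form \<gamma>"
    and order: "var_order \<gamma> xs"
begin

lemma distinct_xs: "distinct xs" and set_xs: "set xs = vars_in \<gamma>"
  using order by (auto simp: var_order_def)

definition fix_of :: "'v \<Rightarrow> fixop \<times> ('v, 'p, 'a) pform" where
  "fix_of X = (SOME p. PFix (fst p) X (snd p) \<in> subformulas \<gamma>)"

definition op_of :: "'v \<Rightarrow> fixop" where "op_of X = fst (fix_of X)"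

definition body :: "'v \<Rightarrow> ('v, 'p, 'a) pform" where "body X = snd (fix_of X)"

lemma PFix_body: "X \<in> set xs \<Longrightarrow> PFix (op_of X) X (body X) \<in> subformulas \<gamma>"
proof -
  assume "X \<in> set xs"
  then have "\<exists>p. PFix (fst p) X (snd p) \<in> subformulas \<gamma>" by (auto simp: set_xs vars_in_def)
  then show ?thesis unfolding op_of_def body_def fix_of_def by (rule someI_ex)
qed

lemma PFix_subformula:
  assumes "PFix \<sigma> X \<psi> \<in> subformulas \<gamma>"
  shows "X \<in> set xs" "\<sigma> = op_of X" "\<psi> = body X"
proof -
  show X: "X \<in> set xs" using assms by (auto simp: set_xs vars_in_def)
  have "distinct (binders \<gamma>)" using pnf by (simp add: positive_normal_form_def)
  from PFix_unique[OF this assms PFix_body[OF X]] show "\<sigma> = op_of X" "\<psi> = body X" by auto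
qed

lemma body_subformula: "X \<in> set xs \<Longrightarrow> body X \<in> subformulas \<gamma>"
  by (rule subformulas_trans[OF PFix_body]) auto

lemma free_vars_subformula: "\<psi> \<in> subformulas \<gamma> \<Longrightarrow> free_vars \<psi> \<subseteq> set xs"
  using free_var_scope[of \<psi> \<gamma>] closed PFix_subformula(1) unfolding closed_pform_def by blast

lemma nu_vars_iff: "X \<in> nu_vars \<gamma> \<longleftrightarrow> X \<in> set xs \<and> op_of X = Nu"
  using PFix_body[of X] by (auto simp: nu_vars_def dest: PFix_subformula)

lemma more_outermost_pos: "more_outermost \<gamma> Y X \<Longrightarrow> pos xs Y < pos xs X"
  using order precedes_iff[OF distinct_xs] by (auto simp: var_order_def)

text \<open>Since \<gamma> is closed, \<open>Y\<close> is bound by a fixed point around that of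
  \<open>X\<close>, so \<open>Y\<close> is more outermost. This makes every system of equations
  indexed by the variables acyclic in the order \<open>xs\<close>.\<close>

lemma free_vars_body:
  assumes "X \<in> set xs" "Y \<in> free_vars (body X)" "Y \<noteq> X"
  shows "Y \<in> set xs" "pos xs Y < pos xs X"
proof -
  let ?f = "PFix (op_of X) X (body X)"
  have f: "?f \<in> subformulas \<gamma>" using assms(1) by (rule PFix_body)
  have "Y \<in> free_vars ?f" using assms by simp
  with free_var_scope[OF f this] closed obtain \<sigma> \<chi>
    where \<chi>: "PFix \<sigma> Y \<chi> \<in> subformulas \<gamma>" "?f \<in> subformulas \<chi>"
    by (auto simp: closed_pform_def)
  then show "Y \<in> set xs" by (auto dest: PFix_subformula)
  have "?f \<noteq> PFix \<sigma> Y \<chi>" using assms(3) by simp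
  with \<chi> have "more_outermost \<gamma> Y X" unfolding more_outermost_def
    by (intro exI[of _ "op_of X"] exI[of _ "body X"] exI[of _ \<sigma>] exI[of _ \<chi>]) simp
  then show "pos xs Y < pos xs X" by (rule more_outermost_pos)
qed

lemma binders_body:
  assumes "X \<in> set xs" "Y \<in> set (binders (body X))"
  shows "Y \<in> set xs" "pos xs X < pos xs Y"
proof -
  obtain \<sigma> \<psi> where Y: "PFix \<sigma> Y \<psi> \<in> subformulas (body X)"
    using assms(2) by (auto simp: set_binders)
  then show "Y \<in> set xs"
    using subformulas_trans[OF body_subformula[OF assms(1)]] PFix_subformula(1) by blast
  have "PFix \<sigma> Y \<psi> \<noteq> PFix (op_of X) X (body X)" using len_subformulas[OF Y] by auto
  with Y PFix_body[OF assms(1)] have "more_outermost \<gamma> X Y" unfolding more_outermost_def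
    by (intro exI[of _ \<sigma>] exI[of _ \<psi>] exI[of _ "op_of X"] exI[of _ "body X"]) simp
  then show "pos xs X < pos xs Y" by (rule more_outermost_pos)
qed

text \<open>\<open>expand\<close> replaces the free variables of a subformula of \<open>\<gamma>\<close> by the fixed points they stand for.\<close>

definition \<theta> :: "'v \<Rightarrow> ('v, 'p, 'a) pform" where
  "\<theta> = sol (\<lambda>X V. msubst V (PFix (op_of X) X (body X))) xs"

definition expand :: "('v, 'p, 'a) pform \<Rightarrow> ('v, 'p, 'a) pform" where
  "expand \<psi> = msubst \<theta> \<psi>"

lemma \<theta>_eq:
  assumes "X \<in> set xs"
  shows "\<theta> X = expand (PFix (op_of X) X (body X))"
proof -
  have "acyclic_deps (\<lambda>X V. msubst V (PFix (op_of X) X (body X))) xs"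
    unfolding acyclic_deps_def
  proof (intro ballI allI impI, rule msubst_cong)
    fix X V V' Y
    assume "X \<in> set xs" "\<forall>Y\<in>set xs. pos xs Y < pos xs X \<longrightarrow> V Y = V' Y"
      and "Y \<in> free_vars (PFix (op_of X) X (body X))"
    then show "V Y = V' Y" using free_vars_body[of X Y] by simp
  qed
  from sol_eq[OF distinct_xs this assms] show ?thesis
    unfolding \<theta>_def expand_def .
qed

lemma \<theta>_closed: "X \<in> set xs \<Longrightarrow> free_vars (\<theta> X) = {}"
proof (induction "pos xs X" arbitrary: X rule: less_induct)
  case less
  have "free_vars (\<theta> X) \<subseteq> (\<Union>Y\<in>free_vars (PFix (op_of X) X (body X)). free_vars (\<theta> Y))"
    unfolding \<theta>_eq[OF less.prems] expand_def by (rule free_vars_msubst)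
  also have "\<dots> \<subseteq> {}" using less free_vars_body by fastforce
  finally show ?case by simp
qed

text \<open>All \<open>\<theta> Y\<close> are closed, so nothing is captured, and unfolding a closed
  fixed point amounts to moving to the body of its variable inside \<gamma>. Guardedness gives the
  last claim.\<close>

lemma expand_fix:
  assumes X: "X \<in> set xs" and "\<theta> X = PFix \<sigma> Z \<phi>"
  shows "\<sigma> = op_of X" "Z = X" "unfold_fix \<sigma> Z \<phi> = expand (body X)"
    "outer_size (unfold_fix \<sigma> Z \<phi>) = outer_size \<phi>"
proof -
  have eq: "PFix \<sigma> Z \<phi> = PFix (op_of X) X (msubst (\<theta>(X := PVar X)) (body X))"
    using \<theta>_eq[OF X] assms(2) by (simp add: expand_def)
  then show 1: "\<sigma> = op_of X" "Z = X" by auto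
  have clo: "X \<notin> free_vars (\<theta> Y)" if "Y \<in> free_vars (body X)" for Y
    using that free_vars_subformula[OF body_subformula[OF X]] \<theta>_closed by blast
  have "unfold_fix \<sigma> Z \<phi> = subst X (\<theta> X) (msubst (\<theta>(X := PVar X)) (body X))"
    using eq assms(2) by (simp add: unfold_fix_def)
  also have "\<dots> = msubst (\<theta>(X := \<theta> X)) (body X)" by (rule subst_msubst) (rule clo)
  finally show "unfold_fix \<sigma> Z \<phi> = expand (body X)" by (simp add: expand_def)
  have "guarded_in X (body X)" using guarded PFix_body[OF X] by (auto simp: guarded_def)
  then have "guarded_in X (msubst (\<theta>(X := PVar X)) (body X))"
    by (rule guarded_in_msubst) (use clo in auto)
  then show "outer_size (unfold_fix \<sigma> Z \<phi>) = outer_size \<phi>"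
    using eq 1 by (simp add: unfold_fix_def outer_size_subst)
qed

text \<open>The ambiguity of expansions at fixed points: \<open>\<psi>\<close> is either the bound
  variable, where a loop closes, or the binding formula, where it is entered. The stage arguments
  treat the two cases differently.\<close>

lemma expand_PFixD:
  assumes "\<psi> \<in> subformulas \<gamma>" "expand \<psi> = PFix \<sigma> Z \<phi>"
  shows "Z \<in> set xs" "\<sigma> = op_of Z" "\<psi> = PVar Z \<or> \<psi> = PFix (op_of Z) Z (body Z)"
    "unfold_fix \<sigma> Z \<phi> = expand (body Z)" "outer_size (unfold_fix \<sigma> Z \<phi>) = outer_size \<phi>"
proof -
  have "\<exists>X. X \<in> set xs \<and> \<theta> X = PFix \<sigma> Z \<phi> \<and> (\<psi> = PVar X \<or> \<psi> = PFix (op_of X) X (body X))"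
  proof (cases \<psi>)
    case (PVar X)
    then show ?thesis using assms free_vars_subformula[OF assms(1)] by (simp add: expand_def)
  next
    case (PFix \<sigma>' X \<psi>')
    then show ?thesis using assms PFix_subformula[of \<sigma>' X \<psi>'] \<theta>_eq[of X] by auto
  qed (use assms in \<open>auto simp: expand_def\<close>)
  then obtain X where X: "X \<in> set xs" "\<theta> X = PFix \<sigma> Z \<phi>" "\<psi> = PVar X \<or> \<psi> = PFix (op_of X) X (body X)"
    by blast
  with expand_fix[OF X(1,2)] show "Z \<in> set xs" "\<sigma> = op_of Z" "\<psi> = PVar Z \<or> \<psi> = PFix (op_of Z) Z (body Z)"
    "unfold_fix \<sigma> Z \<phi> = expand (body Z)" "outer_size (unfold_fix \<sigma> Z \<phi>) = outer_size \<phi>"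
    by auto
qed

lemma expand_PVar: "PVar X \<in> subformulas \<gamma> \<Longrightarrow> \<exists>\<phi>. expand (PVar X) = PFix (op_of X) X \<phi>"
  using free_vars_subformula[of "PVar X"] \<theta>_eq[of X] by (auto simp: expand_def)

lemma expand_PPropD: "\<psi> \<in> subformulas \<gamma> \<Longrightarrow> expand \<psi> = PProp P \<Longrightarrow> \<psi> = PProp P"
  using expand_PVar by (cases \<psi>) (fastforce simp: expand_def)+

lemma expand_PNegD: "\<psi> \<in> subformulas \<gamma> \<Longrightarrow> expand \<psi> = PNeg P \<Longrightarrow> \<psi> = PNeg P"
  using expand_PVar by (cases \<psi>) (fastforce simp: expand_def)+

lemma expand_PTrueD: "\<psi> \<in> subformulas \<gamma> \<Longrightarrow> expand \<psi> = PTrue \<Longrightarrow> \<psi> = PTrue"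
  using expand_PVar by (cases \<psi>) (fastforce simp: expand_def)+

lemma expand_PConjD: "\<psi> \<in> subformulas \<gamma> \<Longrightarrow> expand \<psi> = PConj \<phi>1 \<phi>2 \<Longrightarrow>
    \<exists>\<psi>1 \<psi>2. \<psi> = PConj \<psi>1 \<psi>2 \<and> \<phi>1 = expand \<psi>1 \<and> \<phi>2 = expand \<psi>2"
  using expand_PVar by (cases \<psi>) (fastforce simp: expand_def)+

lemma expand_PDisjD: "\<psi> \<in> subformulas \<gamma> \<Longrightarrow> expand \<psi> = PDisj \<phi>1 \<phi>2 \<Longrightarrow>
    \<exists>\<psi>1 \<psi>2. \<psi> = PDisj \<psi>1 \<psi>2 \<and> \<phi>1 = expand \<psi>1 \<and> \<phi>2 = expand \<psi>2"
  using expand_PVar by (cases \<psi>) (fastforce simp: expand_def)+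

lemma expand_PBoxD: "\<psi> \<in> subformulas \<gamma> \<Longrightarrow> expand \<psi> = PBox a \<phi> \<Longrightarrow> \<exists>\<psi>'. \<psi> = PBox a \<psi>' \<and> \<phi> = expand \<psi>'"
  using expand_PVar by (cases \<psi>) (fastforce simp: expand_def)+

lemma expand_PDiaD: "\<psi> \<in> subformulas \<gamma> \<Longrightarrow> expand \<psi> = PDia a \<phi> \<Longrightarrow> \<exists>\<psi>'. \<psi> = PDia a \<psi>' \<and> \<phi> = expand \<psi>'"
  using expand_PVar by (cases \<psi>) (fastforce simp: expand_def)+

lemma sub_componentsD:
  "PConj \<psi>1 \<psi>2 \<in> subformulas \<gamma> \<Longrightarrow> \<psi>1 \<in> subformulas \<gamma> \<and> \<psi>2 \<in> subformulas \<gamma>"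
  "PDisj \<psi>1 \<psi>2 \<in> subformulas \<gamma> \<Longrightarrow> \<psi>1 \<in> subformulas \<gamma> \<and> \<psi>2 \<in> subformulas \<gamma>"
  "PBox a \<psi>1 \<in> subformulas \<gamma> \<Longrightarrow> \<psi>1 \<in> subformulas \<gamma>"
  "PDia a \<psi>1 \<in> subformulas \<gamma> \<Longrightarrow> \<psi>1 \<in> subformulas \<gamma>"
  by (auto intro: subformulas_trans)

text \<open>Unfolding leads to the expansion of another subformula, so the closure is no larger than
  the set of subformulas.\<close>

lemma clos_expand: "\<phi> \<in> clos \<gamma> \<Longrightarrow> \<exists>\<psi>\<in>subformulas \<gamma>. \<phi> = expand \<psi>"
proof (induction rule: clos.induct)
  case 1
  show ?case using closed
    by (intro bexI[of _ \<gamma>]) (auto simp: expand_def closed_pform_def msubst_closed)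
next
  case (8 \<sigma> Z \<phi>)
  then obtain \<psi> where "\<psi> \<in> subformulas \<gamma>" "expand \<psi> = PFix \<sigma> Z \<phi>" by metis
  from expand_PFixD[OF this] show ?case using body_subformula by blast
qed (metis expand_PConjD expand_PDisjD expand_PBoxD expand_PDiaD sub_componentsD)+

lemma outer_size_unfold:
  "PFix \<sigma> Z \<phi> \<in> clos \<gamma> \<Longrightarrow> outer_size (unfold_fix \<sigma> Z \<phi>) = outer_size \<phi>"
  using clos_expand expand_PFixD(5) by metis

lemma clos_PFix: "PFix \<sigma> Z \<phi> \<in> clos \<gamma> \<Longrightarrow> Z \<in> set xs \<and> \<sigma> = op_of Z"
  using clos_expand expand_PFixD(1,2) by metis

lemma finite_clos: "finite (clos \<gamma>)"
proof -
  have "clos \<gamma> \<subseteq> expand ` subformulas \<gamma>" using clos_expand by blast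
  then show ?thesis using finite_subformulas finite_surj by blast
qed

lemma card_clos: "X \<in> set xs \<Longrightarrow> card (clos \<gamma>) < len \<gamma>"
proof -
  assume "X \<in> set xs"
  then have "X \<in> set (binders \<gamma>)" using PFix_body[of X] unfolding set_binders by blast
  \<comment> \<open>A variable in \<gamma> guarantees a binder, whose surplus symbol makes the final
    bound strict.\<close>
  then have "0 < length (binders \<gamma>)" by (cases "binders \<gamma>") auto
  moreover have "clos \<gamma> \<subseteq> expand ` subformulas \<gamma>" using clos_expand by blast
  then have "card (clos \<gamma>) \<le> card (subformulas \<gamma>)"
    using surj_card_le finite_subformulas by blast
  ultimately show ?thesis using card_subformulas[of \<gamma>] by linarith
qed

section \<open>Unfolding fixed points along stages\<close>

text \<open>\<open>val b T r\<close> interprets every variable of \<open>\<gamma>\<close> relative to the interpretations of the more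
  outermost ones: least fixed points (with respect to \<open>b\<close>) by their stage given by \<open>r\<close>, greatest
  ones exactly.\<close>

definition val_step ::
  "bool \<Rightarrow> ('s, 'p, 'a) kripke \<Rightarrow> ('v \<Rightarrow> 's stage) \<Rightarrow> 'v \<Rightarrow> ('v \<Rightarrow> 's set) \<Rightarrow> 's set" where
  "val_step b T r X V =
    (if op_of X = least_op b then approx (\<lambda>S. gsem b T (V(X := S)) (body X)) (r X)
     else gfp (\<lambda>S. gsem b T (V(X := S)) (body X)))"

definition val :: "bool \<Rightarrow> ('s, 'p, 'a) kripke \<Rightarrow> ('v \<Rightarrow> 's stage) \<Rightarrow> 'v \<Rightarrow> 's set" where
  "val b T r = sol (val_step b T r) xs"

lemma val_step_deps: "acyclic_deps (val_step b T r) xs"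
  for T :: "('s, 'p, 'a) kripke"
  unfolding acyclic_deps_def
proof (intro ballI allI impI)
  fix X and V V' :: "'v \<Rightarrow> 's set" assume X: "X \<in> set xs" and eq: "\<forall>Y\<in>set xs. pos xs Y < pos xs X \<longrightarrow> V Y = V' Y"
  have "gsem b T (V(X := S)) (body X) = gsem b T (V'(X := S)) (body X)" for S
    by (rule gsem_cong) (use free_vars_body[OF X] eq in auto)
  then show "val_step b T r X V = val_step b T r X V'" by (simp add: val_step_def)
qed

lemma val_eq: "X \<in> set xs \<Longrightarrow> val b T r X = val_step b T r X (val b T r)"
  unfolding val_def by (rule sol_eq[OF distinct_xs val_step_deps])

lemma val_cong:
  assumes "X \<in> set xs" "\<And>Y. Y \<in> set xs \<Longrightarrow> pos xs Y \<le> pos xs X \<Longrightarrow> r Y = r' Y"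
  shows "val b T r X = val b T r' X"
  unfolding val_def
  by (rule sol_cong[OF distinct_xs val_step_deps val_step_deps, where k = "pos xs X"])
    (use assms in \<open>auto simp: val_step_def\<close>)

text \<open>The free variables of the body other than \<open>X\<close> are more outermost than
  \<open>X\<close>, and their interpretations do not depend on the stage of
  \<open>X\<close>.\<close>

lemma gsem_body_cong:
  assumes "X \<in> set xs"
  shows "gsem b T ((val b T (r(X := c)))(X := S)) (body X) = gsem b T ((val b T r)(X := S)) (body X)"
proof (rule gsem_cong)
  fix Y assume Y: "Y \<in> free_vars (body X)"
  show "states T \<inter> ((val b T (r(X := c)))(X := S)) Y = states T \<inter> ((val b T r)(X := S)) Y"
  proof (cases "Y = X")
    case False
    note 1 = free_vars_body[OF assms Y False]
    have "val b T (r(X := c)) Y = val b T r Y" by (rule val_cong) (use 1 in auto)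
    then show ?thesis using False by simp
  qed simp
qed

text \<open>A variable of the least kind is interpreted by the stage \<open>r X\<close>, so
  belonging to it means satisfying the body at a smaller stage. At the binding formula
  \<open>lfp_approx\<close> supplies some stage without a bound. Fixed points of the other kind are
  interpreted exactly and unfold with unchanged stages.\<close>

lemma gsem_unfold:
  assumes X: "X \<in> set xs" and \<psi>: "\<psi> = PVar X \<or> \<psi> = PFix (op_of X) X (body X)"
    and s: "s \<in> gsem b T (val b T r) \<psi>"
  shows "\<exists>r'. s \<in> gsem b T (val b T r') (body X) \<and> (\<forall>Y. Y \<noteq> X \<longrightarrow> r' Y = r Y) \<and>
    (op_of X \<noteq> least_op b \<longrightarrow> r' = r) \<and> (op_of X = least_op b \<and> \<psi> = PVar X \<longrightarrow> r' X < r X)"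
proof -
  define f where "f = (\<lambda>S. gsem b T ((val b T r)(X := S)) (body X))"
  have mono: "mono f" unfolding f_def by (rule mono_gsem)
  show ?thesis
  proof (cases "op_of X = least_op b")
    case True
    have body: "gsem b T (val b T (r(X := c))) (body X) = f (approx f c)" for c
    proof -
      have "val b T (r(X := c)) X = approx f c"
        unfolding val_eq[OF X] val_step_def gsem_body_cong[OF X] f_def using True by simp
      then have "val b T (r(X := c)) = (val b T (r(X := c)))(X := approx f c)"
        by (metis fun_upd_triv)
      then have "gsem b T (val b T (r(X := c))) (body X) =
          gsem b T ((val b T (r(X := c)))(X := approx f c)) (body X)"
        by simp
      then show ?thesis unfolding gsem_body_cong[OF X] f_def .
    qed
    have var: "val b T r X = approx f (r X)"
      unfolding val_eq[OF X] val_step_def f_def using True by simp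
    have "\<exists>c. s \<in> f (approx f c) \<and> (\<psi> = PVar X \<longrightarrow> c < r X)"
    proof (cases "\<psi> = PVar X")
      case True
      then show ?thesis using s approx_iff[of s f "r X"] by (auto simp: var)
    next
      case False
      then have "s \<in> lfp f" using s \<psi> True by (auto simp: f_def)
      then show ?thesis using lfp_approx[OF mono] False by auto
    qed
    then obtain c where "s \<in> f (approx f c)" "\<psi> = PVar X \<longrightarrow> c < r X" by blast
    then show ?thesis using True body by (intro exI[of _ "r(X := c)"]) simp
  next
    case False
    have var: "val b T r X = gfp f"
      unfolding val_eq[OF X] val_step_def f_def using False by simp
    have "s \<in> gfp f" using \<psi> s False by (elim disjE) (simp_all add: f_def var)
    then have "s \<in> f (gfp f)" using gfp_fixpoint[OF mono] by simp
    then have "s \<in> f (val b T r X)" by (simp only: var)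
    then have "s \<in> gsem b T (val b T r) (body X)" by (simp only: f_def fun_upd_triv)
    then show ?thesis using False by blast
  qed
qed

end


section \<open>Soundness\<close>

definition evolves :: "'b list \<Rightarrow> 'b list \<Rightarrow> bool" where
  "evolves w w' \<longleftrightarrow> (\<exists>P new. w' = filter P w @ new \<and> set new \<inter> set w = {})"

lemma evolves_filter [simp]: "evolves w (filter P w)"
  unfolding evolves_def by (intro exI[of _ P] exI[of _ "[]"]) simp

lemma evolves_refl [simp]: "evolves w w"
  using evolves_filter[of w "\<lambda>_. True"] by simp

lemma evolves_snoc: "z \<notin> set w \<Longrightarrow> evolves w (filter P w @ [z])"
  unfolding evolves_def by (intro exI[of _ P] exI[of _ "[z]"]) simp

text \<open>New names are appended at the end and survivors keep their order, so the part in front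
  of a surviving \<open>z\<close> can only lose names.\<close>

lemma evolves_takeWhile:
  assumes "evolves w w'" "z \<in> set w" "z \<in> set w'"
  shows "subseq (takeWhile (\<lambda>y. y \<noteq> z) w') (takeWhile (\<lambda>y. y \<noteq> z) w)"
proof -
  obtain P new where w': "w' = filter P w @ new" and new: "set new \<inter> set w = {}"
    using assms(1) unfolding evolves_def by blast
  then have z: "z \<in> set (filter P w)" using assms by auto
  then have "P z" by simp
  then have "takeWhile (\<lambda>y. y \<noteq> z) w' = takeWhile (\<lambda>y. y \<noteq> z) (filter P w)"
    unfolding w' using z by (subst takeWhile_append1[of z]) auto
  also have "\<dots> = filter P (takeWhile (\<lambda>y. y \<noteq> z) w)"
    using \<open>P z\<close> by (induction w) auto
  finally show ?thesis by simp
qed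

lemma prefix_takeWhile: "z \<in> set w \<Longrightarrow> prefix (takeWhile (\<lambda>y. y \<noteq> z) w @ [z]) w"
  by (induction w) auto

text \<open>Along a loop that never loses \<open>z\<close>, the part in front of \<open>z\<close>
  shrinks with respect to \<open>subseq\<close>. It is the same at both ends, so by antisymmetry it
  is constant.\<close>

lemma evolves_return:
  assumes "successively evolves (w # ws @ [w])" and "\<And>w'. w' \<in> set ws \<Longrightarrow> z \<in> set w'" and "z \<in> set w"
    and "w' \<in> set ws"
  shows "prefix (takeWhile (\<lambda>y. y \<noteq> z) w @ [z]) w'"
proof -
  define up where "up = takeWhile (\<lambda>y. y \<noteq> z)"
  define R where "R = (\<lambda>w w'. subseq (up w') (up w))"
  have "successively R (w # ws @ [w])"
    by (rule successively_mono[OF assms(1)])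
      (use assms(2,3) evolves_takeWhile[of _ _ z] in \<open>auto simp: R_def up_def\<close>)
  moreover have "transp R" unfolding R_def by (auto intro!: transpI intro: subseq_order.order_trans)
  ultimately have "sorted_wrt R (w # ws @ [w])" by (simp add: successively_conv_sorted_wrt)
  then have "R w w'" "R w' w" using assms(4) by (auto simp: sorted_wrt_append)
  then have "up w' = up w" unfolding R_def by (simp add: subseq_order.antisym)
  moreover have "prefix (up w' @ [z]) w'" unfolding up_def using assms(2,4) by (intro prefix_takeWhile)
  ultimately show ?thesis by (simp add: up_def)
qed

section \<open>Lexicographic comparison of stages along a list of names\<close>

lemma lex_append_less:
  fixes a b :: "('c :: linorder) list"
  shows "length a = length b \<Longrightarrow> a < b \<Longrightarrow> a @ c < b @ d"
  by (induction a b rule: list_induct2) auto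

lemma lex_append_le:
  fixes a b :: "('c :: linorder) list"
  shows "length a = length b \<Longrightarrow> a @ c < b @ d \<Longrightarrow> a \<le> b"
  by (induction a b rule: list_induct2) auto

lemma lex_map_le:
  fixes f g :: "'b \<Rightarrow> 'c :: linorder"
  shows "(\<And>z. z \<in> set p \<Longrightarrow> f z \<le> g z) \<Longrightarrow> map f p \<le> map g p"
proof (induction p)
  case (Cons a p)
  then have "f a \<le> g a" "map f p \<le> map g p" by auto
  then show ?case by (auto simp: le_less)
qed simp

lemma lex_map_less:
  fixes f g :: "'b \<Rightarrow> 'c :: linorder"
  shows "(\<And>z. z \<in> set p \<Longrightarrow> f z \<le> g z) \<Longrightarrow> z \<in> set p \<Longrightarrow> f z < g z \<Longrightarrow> map f p < map g p"
proof (induction p)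
  case (Cons a p)
  then show ?case by (cases "f a = g a") (auto simp: less_le)
qed simp

text \<open>All compared lists have the length of \<open>p\<close>; without such a bound the
  lexicographic order would not be well-founded.\<close>

lemma wf_lex_map: "wf {(f, g :: 'b \<Rightarrow> 'c :: wellorder). map f p < map g p}"
proof (rule wf_subset)
  show "wf (inv_image (lex {(x, y :: 'c). x < y}) (\<lambda>f. map f p))"
    by (intro wf_inv_image wf_lex wf)
  show "{(f, g :: 'b \<Rightarrow> 'c). map f p < map g p} \<subseteq> inv_image (lex {(x, y). x < y}) (\<lambda>f. map f p)"
    by (auto simp: list_less_def lexord_lex)
qed

section \<open>Refuted formulas and the stages of their names\<close>

context mu_formula
begin

text \<open>A later name of the same variable stands for a later unfolding. The strict drop between
  two such names is what a reset exploits.\<close>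

abbreviation decreasing :: "('v name \<Rightarrow> 's stage) \<Rightarrow> 'v name list \<Rightarrow> bool" where
  "decreasing \<alpha> \<equiv> sorted_wrt (\<lambda>z z'. fst z = fst z' \<longrightarrow> \<alpha> z' < \<alpha> z)"

text \<open>A formula of the closure may expand several subformulas \<open>\<psi>\<close> of \<open>\<gamma>\<close>, so one of them is
  chosen together with stages \<open>r\<close> for the variables, which are bounded by those of the names.\<close>

definition refuted ::
  "('s, 'p, 'a) kripke \<Rightarrow> 's \<Rightarrow> ('v name \<Rightarrow> 's stage) \<Rightarrow> ('v, 'p, 'a) pform \<Rightarrow> 'v name list \<Rightarrow> bool" where
  "refuted T s \<alpha> \<phi> u \<longleftrightarrow> (\<exists>\<psi> r. \<psi> \<in> subformulas \<gamma> \<and> \<phi> = expand \<psi> \<and> s \<in> gsem False T (val False T r) \<psi> \<and>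
     (\<forall>z\<in>set u. r (fst z) \<le> \<alpha> z \<and> fst z \<notin> set (binders \<psi>)) \<and>
     decreasing \<alpha> u)"

definition all_refuted ::
  "('s, 'p, 'a) kripke \<Rightarrow> 's \<Rightarrow> ('v name \<Rightarrow> 's stage) \<Rightarrow> ('v, 'p, 'a) iform set \<Rightarrow> bool" where
  "all_refuted T s \<alpha> \<Gamma> \<longleftrightarrow> (\<forall>(\<phi>, u)\<in>\<Gamma>. refuted T s \<alpha> \<phi> u)"

lemma refutedI:
  "\<psi> \<in> subformulas \<gamma> \<Longrightarrow> \<phi> = expand \<psi> \<Longrightarrow> s \<in> gsem False T (val False T r) \<psi> \<Longrightarrow>
   (\<And>z. z \<in> set u \<Longrightarrow> r (fst z) \<le> \<alpha> z) \<Longrightarrow> (\<And>z. z \<in> set u \<Longrightarrow> fst z \<notin> set (binders \<psi>)) \<Longrightarrow>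
   decreasing \<alpha> u \<Longrightarrow> refuted T s \<alpha> \<phi> u"
  unfolding refuted_def by blast

lemma refutedE:
  assumes "refuted T s \<alpha> \<phi> u"
  obtains \<psi> r where "\<psi> \<in> subformulas \<gamma>" "expand \<psi> = \<phi>" "s \<in> gsem False T (val False T r) \<psi>"
    "\<forall>z\<in>set u. r (fst z) \<le> \<alpha> z \<and> fst z \<notin> set (binders \<psi>)"
    "decreasing \<alpha> u"
  using assms that unfolding refuted_def by blast

lemma refuted_cong:
  assumes "refuted T s \<alpha> \<phi> u" "\<And>z. z \<in> set u \<Longrightarrow> \<alpha>' z = \<alpha> z"
  shows "refuted T s \<alpha>' \<phi> u"
proof -
  obtain \<psi> r where *: "\<psi> \<in> subformulas \<gamma>" "\<phi> = expand \<psi>" "s \<in> gsem False T (val False T r) \<psi>"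
    "\<forall>z\<in>set u. r (fst z) \<le> \<alpha> z \<and> fst z \<notin> set (binders \<psi>)"
    "decreasing \<alpha> u"
    using assms(1) unfolding refuted_def by blast
  have "decreasing \<alpha>' u"
    by (rule sorted_wrt_mono_rel[OF _ *(5)]) (use assms(2) in auto)
  then show ?thesis using * assms(2) by (intro refutedI[of \<psi>]) auto
qed

lemma refuted_Disj:
  assumes "refuted T s \<alpha> (PDisj \<phi> \<psi>) u"
  shows "refuted T s \<alpha> \<phi> u" "refuted T s \<alpha> \<psi> u"
proof -
  obtain \<chi> r where *: "\<chi> \<in> subformulas \<gamma>" "expand \<chi> = PDisj \<phi> \<psi>" "s \<in> gsem False T (val False T r) \<chi>"
    "\<forall>z\<in>set u. r (fst z) \<le> \<alpha> z \<and> fst z \<notin> set (binders \<chi>)"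
    "decreasing \<alpha> u"
    using assms(1) by (rule refutedE)
  from expand_PDisjD[OF *(1,2)] obtain \<chi>1 \<chi>2
    where \<chi>: "\<chi> = PDisj \<chi>1 \<chi>2" "\<phi> = expand \<chi>1" "\<psi> = expand \<chi>2" by blast
  then have sub: "\<chi>1 \<in> subformulas \<gamma>" "\<chi>2 \<in> subformulas \<gamma>" using * sub_componentsD by blast+
  show "refuted T s \<alpha> \<phi> u" using * \<chi> sub by (intro refutedI[of \<chi>1 _ s T r]) auto
  show "refuted T s \<alpha> \<psi> u" using * \<chi> sub by (intro refutedI[of \<chi>2 _ s T r]) auto
qed

lemma refuted_Conj:
  assumes "refuted T s \<alpha> (PConj \<phi> \<psi>) u"
  shows "refuted T s \<alpha> \<phi> u \<or> refuted T s \<alpha> \<psi> u"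
proof -
  obtain \<chi> r where *: "\<chi> \<in> subformulas \<gamma>" "expand \<chi> = PConj \<phi> \<psi>" "s \<in> gsem False T (val False T r) \<chi>"
    "\<forall>z\<in>set u. r (fst z) \<le> \<alpha> z \<and> fst z \<notin> set (binders \<chi>)"
    "decreasing \<alpha> u"
    using assms(1) by (rule refutedE)
  from expand_PConjD[OF *(1,2)] obtain \<chi>1 \<chi>2
    where \<chi>: "\<chi> = PConj \<chi>1 \<chi>2" "\<phi> = expand \<chi>1" "\<psi> = expand \<chi>2" by blast
  then have sub: "\<chi>1 \<in> subformulas \<gamma>" "\<chi>2 \<in> subformulas \<gamma>" using * sub_componentsD by blast+
  from * \<chi> consider "s \<in> gsem False T (val False T r) \<chi>1" | "s \<in> gsem False T (val False T r) \<chi>2"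
    by auto
  then show ?thesis
  proof cases
    case 1
    then have "refuted T s \<alpha> \<phi> u" using * \<chi> sub by (intro refutedI[of \<chi>1 _ s T r]) auto
    then show ?thesis ..
  next
    case 2
    then have "refuted T s \<alpha> \<psi> u" using * \<chi> sub by (intro refutedI[of \<chi>2 _ s T r]) auto
    then show ?thesis ..
  qed
qed

lemma refuted_Box:
  assumes "refuted T s \<alpha> (PBox a \<phi>) u"
  shows "\<exists>t. (s, t) \<in> steps T a \<and> refuted T t \<alpha> \<phi> u"
proof -
  obtain \<chi> r where *: "\<chi> \<in> subformulas \<gamma>" "expand \<chi> = PBox a \<phi>" "s \<in> gsem False T (val False T r) \<chi>"
    "\<forall>z\<in>set u. r (fst z) \<le> \<alpha> z \<and> fst z \<notin> set (binders \<chi>)"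
    "decreasing \<alpha> u"
    using assms(1) by (rule refutedE)
  from expand_PBoxD[OF *(1,2)] obtain \<chi>' where \<chi>: "\<chi> = PBox a \<chi>'" "\<phi> = expand \<chi>'" by blast
  then have sub: "\<chi>' \<in> subformulas \<gamma>" using * sub_componentsD by blast
  from * \<chi> obtain t where "(s, t) \<in> steps T a" "t \<in> gsem False T (val False T r) \<chi>'" by auto
  moreover from this have "refuted T t \<alpha> \<phi> u" using * \<chi> sub by (intro refutedI[of \<chi>' _ t T r]) auto
  ultimately show ?thesis by blast
qed

lemma refuted_Dia:
  assumes "refuted T s \<alpha> (PDia a \<phi>) u" "(s, t) \<in> steps T a"
  shows "refuted T t \<alpha> \<phi> u"
proof -
  obtain \<chi> r where *: "\<chi> \<in> subformulas \<gamma>" "expand \<chi> = PDia a \<phi>" "s \<in> gsem False T (val False T r) \<chi>"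
    "\<forall>z\<in>set u. r (fst z) \<le> \<alpha> z \<and> fst z \<notin> set (binders \<chi>)"
    "decreasing \<alpha> u"
    using assms(1) by (rule refutedE)
  from expand_PDiaD[OF *(1,2)] obtain \<chi>' where \<chi>: "\<chi> = PDia a \<chi>'" "\<phi> = expand \<chi>'" by blast
  then have sub: "\<chi>' \<in> subformulas \<gamma>" using * sub_componentsD by blast
  from * \<chi> assms(2) have "t \<in> gsem False T (val False T r) \<chi>'" by auto
  then show ?thesis using * \<chi> sub by (intro refutedI[of \<chi>' _ t T r]) auto
qed

text \<open>Restricting the index at an unfolding of \<open>Z\<close> discards the names of all
  variables bound in its body. This restores the side condition on binders in
  \<open>refuted\<close>.\<close>

lemma binders_restrict_names:
  assumes "Z \<in> set xs" "z \<in> set (restrict_names xs u Z)"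
  shows "z \<in> set u" "fst z \<notin> set (binders (body Z))"
  using assms binders_body[OF assms(1)] precedes_iff[OF distinct_xs]
  by (auto simp: restrict_names_def)

lemma refuted_Mu:
  assumes "refuted T s \<alpha> (PFix Mu Z \<phi>) u"
  shows "refuted T s \<alpha> (unfold_fix Mu Z \<phi>) (restrict_names xs u Z)"
proof -
  obtain \<chi> r where *: "\<chi> \<in> subformulas \<gamma>" "expand \<chi> = PFix Mu Z \<phi>" "s \<in> gsem False T (val False T r) \<chi>"
    "\<forall>z\<in>set u. r (fst z) \<le> \<alpha> z \<and> fst z \<notin> set (binders \<chi>)"
    "decreasing \<alpha> u"
    using assms(1) by (rule refutedE)
  note Z = expand_PFixD[OF *(1,2)]
  have "s \<in> gsem False T (val False T r) (body Z)"
    using gsem_unfold[OF Z(1,3) *(3)] Z(2) by (auto simp: least_op_def)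
  moreover have "decreasing \<alpha> (restrict_names xs u Z)"
    using *(5) by (simp add: restrict_names_def sorted_wrt_filter)
  ultimately show ?thesis
    using * Z binders_restrict_names[OF Z(1), of _ u] body_subformula[OF Z(1)]
    by (intro refutedI[of "body Z" _ s T r]) auto
qed

text \<open>The new name receives the new stage of \<open>Z\<close>. If the index already contains a
  name of \<open>Z\<close>, the condition on binders in \<open>refuted\<close> excludes the binding
  formula, so \<open>\<chi>\<close> is the variable and the new stage is strictly below those of all
  earlier names of \<open>Z\<close>.\<close>

lemma refuted_Nu:
  assumes "refuted T s \<alpha> (PFix Nu Z \<phi>) u" "z \<notin> set u" "fst z = Z"
  shows "\<exists>c. refuted T s (\<alpha>(z := c)) (unfold_fix Nu Z \<phi>) (restrict_names xs u Z @ [z])"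
proof -
  obtain \<chi> r where *: "\<chi> \<in> subformulas \<gamma>" "expand \<chi> = PFix Nu Z \<phi>" "s \<in> gsem False T (val False T r) \<chi>"
    "\<forall>z\<in>set u. r (fst z) \<le> \<alpha> z \<and> fst z \<notin> set (binders \<chi>)"
    "decreasing \<alpha> u"
    using assms(1) by (rule refutedE)
  note Z = expand_PFixD[OF *(1,2)]
  from gsem_unfold[OF Z(1,3) *(3)] Z(2) obtain r'
    where r': "s \<in> gsem False T (val False T r') (body Z)" "\<And>Y. Y \<noteq> Z \<Longrightarrow> r' Y = r Y"
      "\<chi> = PVar Z \<Longrightarrow> r' Z < r Z"
    by (auto simp: least_op_def)
  let ?u = "restrict_names xs u Z" and ?\<alpha> = "\<alpha>(z := r' Z)"
  have sub: "y \<in> set u" "y \<noteq> z" if "y \<in> set ?u" for y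
    using binders_restrict_names(1)[OF Z(1) that] assms(2) by auto
  have Zless: "r' Z < \<alpha> y" if y: "y \<in> set u" "fst y = Z" for y
  proof -
    have "\<chi> = PVar Z" using Z(3) *(4) y by auto
    then show ?thesis using r'(3) *(4) y by force
  qed
  have "decreasing \<alpha> ?u"
    using *(5) by (simp add: restrict_names_def sorted_wrt_filter)
  then have "decreasing ?\<alpha> ?u"
    by (rule sorted_wrt_mono_rel[rotated]) (use sub in auto)
  then have sorted: "decreasing ?\<alpha> (?u @ [z])"
    using sub Zless assms(3) by (auto simp: sorted_wrt_append)
  have "refuted T s ?\<alpha> (unfold_fix Nu Z \<phi>) (?u @ [z])"
  proof (rule refutedI[of "body Z" _ s T r'])
    fix y assume y: "y \<in> set (?u @ [z])"
    show "r' (fst y) \<le> ?\<alpha> y"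
    proof (cases "y = z")
      case False
      then have "y \<in> set u" using y sub by auto
      then show ?thesis using False *(4) r'(2)[of "fst y"] Zless[of y]
        by (cases "fst y = Z") (auto intro: less_imp_le)
    qed (simp add: assms(3))
    show "fst y \<notin> set (binders (body Z))"
      using y binders_restrict_names(2)[OF Z(1), of y u] binders_body(2)[OF Z(1), of Z] assms(3) by auto
  qed (use Z body_subformula r'(1) sorted in auto)
  then show ?thesis by blast
qed

text \<open>The stage of \<open>z'\<close> bounds that of the formula, so any \<open>c\<close> above
  it still does. As \<open>c\<close> is below the stage of \<open>z\<close>, it is also below those
  of earlier names of the same variable.\<close>

lemma refuted_Reset:
  assumes "refuted T s \<alpha> \<phi> (u @ [z, z'] @ v)" "fst z' = fst z" "distinct (u @ [z, z'] @ v)"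
    "\<alpha> z' \<le> c" "c < \<alpha> z"
  shows "refuted T s (\<alpha>(z := c)) \<phi> (u @ [z])"
proof -
  obtain \<chi> r where *: "\<chi> \<in> subformulas \<gamma>" "expand \<chi> = \<phi>" "s \<in> gsem False T (val False T r) \<chi>"
    "\<forall>y\<in>set (u @ [z, z'] @ v). r (fst y) \<le> \<alpha> y \<and> fst y \<notin> set (binders \<chi>)"
    "decreasing \<alpha> (u @ [z, z'] @ v)"
    using assms(1) by (rule refutedE)
  let ?\<alpha> = "\<alpha>(z := c)"
  have "decreasing ?\<alpha> u"
    by (rule sorted_wrt_mono_rel[of _ "\<lambda>z z'. fst z = fst z' \<longrightarrow> \<alpha> z' < \<alpha> z"])
      (use *(5) assms(3) in \<open>auto simp: sorted_wrt_append\<close>)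
  moreover have "c < \<alpha> y" if "y \<in> set u" "fst y = fst z" for y
    using *(5) assms(5) that by (auto simp: sorted_wrt_append intro: less_trans)
  ultimately have "decreasing ?\<alpha> (u @ [z])"
    using assms(3) by (auto simp: sorted_wrt_append)
  moreover have "r (fst z) \<le> c" using *(4) assms(2,4) by (auto intro: order_trans)
  ultimately show ?thesis using * assms(3) by (intro refutedI[of \<chi> _ s T r]) auto
qed

lemma all_refutedD: "all_refuted T s \<alpha> \<Gamma> \<Longrightarrow> (\<phi>, u) \<in> \<Gamma> \<Longrightarrow> refuted T s \<alpha> \<phi> u"
  unfolding all_refuted_def by blast

lemma refuted_step:
  assumes seq: "is_sequent \<gamma> (w, \<Gamma>)" and ref: "all_refuted T s \<alpha> \<Gamma>"
    and app: "applies \<gamma> xs rl (w, \<Gamma>) ss"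
  shows "\<exists>(w', \<Gamma>')\<in>set ss. \<exists>s' \<alpha>'. all_refuted T s' \<alpha>' \<Gamma>' \<and> evolves w w' \<and>
    (\<forall>z\<in>set w. \<alpha>' z \<le> \<alpha> z \<and> (rl = ResetR z \<longrightarrow> \<alpha>' z < \<alpha> z))"
proof -
  have idx: "subseq u w" "distinct u" "set u \<subseteq> set w" if "(\<phi>, u) \<in> \<Gamma>" for \<phi> u
  proof -
    show 1: "subseq u w" using seq that by (auto simp: is_sequent_def)
    show "set u \<subseteq> set w" "distinct u"
      using seq 1 by (auto simp: is_sequent_def subseq_conv_nths dest: in_set_nthsD intro: distinct_nthsI)
  qed
  consider (struct) s' where "structural \<gamma> xs rl (w, \<Gamma>) s'" "ss = [s']"
    | (logical) "logical \<gamma> xs rl (w, \<Gamma>) ss"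
    using app unfolding applies_def by blast
  then show ?thesis
  proof cases
    case struct
    from struct(1) show ?thesis
    proof cases
      case (Thin u v \<Delta> \<Gamma>' \<phi>)
      then have "all_refuted T s \<alpha> \<Delta>" using ref by (auto simp: all_refuted_def)
      then show ?thesis using Thin struct(2) by (auto simp: still_occurring_def)
    next
      case (Reset fs z \<Gamma>' \<Delta> u)
      define A where "A = \<alpha> ` (fst \<circ> snd) ` set fs"
      \<comment> \<open>A single new stage of \<open>z\<close> must bound those of all the names
        \<open>z'\<close> that follow it. There are finitely many, each below the stage of
        \<open>z\<close>, so their maximum works.\<close>
      define c where "c = Max A"
      have A: "finite A" "A \<noteq> {}" using Reset by (auto simp: A_def)
      have princ: "(\<phi>, u @ [z, z'] @ v) \<in> \<Gamma>" if "(\<phi>, z', v) \<in> set fs" for \<phi> z' v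
        unfolding Reset using that by blast
      have fst: "fst z' = fst z" if "(\<phi>, z', v) \<in> set fs" for \<phi> z' v
        using Reset that by blast
      have "\<alpha> z' < \<alpha> z" if "(\<phi>, z', v) \<in> set fs" for \<phi> z' v
      proof -
        from all_refutedD[OF ref princ[OF that]]
        have "decreasing \<alpha> (u @ [z, z'] @ v)"
          by (rule refutedE)
        then show ?thesis using fst[OF that] by (simp add: sorted_wrt_append)
      qed
      then have less: "c < \<alpha> z" using A by (auto simp: c_def A_def)
      have le: "\<alpha> z' \<le> c" if "(\<phi>, z', v) \<in> set fs" for \<phi> z' v
        using A(1) that unfolding c_def by (intro Max_ge) (force simp: A_def)+
      have "all_refuted T s (\<alpha>(z := c)) \<Delta>"
        unfolding all_refuted_def
      proof (clarify)
        fix \<phi> u' assume "(\<phi>, u') \<in> \<Delta>"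
        then consider "(\<phi>, u') \<in> \<Gamma>'" | z' v where "(\<phi>, z', v) \<in> set fs" "u' = u @ [z]"
          unfolding Reset by blast
        then show "refuted T s (\<alpha>(z := c)) \<phi> u'"
        proof cases
          case 1
          \<comment> \<open>The side condition of Reset makes the change at \<open>z\<close>
            invisible to the remaining formulas.\<close>
          then have "(\<phi>, u') \<in> \<Gamma>" "z \<notin> set u'" using Reset by (auto simp: names_of_def)
          then show ?thesis by (intro refuted_cong[OF all_refutedD[OF ref]]) auto
        next
          case 2
          then show ?thesis
            using refuted_Reset[OF all_refutedD[OF ref princ[OF 2(1)]] fst[OF 2(1)] _ le[OF 2(1)] less]
              idx(2)[OF princ[OF 2(1)]] by simp
        qed
      qed
      then show ?thesis using Reset struct(2) less
        by (auto simp: still_occurring_def less_imp_le intro!: exI[of _ s] exI[of _ "\<alpha>(z := c)"])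
    qed
  next
    case logical
    then show ?thesis
    proof cases
      case (Or \<Gamma>' \<phi> \<psi> u)
      then have "all_refuted T s \<alpha> (\<Gamma>' \<union> {(\<phi>, u), (\<psi>, u)})"
        using ref refuted_Disj[of T s \<alpha> \<phi> \<psi> u] by (auto simp: all_refuted_def)
      then show ?thesis using Or by (auto intro!: exI[of _ s] exI[of _ \<alpha>])
    next
      case (And \<Gamma>' \<phi> \<psi> u)
      then have "all_refuted T s \<alpha> (\<Gamma>' \<union> {(\<phi>, u)}) \<or> all_refuted T s \<alpha> (\<Gamma>' \<union> {(\<psi>, u)})"
        using ref refuted_Conj[of T s \<alpha> \<phi> \<psi> u] by (auto simp: all_refuted_def)
      then show ?thesis using And by (auto intro!: exI[of _ s] exI[of _ \<alpha>])
    next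
      case (Modal \<Delta> \<Sigma> \<psi> u \<Gamma>' a)
      have "refuted T s \<alpha> (PBox a \<psi>) u" using Modal by (intro all_refutedD[OF ref]) simp
      from refuted_Box[OF this] obtain t where t: "(s, t) \<in> steps T a" "refuted T t \<alpha> \<psi> u" by auto
      have "refuted T t \<alpha> \<phi> v" if "(\<phi>, v) \<in> \<Sigma>" for \<phi> v
      proof -
        have "refuted T s \<alpha> (PDia a \<phi>) v" using Modal that by (intro all_refutedD[OF ref]) blast
        then show ?thesis using t(1) by (rule refuted_Dia)
      qed
      then have "all_refuted T t \<alpha> \<Delta>" using t(2) Modal by (auto simp: all_refuted_def)
      then show ?thesis using Modal by (auto simp: still_occurring_def)
    next
      case (Mu \<Delta> \<Gamma>' Z \<phi> u)
      then have "all_refuted T s \<alpha> \<Delta>"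
        using ref refuted_Mu[of T s \<alpha> Z \<phi> u] by (auto simp: all_refuted_def)
      then show ?thesis using Mu by (auto simp: still_occurring_def)
    next
      case (Nu Z z \<Delta> \<Gamma>' \<phi> u)
      have z: "z \<notin> set w" "fst z = Z" using Nu(4) by (auto simp: first_unused_def)
      have princ: "(PFix Nu Z \<phi>, u) \<in> \<Gamma>" using Nu by simp
      have "z \<notin> set u" using z idx(3)[OF princ] by blast
      from refuted_Nu[OF all_refutedD[OF ref princ] this z(2)] obtain c
        where c: "refuted T s (\<alpha>(z := c)) (unfold_fix Nu Z \<phi>) (restrict_names xs u Z @ [z])" by blast
      have "refuted T s (\<alpha>(z := c)) \<phi>' v" if "(\<phi>', v) \<in> \<Gamma>'" for \<phi>' v
      proof -
        have "(\<phi>', v) \<in> \<Gamma>" using Nu that by simp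
        then show ?thesis using idx(3) z by (intro refuted_cong[OF all_refutedD[OF ref]]) auto
      qed
      then have "all_refuted T s (\<alpha>(z := c)) \<Delta>" using c Nu by (auto simp: all_refuted_def)
      moreover have "evolves w (still_occurring w \<Delta> @ [z])"
        unfolding still_occurring_def using z by (intro evolves_snoc)
      ultimately show ?thesis using Nu z by (auto intro!: exI[of _ s] exI[of _ "\<alpha>(z := c)"])
    qed
  qed
qed

text \<open>A branch of a proof tree together with the stages of the names at each of its nodes;
  \<open>descends\<close> relates these to the stages \<open>\<alpha>\<close> at the current node, whose names are \<open>w\<close>.\<close>

type_synonym ('v', 'p', 'a', 's') branch =
  "((('v', 'p', 'a') sequent \<times> 'v' rule) \<times> ('v' name \<Rightarrow> 's' stage)) list"

definition branch_names :: "('v', 'p', 'a', 's') branch \<Rightarrow> 'v' name list list" where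
  "branch_names h = map (fst \<circ> fst \<circ> fst) h"

definition descends :: "('v', 'p', 'a', 's') branch \<Rightarrow> 'v' name list \<Rightarrow> ('v' name \<Rightarrow> 's' stage) \<Rightarrow> bool" where
  "descends h w \<alpha> \<longleftrightarrow> (\<forall>h1 w1 \<Gamma>1 rl a h2 p. h = h1 @ (((w1, \<Gamma>1), rl), a) # h2 \<longrightarrow>
     prefix p w1 \<longrightarrow> (\<forall>w'\<in>set (branch_names h2). prefix p w') \<longrightarrow> prefix p w \<longrightarrow>
     map \<alpha> p \<le> map a p \<and>
     (\<forall>z\<in>set p. ResetR z \<in> insert rl (snd ` fst ` set h2) \<longrightarrow> map \<alpha> p < map a p))"

text \<open>Allows a node to be considered again with smaller stages: a lexicographic decrease on
  \<open>w\<close> is at least a weak decrease on each prefix of \<open>w\<close>.\<close>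

lemma descends_less:
  assumes "descends h w \<alpha>" "map \<alpha>' w < map \<alpha> w"
  shows "descends h w \<alpha>'"
  unfolding descends_def
proof (intro allI impI)
  fix h1 w1 \<Gamma>1 rl a h2 p
  assume *: "h = h1 @ (((w1, \<Gamma>1), rl), a) # h2" "prefix p w1"
    "\<forall>w'\<in>set (branch_names h2). prefix p w'" "prefix p w"
  have "map \<alpha>' p \<le> map \<alpha> p"
    using assms(2) *(4) by (auto simp: prefix_def intro: lex_append_le[rotated])
  with assms(1)[unfolded descends_def, rule_format, OF *(1,2) _ *(4)] *(3)
  show "map \<alpha>' p \<le> map a p \<and>
     (\<forall>z\<in>set p. ResetR z \<in> insert rl (snd ` fst ` set h2) \<longrightarrow> map \<alpha>' p < map a p)"
    by (meson le_less_trans order_trans)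
qed

text \<open>No stage of a name present increases in a step. So on a prefix \<open>p\<close> kept
  since an ancestor the stages stay lexicographically at most what they were there, and a reset of a
  name in \<open>p\<close> makes the comparison strict for good.\<close>

lemma descends_snoc:
  assumes "descends h w \<alpha>"
    and le: "\<And>z. z \<in> set w \<Longrightarrow> \<alpha>' z \<le> \<alpha> z"
    and less: "\<And>z. z \<in> set w \<Longrightarrow> rl = ResetR z \<Longrightarrow> \<alpha>' z < \<alpha> z"
  shows "descends (h @ [(((w, \<Gamma>), rl), \<alpha>)]) w' \<alpha>'"
  unfolding descends_def
proof (intro allI impI)
  fix h1 w1 \<Gamma>1 rl1 a h2 p
  assume *: "h @ [(((w, \<Gamma>), rl), \<alpha>)] = h1 @ (((w1, \<Gamma>1), rl1), a) # h2" "prefix p w1"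
    "\<forall>w'\<in>set (branch_names h2). prefix p w'" "prefix p w'"
  have step: "map \<alpha>' p \<le> map \<alpha> p \<and> (\<forall>z\<in>set p. rl = ResetR z \<longrightarrow> map \<alpha>' p < map \<alpha> p)" if "prefix p w"
  proof -
    have "set p \<subseteq> set w" using that by (rule set_mono_prefix)
    then show ?thesis using le less lex_map_le[of p \<alpha>' \<alpha>] lex_map_less[of p \<alpha>' \<alpha>] by blast
  qed
  show "map \<alpha>' p \<le> map a p \<and>
     (\<forall>z\<in>set p. ResetR z \<in> insert rl1 (snd ` fst ` set h2) \<longrightarrow> map \<alpha>' p < map a p)"
  proof (cases h2 rule: rev_cases)
    case Nil
    then show ?thesis using * step by auto
  next
    case (snoc h3 e)
    then have h: "h = h1 @ (((w1, \<Gamma>1), rl1), a) # h3" "e = (((w, \<Gamma>), rl), \<alpha>)"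
      using *(1) by auto
    then have pw: "prefix p w" "\<forall>w'\<in>set (branch_names h3). prefix p w'"
      using *(3) snoc by (auto simp: branch_names_def)
    from assms(1)[unfolded descends_def, rule_format, OF h(1) *(2) _ pw(1)] pw(2)
    have "map \<alpha> p \<le> map a p \<and>
      (\<forall>z\<in>set p. ResetR z \<in> insert rl1 (snd ` fst ` set h3) \<longrightarrow> map \<alpha> p < map a p)" by blast
    moreover have "snd ` fst ` set h2 = insert rl (snd ` fst ` set h3)" using snoc h by auto
    ultimately show ?thesis using step[OF pw(1)]
      by (metis (no_types, lifting) insert_iff le_less_trans less_le_trans order_trans)
  qed
qed

text \<open>The premise on \<open>hb\<close> hands an induction hypothesis down the branch: no
  ancestor is refuted under stages lexicographically below those it was visited with. An inner node
  provides it for itself by a well-founded induction on its stages, nested inside the induction on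
  the tree; a successful repeat uses it for its companion.\<close>

lemma proof_below_sound:
  fixes T :: "('s, 'p, 'a) kripke"
  shows "proof_below \<gamma> xs h t \<Longrightarrow> label t = (w, \<Gamma>) \<Longrightarrow> map fst hb = h \<Longrightarrow>
    (\<And>w1 \<Gamma>1 rl a s' \<alpha>'. (((w1, \<Gamma>1), rl), a) \<in> set hb \<Longrightarrow> map \<alpha>' w1 < map a w1 \<Longrightarrow>
      \<not> all_refuted T s' \<alpha>' \<Gamma>1) \<Longrightarrow>
    successively evolves (branch_names hb @ [w]) \<Longrightarrow> descends hb w \<alpha> \<Longrightarrow> \<not> all_refuted T s \<alpha> \<Gamma>"
proof (induction arbitrary: w \<Gamma> hb \<alpha> s rule: proof_below.induct)
  case (leaf sq h)
  then have sq: "sq = (w, \<Gamma>)" by simp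
  show ?case
  proof
    assume ref: "all_refuted T s \<alpha> \<Gamma>"
    from leaf.hyps(2) consider "is_axiom sq" | "successful_repeat h sq" by blast
    then show False
    proof cases
      case 1
      then consider P u v where "(PProp P, u) \<in> \<Gamma>" "(PNeg P, v) \<in> \<Gamma>" | u where "(PTrue, u) \<in> \<Gamma>"
        unfolding is_axiom_def sq by blast
      then show False
      proof cases
        case 1
        from all_refutedD[OF ref 1(1)] have "s \<notin> vprop T P"
          by (rule refutedE) (auto dest: expand_PPropD)
        moreover from all_refutedD[OF ref 1(2)] have "s \<in> vprop T P"
          by (rule refutedE) (auto dest: expand_PNegD)
        ultimately show False by blast
      next
        case 2
        from all_refutedD[OF ref 2] show False by (rule refutedE) (auto dest: expand_PTrueD)
      qed
    next
      case 2
      then obtain h1 r h2 z where h: "h = h1 @ (sq, r) # h2" "ResetR z \<in> snd ` set ((sq, r) # h2)"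
        "\<forall>(w, \<Sigma>)\<in>insert sq (fst ` set h2). z \<in> set w"
        unfolding successful_repeat_def by blast
      from leaf.prems(2) h(1) obtain hb1 a hb2
        where hb: "hb = hb1 @ ((sq, r), a) # hb2" "map fst hb2 = h2"
        by (auto simp: map_eq_append_conv map_eq_Cons_conv)
      have zw: "z \<in> set w" using h(3) sq by auto
      have z2: "z \<in> set w'" if "w' \<in> set (branch_names hb2)" for w'
        using h(3) that hb(2) unfolding branch_names_def by force
      have "successively evolves (w # branch_names hb2 @ [w])"
        using leaf.prems(4) unfolding hb sq branch_names_def
        by (simp add: successively_append_iff)
      note pre = evolves_return[OF this z2 zw]
      \<comment> \<open>The names up to and including \<open>z\<close> persist through the whole
        loop by \<open>evolves_return\<close>. As \<open>z\<close> belongs to \<open>p\<close> and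
        is reset on the way, the stages on \<open>p\<close>, and hence on \<open>w\<close>, have
        become strictly smaller.\<close>
      define p where "p = takeWhile (\<lambda>y. y \<noteq> z) w @ [z]"
      have pw: "prefix p w" unfolding p_def using zw by (rule prefix_takeWhile)
      have "ResetR z \<in> insert r (snd ` fst ` set hb2)"
        using h(2) unfolding hb(2)[symmetric] by auto
      moreover have "z \<in> set p" by (simp add: p_def)
      ultimately have "map \<alpha> p < map a p"
        using leaf.prems(5)[unfolded descends_def, rule_format, OF hb(1)[unfolded sq] pw _ pw] pre
        unfolding p_def by blast
      then have "map \<alpha> w < map a w"
        using pw by (auto simp: prefix_def lex_append_less)
      then show False using leaf.prems(3)[of w \<Gamma> r a \<alpha> s] ref hb sq by auto
    qed
  qed
next
  case (node sq h r ts)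
  then have sq: "sq = (w, \<Gamma>)" by simp
  have "\<forall>s. descends hb w \<alpha> \<longrightarrow> \<not> all_refuted T s \<alpha> \<Gamma>" for \<alpha>
  proof (induction \<alpha> rule: wf_induct_rule[OF wf_lex_map[of w]])
    case (1 \<alpha>)
    show ?case
    proof (intro allI impI notI)
      fix s assume desc: "descends hb w \<alpha>" and ref: "all_refuted T s \<alpha> \<Gamma>"
      from refuted_step[OF node.hyps(1)[unfolded sq] ref node.hyps(3)[unfolded sq]]
      obtain w' \<Gamma>' s' \<alpha>' where step: "(w', \<Gamma>') \<in> set (map label ts)" "all_refuted T s' \<alpha>' \<Gamma>'"
        "evolves w w'" "\<forall>z\<in>set w. \<alpha>' z \<le> \<alpha> z \<and> (r = ResetR z \<longrightarrow> \<alpha>' z < \<alpha> z)"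
        by blast
      then obtain t where t: "t \<in> set ts" "label t = (w', \<Gamma>')" by auto
      let ?hb = "hb @ [((sq, r), \<alpha>)]"
      have "\<not> all_refuted T s' \<alpha>' \<Gamma>'"
      proof (rule node.IH[OF t])
        show "map fst ?hb = h @ [(sq, r)]" using node.prems(2) by simp
        show "successively evolves (branch_names ?hb @ [w'])"
          using node.prems(4) step(3) by (simp add: branch_names_def sq successively_append_iff)
        show "descends ?hb w' \<alpha>'" unfolding sq by (rule descends_snoc[OF desc]) (use step(4) in auto)
        fix w1 \<Gamma>1 rl a s'' \<alpha>''
        assume mem: "(((w1, \<Gamma>1), rl), a) \<in> set ?hb" and less: "map \<alpha>'' w1 < map a w1"
        show "\<not> all_refuted T s'' \<alpha>'' \<Gamma>1"
        proof (cases "(((w1, \<Gamma>1), rl), a) \<in> set hb")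
          case True
          then show ?thesis using less by (rule node.prems(3))
        next
          case False
          then have "w1 = w" "\<Gamma>1 = \<Gamma>" "a = \<alpha>" using mem sq by auto
          then show ?thesis using 1 less descends_less[OF desc] by auto
        qed
      qed
      then show False using step(2) by blast
    qed
  qed
  then show ?case using node.prems(5) by blast
qed

lemma soundness:
  assumes "proof_tree \<gamma> xs t"
  shows "valid TYPE('s) (form_of \<gamma>)"
  unfolding valid_def
proof (intro allI impI)
  fix T :: "('s, 'p, 'a) kripke" and V :: "'v \<Rightarrow> 's set"
  assume T: "kripke_structure T" and V: "\<forall>Z. V Z \<subseteq> states T"
  have "s \<in> sem T V (form_of \<gamma>)" if s: "s \<in> states T" for s
  proof (rule ccontr)
    assume "s \<notin> sem T V (form_of \<gamma>)"
    then have "s \<in> gsem False T (\<lambda>Z. states T - V Z) \<gamma>"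
      using s gsem_False[OF T, of V \<gamma>] gsem_True[OF T V, of \<gamma>] by simp
    also have "gsem False T (\<lambda>Z. states T - V Z) \<gamma> = gsem False T (val False T r) \<gamma>" for r
      using closed by (intro gsem_cong) (simp add: closed_pform_def)
    finally have "refuted T s \<alpha> \<gamma> []" for \<alpha>
      using closed by (intro refutedI[of \<gamma>]) (auto simp: expand_def msubst_closed closed_pform_def)
    then have "all_refuted T s \<alpha> {(\<gamma>, [])}" for \<alpha> by (simp add: all_refuted_def)
    moreover have "\<not> all_refuted T s \<alpha> {(\<gamma>, [])}" for \<alpha>
      by (rule proof_below_sound[of "[]" t "[]" _ "[]"])
        (use assms in \<open>auto simp: proof_tree_def branch_names_def descends_def\<close>)
    ultimately show False by blast
  qed
  then show "sem T V (form_of \<gamma>) = states T" using sem_subset[OF T V] by blast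
qed

end

section \<open>Indices and their ordering\<close>

lemma subseq_set_distinct:
  assumes "subseq u w"
  shows "set u \<subseteq> set w" "distinct w \<Longrightarrow> distinct u"
  using assms by (auto simp: subseq_conv_nths dest: in_set_nthsD intro: distinct_nthsI)

lemma sorted_filter_takeWhile:
  fixes f :: "'b \<Rightarrow> nat"
  shows "sorted (map f u) \<Longrightarrow> filter (\<lambda>z. f z \<le> k) u = takeWhile (\<lambda>z. f z \<le> k) u"
  by (induction u) (auto simp: filter_empty_conv takeWhile_eq_Nil_iff neq_Nil_conv)

context mu_formula
begin

abbreviation rank :: "'v name \<Rightarrow> nat" where
  "rank z \<equiv> pos xs (fst z)"

lemma names_vars: "z \<in> names \<gamma> \<Longrightarrow> fst z \<in> set xs \<and> fst z \<in> nu_vars \<gamma>"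
  by (auto simp: names_def nu_vars_iff)

lemma restrict_names_eq:
  assumes "set u \<subseteq> names \<gamma>" "X \<in> set xs"
  shows "restrict_names xs u X = filter (\<lambda>z. rank z \<le> pos xs X) u"
  unfolding restrict_names_def
  by (rule filter_cong) (use assms names_vars precedes_iff[OF distinct_xs] in \<open>auto simp: not_less\<close>)

text \<open>In an index sorted by rank the names of inner variables form the end, so discarding them
  cuts off a suffix.\<close>

lemma prefix_restrict_names:
  assumes "set u \<subseteq> names \<gamma>" "X \<in> set xs" "sorted (map rank u)"
  shows "prefix (restrict_names xs u X) u"
  unfolding restrict_names_eq[OF assms(1,2)] sorted_filter_takeWhile[OF assms(3)]
  by (rule takeWhile_is_prefix)

lemma sq_less_irrefl:
  assumes "distinct w" shows "\<not> sq_less \<gamma> xs w u u"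
  using precedes_iff[OF assms] by (auto simp: sq_less_def less_names_def)

text \<open>Restrict to the variable of the last name of \<open>v\<close>: since \<open>v\<close> is
  sorted, this removes nothing from \<open>v\<close>, nor from its prefix \<open>u\<close>.\<close>

lemma sq_less_extension:
  assumes v: "set v \<subseteq> names \<gamma>" "sorted (map rank v)" and u: "strict_prefix u v"
  shows "sq_less \<gamma> xs w v u"
proof -
  obtain v' z where vz: "v = v' @ [z]" using u by (cases v rule: rev_cases) auto
  have z: "fst z \<in> set xs" "fst z \<in> nu_vars \<gamma>" using v(1) names_vars vz by auto
  have v_eq: "restrict_names xs v (fst z) = v"
    using v by (simp add: restrict_names_eq z) (auto simp: vz sorted_append filter_id_conv)
  have "set u \<subseteq> set v" using u by (auto simp: strict_prefix_def dest: set_mono_prefix)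
  then have "restrict_names xs u (fst z) = u"
    using v_eq unfolding restrict_names_def filter_id_conv by auto
  then show ?thesis using u v_eq z(2) unfolding sq_less_def
    by (intro disjI2 bexI[of _ "fst z"]) simp_all
qed

text \<open>Restricting to the variable of \<open>b\<close> keeps \<open>b\<close> but removes
  \<open>c\<close> and everything after it, leaving the common part \<open>as\<close>.\<close>

lemma sq_less_outer:
  assumes "set (as @ b # bs) \<subseteq> names \<gamma>" "sorted (map rank (as @ b # bs))"
    and "set (as @ c # cs) \<subseteq> names \<gamma>" "sorted (map rank (as @ c # cs))" and "rank b < rank c"
  shows "sq_less \<gamma> xs w (as @ b # bs) (as @ c # cs)"
proof -
  have b: "fst b \<in> set xs" "fst b \<in> nu_vars \<gamma>" using assms(1) names_vars by auto
  have as: "filter (\<lambda>z. rank z \<le> rank b) as = as"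
    using assms(2) by (auto simp: sorted_append filter_id_conv)
  have cs: "filter (\<lambda>z. rank z \<le> rank b) (c # cs) = []"
    using assms(4,5) by (auto simp: sorted_append filter_empty_conv)
  have "restrict_names xs (as @ c # cs) (fst b) = as"
    unfolding restrict_names_eq[OF assms(3) b(1)] filter_append as cs by simp
  moreover have "restrict_names xs (as @ b # bs) (fst b) = as @ b # filter (\<lambda>z. rank z \<le> rank b) bs"
    unfolding restrict_names_eq[OF assms(1) b(1)] filter_append as by simp
  ultimately show ?thesis using b(2) unfolding sq_less_def
    by (intro disjI2 bexI[of _ "fst b"]) (simp_all add: strict_prefix_def)
qed

text \<open>Comparability lets Thin remove all but one index of a formula. At the first difference,
  names of one variable are compared by their places in \<open>w\<close>, names of different
  variables by rank.\<close>

lemma sq_less_total: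
  assumes w: "distinct w" "set w \<subseteq> names \<gamma>"
    and u: "set u \<subseteq> set w" "sorted (map rank u)" and v: "set v \<subseteq> set w" "sorted (map rank v)"
    and "u \<noteq> v"
  shows "sq_less \<gamma> xs w u v \<or> sq_less \<gamma> xs w v u"
proof -
  have un: "set u \<subseteq> names \<gamma>" "set v \<subseteq> names \<gamma>" using w u v by auto
  consider "strict_prefix u v" | "strict_prefix v u" | "u \<parallel> v"
    using \<open>u \<noteq> v\<close> by (auto simp: strict_prefix_def parallel_def)
  then show ?thesis
  proof cases
    case 3
    then obtain as b bs c cs where uv: "b \<noteq> c" "u = as @ b # bs" "v = as @ c # cs"
      using parallel_decomp by blast
    have bc: "b \<in> set w" "c \<in> set w" using u v uv by auto
    consider "fst b = fst c" | "rank b < rank c" | "rank c < rank b"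
      using pos_eq_iff[of "fst b" xs "fst c"] bc w(2) names_vars by (meson linorder_neqE_nat subsetD)
    then show ?thesis
    proof cases
      case 1
      have "precedes w b c \<or> precedes w c b"
        using bc uv(1) pos_eq_iff[of b w c] by (auto simp: precedes_iff[OF w(1)])
      then have "less_names w u v \<or> less_names w v u"
        unfolding less_names_def using uv 1
        by (auto simp: nth_append intro!: exI[of _ "length as"])
      then show ?thesis unfolding sq_less_def by blast
    next
      case 2
      then show ?thesis using sq_less_outer[of as b bs c cs] un u v uv by blast
    next
      case 3
      then show ?thesis using sq_less_outer[of as c cs b bs] un u v uv by blast
    qed
  qed (use sq_less_extension un u v in blast)+
qed


section \<open>Reductions of sequents\<close>

text \<open>The last clause says that a name determines what precedes it in an index. It provides
  the common part \<open>u\<close> required by Reset.\<close>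

definition good :: "('v, 'p, 'a) sequent \<Rightarrow> bool" where
  "good = (\<lambda>(w, \<Gamma>). is_sequent \<gamma> (w, \<Gamma>) \<and> set w = names_of \<Gamma> \<and>
     (\<forall>(\<phi>, u)\<in>\<Gamma>. sorted (map rank u)) \<and>
     (\<forall>\<phi> \<phi>' z a b a' b'. (\<phi>, a @ z # b) \<in> \<Gamma> \<longrightarrow> (\<phi>', a' @ z # b') \<in> \<Gamma> \<longrightarrow> a = a'))"

lemma goodD:
  assumes "good (w, \<Gamma>)"
  shows "is_sequent \<gamma> (w, \<Gamma>)" "distinct w" "set w \<subseteq> names \<gamma>" "set w = names_of \<Gamma>"
    "(\<phi>, u) \<in> \<Gamma> \<Longrightarrow> \<phi> \<in> clos \<gamma>" "(\<phi>, u) \<in> \<Gamma> \<Longrightarrow> subseq u w" "(\<phi>, u) \<in> \<Gamma> \<Longrightarrow> sorted (map rank u)"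
    "(\<phi>, a @ z # b) \<in> \<Gamma> \<Longrightarrow> (\<phi>', a' @ z # b') \<in> \<Gamma> \<Longrightarrow> a = a'"
  using assms unfolding good_def is_sequent_def by blast+

lemma good_idx:
  assumes "good (w, \<Gamma>)" "(\<phi>, u) \<in> \<Gamma>"
  shows "set u \<subseteq> set w" "distinct u" "set u \<subseteq> names \<gamma>"
  using subseq_set_distinct[OF goodD(6)[OF assms]] goodD(2,3)[OF assms(1)] by auto

lemma finite_names: "finite (names \<gamma>)"
proof -
  have "nu_vars \<gamma> \<subseteq> set xs" by (auto simp: nu_vars_iff)
  then have "finite (nu_vars \<gamma>)" by (rule finite_subset) simp
  then show ?thesis by (simp add: names_def)
qed

lemma finite_sequents: "finite {s. is_sequent \<gamma> s}"
proof -
  define W where "W = {w. set w \<subseteq> names \<gamma> \<and> length w \<le> card (names \<gamma>)}"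
  have W: "w \<in> W" if "distinct w" "set w \<subseteq> names \<gamma>" for w
    using that distinct_card[of w] card_mono[OF finite_names, of "set w"] by (auto simp: W_def)
  have "finite W" unfolding W_def by (rule finite_lists_length_le[OF finite_names])
  moreover have "{s. is_sequent \<gamma> s} \<subseteq> W \<times> Pow (clos \<gamma> \<times> W)"
  proof (clarify)
    fix w \<Gamma> assume seq: "is_sequent \<gamma> (w, \<Gamma>)"
    have "u \<in> W" if "(\<phi>, u) \<in> \<Gamma>" for \<phi> u
    proof -
      have "subseq u w" "distinct w" "set w \<subseteq> names \<gamma>" using seq that by (auto simp: is_sequent_def)
      then show ?thesis using subseq_set_distinct[of u w] W by blast
    qed
    then show "w \<in> W \<and> \<Gamma> \<in> Pow (clos \<gamma> \<times> W)" using seq W by (auto simp: is_sequent_def)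
  qed
  ultimately show ?thesis using finite_clos by (meson finite_Pow_iff finite_SigmaI finite_subset)
qed

lemma finite_sequent:
  assumes "is_sequent \<gamma> (w, \<Gamma>)" shows "finite \<Gamma>"
proof (rule finite_subset)
  have "set u \<subseteq> set w \<and> length u \<le> length w" if "subseq u w" for u
    using that subseq_set_distinct(1) list_emb_length by blast
  then show "\<Gamma> \<subseteq> clos \<gamma> \<times> {u. set u \<subseteq> set w \<and> length u \<le> length w}"
    using assms by (fastforce simp: is_sequent_def)
qed (use finite_clos finite_lists_length_le in blast)

text \<open>One preservation argument for all rules: every new index is a prefix of an old one,
  except possibly for a prefix \<open>q\<close> of an old index extended by a fresh name.\<close>

lemma good_child:
  assumes good: "good (w, \<Gamma>)"
    and clos: "\<And>\<phi> u. (\<phi>, u) \<in> \<Delta> \<Longrightarrow> \<phi> \<in> clos \<gamma>"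
    and old: "\<And>\<phi> u. (\<phi>, u) \<in> \<Delta> \<Longrightarrow>
      (\<exists>\<phi>0 u0. (\<phi>0, u0) \<in> \<Gamma> \<and> prefix u u0) \<or> (new \<noteq> [] \<and> u = q @ new)"
    and new: "new = [] \<or> (\<exists>z \<phi>0 u0 \<phi>. new = [z] \<and> z \<notin> set w \<and> z \<in> names \<gamma> \<and> (\<phi>0, u0) \<in> \<Gamma> \<and>
      prefix q u0 \<and> sorted (map rank (q @ [z])) \<and> (\<phi>, q @ [z]) \<in> \<Delta>)"
  shows "good (still_occurring w \<Delta> @ new, \<Delta>)"
proof -
  note G = goodD[OF good]
  define w' where "w' = still_occurring w \<Delta>"
  have pre: "subseq u w'" "sorted (map rank u)"
    if u: "prefix u u0" "(\<phi>0, u0) \<in> \<Gamma>" "set u \<subseteq> names_of \<Delta>" for u u0 \<phi>0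
  proof -
    have "subseq u w" using u(1) G(6)[OF u(2)] by (auto intro: subseq_order.order_trans prefix_imp_subseq)
    then have "subseq (filter (\<lambda>z. z \<in> names_of \<Delta>) u) w'"
      unfolding w'_def still_occurring_def by (rule subseq_filter)
    moreover have "filter (\<lambda>z. z \<in> names_of \<Delta>) u = u" using u(3) by (auto simp: filter_id_conv)
    ultimately show "subseq u w'" by simp
    show "sorted (map rank u)" using u(1) G(7)[OF u(2)] by (auto simp: prefix_def sorted_append)
  qed
  have D: "set u \<subseteq> names_of \<Delta>" if "(\<phi>, u) \<in> \<Delta>" for \<phi> u using that by (auto simp: names_of_def)
  have w': "set w' \<subseteq> set w" "distinct w'" using G(2) by (auto simp: w'_def still_occurring_def)
  have dist: "distinct (w' @ new)" "set (w' @ new) \<subseteq> names \<gamma>" using new w' G(3) by auto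
  have idx: "subseq u (w' @ new)" "sorted (map rank u)" if u: "(\<phi>, u) \<in> \<Delta>" for \<phi> u
  proof -
    have "subseq u (w' @ new) \<and> sorted (map rank u)"
    proof (cases "new \<noteq> [] \<and> u = q @ new")
      case True
      then obtain z \<phi>0 u0 where z: "new = [z]" "(\<phi>0, u0) \<in> \<Gamma>" "prefix q u0" "sorted (map rank (q @ [z]))"
        using new by blast
      have "subseq q w'" using pre(1)[OF z(3,2)] D[OF u] True by auto
      then show ?thesis using True z by (auto intro: list_emb_append_mono)
    next
      case False
      then obtain \<phi>0 u0 where "(\<phi>0, u0) \<in> \<Gamma>" "prefix u u0" using old[OF u] by blast
      then show ?thesis using pre D[OF u] by (auto intro: list_emb_append2)
    qed
    then show "subseq u (w' @ new)" "sorted (map rank u)" by auto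
  qed
  have names: "set (w' @ new) = names_of \<Delta>"
  proof
    show "set (w' @ new) \<subseteq> names_of \<Delta>"
      using new D by (force simp: w'_def still_occurring_def)
    show "names_of \<Delta> \<subseteq> set (w' @ new)"
      using subseq_set_distinct(1)[OF idx(1)] unfolding names_of_def by blast
  qed
  have uniq: "a = a'" if u: "(\<phi>, a @ z # b) \<in> \<Delta>" "(\<phi>', a' @ z # b') \<in> \<Delta>" for \<phi> \<phi>' z a b a' b'
  proof -
    have occ: "\<exists>\<phi>0 u0. (\<phi>0, u0) \<in> \<Gamma> \<and> prefix (a @ [z]) u0"
      if ab: "(\<phi>, a @ z # b) \<in> \<Delta>" "z \<in> set w" for \<phi> a b
    proof (cases "new \<noteq> [] \<and> a @ z # b = q @ new")
      case True
      then obtain y \<phi>0 u0 where y: "new = [y]" "(\<phi>0, u0) \<in> \<Gamma>" "prefix q u0" "y \<notin> set w" using new by blast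
      have "b \<noteq> []" using True y ab(2) by auto
      then have "prefix (a @ [z]) q" using True y(1)
        by (cases b rule: rev_cases) (auto simp: prefix_def)
      then show ?thesis using y by (meson prefix_order.order_trans)
    next
      case False
      then obtain \<phi>0 u0 where "(\<phi>0, u0) \<in> \<Gamma>" "prefix (a @ z # b) u0" using old[OF ab(1)] by blast
      then show ?thesis by (auto simp: prefix_def)
    qed
    show ?thesis
    proof (cases "z \<in> set w")
      case True
      from occ[OF u(1) True] occ[OF u(2) True] show ?thesis
        using G(8) unfolding prefix_def by fastforce
    next
      case False
      \<comment> \<open>A name outside \<open>w\<close> can only be the fresh one, which ends
        \<open>q @ new\<close>.\<close>
      have form: "a @ z # b = q @ new \<and> new = [z]" if "(\<phi>, a @ z # b) \<in> \<Delta>" for \<phi> a b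
      proof -
        have "\<not> (\<exists>\<phi>0 u0. (\<phi>0, u0) \<in> \<Gamma> \<and> prefix (a @ z # b) u0)"
          using False good_idx(1)[OF good] by (fastforce simp: prefix_def)
        then have *: "new \<noteq> []" "a @ z # b = q @ new" using old[OF that] by auto
        then obtain y \<phi>0 u0 where y: "new = [y]" "(\<phi>0, u0) \<in> \<Gamma>" "prefix q u0" using new by blast
        then have "set q \<subseteq> set w" using good_idx(1)[OF good y(2)] set_mono_prefix by blast
        moreover have "z \<in> set (q @ new)" using *(2) by (metis in_set_conv_decomp)
        ultimately have "y = z" using False y(1) by auto
        then show ?thesis using * y by simp
      qed
      from form[OF u(1)] form[OF u(2)] have *: "a @ z # b = q @ [z]" "a' @ z # b' = q @ [z]" by auto
      have "new \<noteq> []" using form[OF u(1)] by simp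
      then obtain \<phi>0 u0 where "(\<phi>0, u0) \<in> \<Gamma>" "prefix q u0" using new by blast
      then have "z \<notin> set q" using False good_idx(1)[OF good] set_mono_prefix by blast
      then have "c = q" if "c @ z # d = q @ [z]" for c d
        using that by (cases d rule: rev_cases) auto
      then show ?thesis using * by blast
    qed
  qed
  show ?thesis
    unfolding w'_def[symmetric] good_def is_sequent_def
    using dist clos idx names uniq by fastforce
qed

definition stuck :: "('v, 'p, 'a) sequent \<Rightarrow> bool" where
  "stuck s \<longleftrightarrow> \<not> (\<exists>r s'. structural \<gamma> xs r s s')"

text \<open>\<open>expands w p r Q new\<close>: a logical rule \<open>r\<close> other than the modal one, with principal element
  \<open>p\<close>, replaces \<open>p\<close> by \<open>Q\<close> in one of its conclusions and appends the names \<open>new\<close>.\<close>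

inductive expands ::
  "'v name list \<Rightarrow> ('v, 'p, 'a) iform \<Rightarrow> 'v rule \<Rightarrow> ('v, 'p, 'a) iform set \<Rightarrow> 'v name list \<Rightarrow> bool"
  for w where
  Disj: "expands w (PDisj \<phi> \<psi>, u) OrR {(\<phi>, u), (\<psi>, u)} []"
| Conj1: "expands w (PConj \<phi> \<psi>, u) AndR {(\<phi>, u)} []"
| Conj2: "expands w (PConj \<phi> \<psi>, u) AndR {(\<psi>, u)} []"
| Mu: "expands w (PFix Mu Z \<phi>, u) MuR {(unfold_fix Mu Z \<phi>, restrict_names xs u Z)} []"
| Nu: "first_unused \<gamma> w Z z \<Longrightarrow>
    expands w (PFix Nu Z \<phi>, u) NuR {(unfold_fix Nu Z \<phi>, restrict_names xs u Z @ [z])} [z]"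

text \<open>Unlike in the proof rules, the principal elements are always removed.\<close>

inductive red :: "('v, 'p, 'a) sequent \<Rightarrow> 'v rule \<Rightarrow> ('v, 'p, 'a) sequent \<Rightarrow> bool" where
  Thin: "(\<phi>, u) \<in> \<Gamma> \<Longrightarrow> (\<phi>, v) \<in> \<Gamma> \<Longrightarrow> sq_less \<gamma> xs w u v \<Longrightarrow> \<Delta> = \<Gamma> - {(\<phi>, v)} \<Longrightarrow>
    red (w, \<Gamma>) ThinR (still_occurring w \<Delta>, \<Delta>)"
| Reset: "P \<subseteq> \<Gamma> \<Longrightarrow> P \<noteq> {} \<Longrightarrow> z \<notin> names_of (\<Gamma> - P) \<Longrightarrow>
    (\<And>\<phi> u'. (\<phi>, u') \<in> P \<Longrightarrow> \<exists>z' v. u' = u @ [z, z'] @ v \<and> fst z' = fst z) \<Longrightarrow>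
    \<Delta> = (\<Gamma> - P) \<union> (\<lambda>(\<phi>, _). (\<phi>, u @ [z])) ` P \<Longrightarrow>
    red (w, \<Gamma>) (ResetR z) (still_occurring w \<Delta>, \<Delta>)"
| Logical: "stuck (w, \<Gamma>) \<Longrightarrow> p \<in> \<Gamma> \<Longrightarrow> expands w p r Q new \<Longrightarrow> \<Delta> = (\<Gamma> - {p}) \<union> Q \<Longrightarrow>
    red (w, \<Gamma>) r (still_occurring w \<Delta> @ new, \<Delta>)"

lemma first_unusedD: "first_unused \<gamma> w Z z \<Longrightarrow> fst z = Z \<and> z \<in> names \<gamma> \<and> z \<notin> set w"
  by (auto simp: first_unused_def)

lemma sorted_restrict_snoc:
  assumes "set u \<subseteq> names \<gamma>" "X \<in> set xs" "sorted (map rank u)" "fst z = X"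
  shows "sorted (map rank (restrict_names xs u X @ [z]))"
  unfolding restrict_names_eq[OF assms(1,2)] using assms(3,4)
  by (auto simp: sorted_append intro: sorted_filter)

lemma expands_child:
  assumes good: "good (w, \<Gamma>)" and p: "p \<in> \<Gamma>" and e: "expands w p r Q new"
  shows "good (still_occurring w ((\<Gamma> - {p}) \<union> Q) @ new, (\<Gamma> - {p}) \<union> Q)"
  using e
proof cases
  case (Disj \<phi> \<psi> u)
  have "PDisj \<phi> \<psi> \<in> clos \<gamma>" using p Disj goodD(5)[OF good] by blast
  then have "\<phi> \<in> clos \<gamma>" "\<psi> \<in> clos \<gamma>" by (auto intro: clos.intros)
  then show ?thesis using p Disj goodD(5)[OF good]
    by (intro good_child[OF good]) auto
next
  case (Conj1 \<phi> \<psi> u)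
  then have "\<phi> \<in> clos \<gamma>" using p goodD(5)[OF good] by (auto intro: clos.intros)
  then show ?thesis using p Conj1 goodD(5)[OF good]
    by (intro good_child[OF good]) auto
next
  case (Conj2 \<phi> \<psi> u)
  then have "\<psi> \<in> clos \<gamma>" using p goodD(5)[OF good] by (auto intro: clos.intros)
  then show ?thesis using p Conj2 goodD(5)[OF good]
    by (intro good_child[OF good]) auto
next
  case (Mu Z \<phi> u)
  have f: "PFix Mu Z \<phi> \<in> clos \<gamma>" using p Mu goodD(5)[OF good] by blast
  then have "prefix (restrict_names xs u Z) u"
    using good_idx(3)[OF good] goodD(7)[OF good] p Mu clos_PFix
    by (intro prefix_restrict_names) auto
  then show ?thesis using p Mu goodD(5)[OF good] clos.intros(8)[OF f]
    by (intro good_child[OF good]) auto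
next
  case (Nu Z z \<phi> u)
  have f: "PFix Nu Z \<phi> \<in> clos \<gamma>" using p Nu goodD(5)[OF good] by blast
  have u: "set u \<subseteq> names \<gamma>" "Z \<in> set xs" "sorted (map rank u)"
    using good_idx(3)[OF good] goodD(7)[OF good] p Nu clos_PFix[OF f] by auto
  have z: "fst z = Z" "z \<in> names \<gamma>" "z \<notin> set w" using first_unusedD[OF Nu(5)] by auto
  have pu: "(PFix Nu Z \<phi>, u) \<in> \<Gamma>" using p Nu by simp
  show ?thesis
  proof (rule good_child[OF good])
    show "new = [] \<or> (\<exists>z \<phi>0 u0 \<phi>. new = [z] \<and> z \<notin> set w \<and> z \<in> names \<gamma> \<and> (\<phi>0, u0) \<in> \<Gamma> \<and>
        prefix (restrict_names xs u Z) u0 \<and> sorted (map rank (restrict_names xs u Z @ [z])) \<and>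
        (\<phi>, restrict_names xs u Z @ [z]) \<in> \<Gamma> - {p} \<union> Q)"
      using Nu z pu sorted_restrict_snoc[OF u z(1)] prefix_restrict_names[OF u] by blast
    show "\<phi>' \<in> clos \<gamma>" if "(\<phi>', u') \<in> \<Gamma> - {p} \<union> Q" for \<phi>' u'
      using that Nu goodD(5)[OF good] clos.intros(8)[OF f] by auto
    show "(\<exists>\<phi>0 u0. (\<phi>0, u0) \<in> \<Gamma> \<and> prefix u' u0) \<or> new \<noteq> [] \<and> u' = restrict_names xs u Z @ new"
      if "(\<phi>', u') \<in> \<Gamma> - {p} \<union> Q" for \<phi>' u'
      using that Nu by auto
  qed
qed

lemma red_good: "red s r s' \<Longrightarrow> good s \<Longrightarrow> good s'"
proof (induction rule: red.induct)
  case (Thin \<phi> u \<Gamma> v w \<Delta>)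
  have "good (still_occurring w \<Delta> @ [], \<Delta>)"
    using Thin goodD(5)[OF Thin(5)] by (intro good_child[OF Thin(5)]) auto
  then show ?case by simp
next
  case (Reset P \<Gamma> z u \<Delta> w)
  have 1: "\<phi> \<in> clos \<gamma> \<and> (\<exists>\<phi>0 u0. (\<phi>0, u0) \<in> \<Gamma> \<and> prefix u' u0)" if "(\<phi>, u') \<in> \<Delta>" for \<phi> u'
  proof -
    consider "(\<phi>, u') \<in> \<Gamma>" | u0 where "(\<phi>, u0) \<in> P" "u' = u @ [z]"
      using \<open>(\<phi>, u') \<in> \<Delta>\<close> Reset(5) by auto
    then show ?thesis
    proof cases
      case 2
      then have "(\<phi>, u0) \<in> \<Gamma>" "prefix u' u0" using Reset(1) Reset(4)[OF 2(1)] by (auto simp: prefix_def)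
      then show ?thesis using goodD(5)[OF Reset(6)] by blast
    qed (use goodD(5)[OF Reset(6)] in blast)
  qed
  have "good (still_occurring w \<Delta> @ [], \<Delta>)"
    by (intro good_child[OF Reset(6)]) (use 1 in auto)
  then show ?case by simp
next
  case (Logical w \<Gamma> p r Q new \<Delta>)
  then show ?case using expands_child by blast
qed

lemma structural_red: 
  assumes "good s" "structural \<gamma> xs r s s'"
  shows "\<exists>r s'. red s r s'"
  using assms(2)
proof cases
  case (Thin w u v \<Delta> \<Gamma> \<phi>)
  then show ?thesis using red.Thin[of \<phi> u "\<Gamma> \<union> {(\<phi>, u), (\<phi>, v)}" v w] by blast
next
  case (Reset fs z \<Gamma> \<Delta> u w)
  define P where "P = {(\<phi>, u @ [z, z'] @ v) | \<phi> z' v. (\<phi>, z', v) \<in> set fs}"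
  have "red (w, \<Gamma> \<union> P) (ResetR z) (still_occurring w (\<Gamma> \<union> P - P \<union> (\<lambda>(\<phi>, _). (\<phi>, u @ [z])) ` P),
      \<Gamma> \<union> P - P \<union> (\<lambda>(\<phi>, _). (\<phi>, u @ [z])) ` P)"
  proof (rule red.Reset)
    obtain \<phi> z' v where "(\<phi>, z', v) \<in> set fs" using Reset(4) by (cases fs) auto
    then show "P \<noteq> {}" unfolding P_def by blast
    show "z \<notin> names_of (\<Gamma> \<union> P - P)" using Reset(5) by (auto simp: names_of_def)
    show "\<exists>z' v. u' = u @ [z, z'] @ v \<and> fst z' = fst z" if "(\<phi>, u') \<in> P" for \<phi> u'
      using that Reset(6) unfolding P_def by blast
  qed auto
  then show ?thesis unfolding Reset(2) P_def[symmetric] by blast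
qed

lemma still_occurring_all: "set w \<subseteq> names_of \<Delta> \<Longrightarrow> still_occurring w \<Delta> = w"
  by (auto simp: still_occurring_def filter_id_conv)

text \<open>A search may choose the rule but not which of its conclusions is unprovable. So all
  conclusions must be reductions, including both at a conjunction.\<close>

lemma red_applies:
  assumes "red s r s'" "good s"
  shows "\<exists>ss. applies \<gamma> xs r s ss \<and> (\<forall>s''\<in>set ss. red s r s'')"
  using assms
proof (induction rule: red.induct)
  case (Thin \<phi> u \<Gamma> v w \<Delta>)
  have "u \<noteq> v" using Thin(3) sq_less_irrefl[OF goodD(2)[OF Thin(5)]] by blast
  then have eq: "\<Delta> \<union> {(\<phi>, u), (\<phi>, v)} = \<Gamma>" "\<Delta> = \<Delta> \<union> {(\<phi>, u)}" using Thin by auto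
  have "structural \<gamma> xs ThinR (w, \<Delta> \<union> {(\<phi>, u), (\<phi>, v)}) (still_occurring w \<Delta>, \<Delta>)"
    by (rule structural.Thin[OF Thin(3) eq(2)])
  then have "applies \<gamma> xs ThinR (w, \<Gamma>) [(still_occurring w \<Delta>, \<Delta>)]"
    unfolding eq(1) applies_def by blast
  moreover have "red (w, \<Gamma>) ThinR (still_occurring w \<Delta>, \<Delta>)" using Thin(1-4) by (rule red.Thin)
  ultimately show ?case by (intro exI[of _ "[(still_occurring w \<Delta>, \<Delta>)]"]) simp
next
  case (Reset P \<Gamma> z u \<Delta> w)
  have "finite P" using Reset(1) finite_sequent[OF goodD(1)[OF Reset(6)]] finite_subset by blast
  then obtain ps where ps: "set ps = P" using finite_list by blast
  define fs where "fs = map (\<lambda>(\<phi>, u'). (\<phi>, u' ! Suc (length u), drop (Suc (Suc (length u))) u')) ps"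
  have fs: "(\<phi>, z', v) \<in> set fs \<longleftrightarrow> (\<phi>, u @ [z, z'] @ v) \<in> P" for \<phi> z' v
  proof
    assume "(\<phi>, z', v) \<in> set fs"
    then obtain u' where u': "(\<phi>, u') \<in> P" "z' = u' ! Suc (length u)" "v = drop (Suc (Suc (length u))) u'"
      by (auto simp: fs_def ps)
    then show "(\<phi>, u @ [z, z'] @ v) \<in> P" using Reset(4)[OF u'(1)] by (auto simp: nth_append)
  next
    assume "(\<phi>, u @ [z, z'] @ v) \<in> P"
    then show "(\<phi>, z', v) \<in> set fs"
      unfolding fs_def set_map ps by (rule rev_image_eqI) (simp add: nth_append)
  qed
  have P: "{(\<phi>, u @ [z, z'] @ v) | \<phi> z' v. (\<phi>, z', v) \<in> set fs} = P"
    unfolding fs using Reset(4) by (auto; metis)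
  have img: "{(\<phi>, u @ [z]) | \<phi> z' v. (\<phi>, z', v) \<in> set fs} = (\<lambda>(\<phi>, _). (\<phi>, u @ [z])) ` P"
  proof -
    have "(\<lambda>(\<phi>, _). (\<phi>, u @ [z])) ` {(\<phi>, u @ [z, z'] @ v) | \<phi> z' v. (\<phi>, z', v) \<in> set fs} =
        {(\<phi>, u @ [z]) | \<phi> z' v. (\<phi>, z', v) \<in> set fs}" by force
    then show ?thesis by (simp only: P)
  qed
  have "structural \<gamma> xs (ResetR z)
      (w, (\<Gamma> - P) \<union> {(\<phi>, u @ [z, z'] @ v) | \<phi> z' v. (\<phi>, z', v) \<in> set fs}) (still_occurring w \<Delta>, \<Delta>)"
  proof (rule structural.Reset)
    show "fs \<noteq> []" using Reset(2) ps by (auto simp: fs_def)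
    show "\<forall>(\<phi>, z', v)\<in>set fs. fst z' = fst z"
      using Reset(4) fs by fastforce
    show "\<Delta> = \<Gamma> - P \<union> {(\<phi>, u @ [z]) | \<phi> z' v. (\<phi>, z', v) \<in> set fs}" unfolding img by (rule Reset)
  qed (rule Reset)
  then have "structural \<gamma> xs (ResetR z) (w, \<Gamma>) (still_occurring w \<Delta>, \<Delta>)"
    unfolding P using Reset(1) by (simp add: Un_absorb2)
  then have "applies \<gamma> xs (ResetR z) (w, \<Gamma>) [(still_occurring w \<Delta>, \<Delta>)]"
    unfolding applies_def by blast
  moreover have "red (w, \<Gamma>) (ResetR z) (still_occurring w \<Delta>, \<Delta>)" using Reset(1-5) by (rule red.Reset)
  ultimately show ?case by (intro exI[of _ "[(still_occurring w \<Delta>, \<Delta>)]"]) simp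
next
  case (Logical w \<Gamma> p r Q new \<Delta>)
  have red: "red (w, \<Gamma>) r (still_occurring w (\<Gamma> - {p} \<union> Q') @ new', \<Gamma> - {p} \<union> Q')"
    if "expands w p r Q' new'" for Q' new'
    using Logical(1,2) that by (auto intro: red.Logical)
  have w: "set w = names_of \<Gamma>" using Logical goodD by blast
  have same: "still_occurring w (\<Gamma> - {p} \<union> Q') = w" if "snd p = u" "u \<in> snd ` Q'" for u Q'
    by (rule still_occurring_all) (use that w in \<open>force simp: names_of_def\<close>)
  have app: "applies \<gamma> xs r (w, \<Gamma>) ss" if "logical \<gamma> xs r (w, (\<Gamma> - {p}) \<union> {p}) ss" for ss
  proof -
    have "\<Gamma> - {p} \<union> {p} = \<Gamma>" using Logical(2) by blast
    then show ?thesis using that Logical(1) unfolding applies_def stuck_def by auto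
  qed
  have conj: "\<exists>ss. applies \<gamma> xs r (w, \<Gamma>) ss \<and> (\<forall>s''\<in>set ss. red (w, \<Gamma>) r s'')"
    if pr: "p = (PConj \<phi> \<psi>, u)" "r = AndR" for \<phi> \<psi> u
  proof -
    have "red (w, \<Gamma>) r (w, (\<Gamma> - {p}) \<union> {(\<phi>, u)})" "red (w, \<Gamma>) r (w, (\<Gamma> - {p}) \<union> {(\<psi>, u)})"
      using red[of "{(\<phi>, u)}" "[]"] red[of "{(\<psi>, u)}" "[]"] same[of u "{(\<phi>, u)}"]
        same[of u "{(\<psi>, u)}"] pr expands.Conj1 expands.Conj2 by auto
    then show ?thesis using app logical.And[of \<gamma> xs w "\<Gamma> - {p}" \<phi> \<psi> u] pr
      by (intro exI[of _ "[(w, (\<Gamma> - {p}) \<union> {(\<phi>, u)}), (w, (\<Gamma> - {p}) \<union> {(\<psi>, u)})]"]) simp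
  qed
  from Logical(3) show ?case
  proof cases
    case (Disj \<phi> \<psi> u)
    have "red (w, \<Gamma>) r (w, (\<Gamma> - {p}) \<union> Q)" using red[OF Logical(3)] same[of u Q] Disj by simp
    then show ?thesis using app logical.Or[of \<gamma> xs w "\<Gamma> - {p}" \<phi> \<psi> u] Disj
      by (intro exI[of _ "[(w, (\<Gamma> - {p}) \<union> Q)]"]) simp
  next
    case (Conj1 \<phi> \<psi> u)
    then show ?thesis by (intro conj)
  next
    case (Conj2 \<phi> \<psi> u)
    then show ?thesis by (intro conj)
  next
    case (Mu Z \<phi> u)
    then show ?thesis using app logical.Mu[OF refl, of \<gamma> xs w "\<Gamma> - {p}" Z \<phi> u] red[OF Logical(3)]
      by (intro exI[of _ "[(still_occurring w (\<Gamma> - {p} \<union> Q), \<Gamma> - {p} \<union> Q)]"]) simp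
  next
    case (Nu Z z \<phi> u)
    then show ?thesis using app logical.Nu[OF Nu(5) refl, of xs "\<Gamma> - {p}" \<phi> u] red[OF Logical(3)]
      by (intro exI[of _ "[(still_occurring w (\<Gamma> - {p} \<union> Q) @ [z], \<Gamma> - {p} \<union> Q)]"]) simp
  qed
qed

section \<open>Modal successors and irreducible sequents\<close>

definition modal_child ::
  "('v, 'p, 'a) sequent \<Rightarrow> 'a \<Rightarrow> ('v, 'p, 'a) pform \<Rightarrow> 'v name list \<Rightarrow> ('v, 'p, 'a) sequent" where
  "modal_child = (\<lambda>(w, \<Gamma>) a \<psi> u.
     let \<Delta> = {(\<phi>, v). (PDia a \<phi>, v) \<in> \<Gamma>} \<union> {(\<psi>, u)} in (still_occurring w \<Delta>, \<Delta>))"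

lemma modal_child_good:
  assumes "good (w, \<Gamma>)" "(PBox a \<psi>, u) \<in> \<Gamma>"
  shows "good (modal_child (w, \<Gamma>) a \<psi> u)"
proof -
  let ?\<Delta> = "{(\<phi>, v). (PDia a \<phi>, v) \<in> \<Gamma>} \<union> {(\<psi>, u)}"
  have "\<phi> \<in> clos \<gamma> \<and> (\<exists>\<phi>0 u0. (\<phi>0, u0) \<in> \<Gamma> \<and> prefix u' u0)" if mem: "(\<phi>, u') \<in> ?\<Delta>" for \<phi> u'
  proof -
    consider "(PDia a \<phi>, u') \<in> \<Gamma>" | "(PBox a \<phi>, u') \<in> \<Gamma>" using mem assms(2) by auto
    then show ?thesis
    proof cases
      case 1
      then show ?thesis using clos.intros(7)[OF goodD(5)[OF assms(1) 1]] by blast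
    next
      case 2
      then show ?thesis using clos.intros(6)[OF goodD(5)[OF assms(1) 2]] by blast
    qed
  qed
  then have "good (still_occurring w ?\<Delta> @ [], ?\<Delta>)"
    by (intro good_child[OF assms(1)]) simp_all
  then show ?thesis by (simp add: modal_child_def Let_def)
qed

lemma modal_child_applies:
  assumes "stuck (w, \<Gamma>)" "(PBox a \<psi>, u) \<in> \<Gamma>"
  shows "applies \<gamma> xs ModalR (w, \<Gamma>) [modal_child (w, \<Gamma>) a \<psi> u]"
proof -
  let ?S = "{(\<phi>, v). (PDia a \<phi>, v) \<in> \<Gamma>}"
  have "\<Gamma> \<union> {(PDia a \<phi>, v) | \<phi> v. (\<phi>, v) \<in> ?S} \<union> {(PBox a \<psi>, u)} = \<Gamma>" using assms(2) by auto
  then have "logical \<gamma> xs ModalR (w, \<Gamma>) [modal_child (w, \<Gamma>) a \<psi> u]"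
    using logical.Modal[OF refl, of \<gamma> xs w \<Gamma> a ?S \<psi> u] by (simp add: modal_child_def Let_def)
  then show ?thesis using assms(1) by (auto simp: applies_def stuck_def)
qed

lemma stuck_unique:
  assumes "good (w, \<Gamma>)" "stuck (w, \<Gamma>)" "(\<phi>, u) \<in> \<Gamma>" "(\<phi>, v) \<in> \<Gamma>"
  shows "u = v"
proof (rule ccontr)
  assume "u \<noteq> v"
  then have "sq_less \<gamma> xs w u v \<or> sq_less \<gamma> xs w v u"
    using goodD[OF assms(1)] good_idx[OF assms(1)] assms(3,4) by (intro sq_less_total) auto
  then have "\<exists>r s'. structural \<gamma> xs r (w, \<Gamma> \<union> {(\<phi>, u), (\<phi>, v)}) s'"
    using structural.Thin[OF _ refl, of \<gamma> xs w u v \<Gamma> \<phi>] structural.Thin[OF _ refl, of \<gamma> xs w v u \<Gamma> \<phi>]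
    by (auto simp: insert_commute)
  moreover have "\<Gamma> \<union> {(\<phi>, u), (\<phi>, v)} = \<Gamma>" using assms by blast
  ultimately show False using assms(2) unfolding stuck_def by auto
qed

text \<open>Otherwise every index with \<open>z\<close> has a later name of the same variable, and
  by sortedness the name right after \<open>z\<close> is already one. As \<open>z\<close> is always
  preceded by the same \<open>u\<close>, \<open>Reset\<^sub>z\<close> would apply.\<close>

lemma stuck_last_name:
  assumes good: "good (w, \<Gamma>)" and stuck: "stuck (w, \<Gamma>)" and z: "z \<in> set w"
  shows "\<exists>\<phi> a b. (\<phi>, a @ z # b) \<in> \<Gamma> \<and> (\<forall>y\<in>set b. fst y \<noteq> fst z)"
proof (rule ccontr)
  assume neg: "\<not> ?thesis"
  define P where "P = {(\<phi>, u) \<in> \<Gamma>. z \<in> set u}"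
  have "z \<in> names_of \<Gamma>" using z goodD(4)[OF good] by simp
  then obtain \<phi>0 u0 where 0: "(\<phi>0, u0) \<in> \<Gamma>" "z \<in> set u0" unfolding names_of_def by blast
  then obtain u b0 where u: "u0 = u @ z # b0" by (meson split_list)
  have P: "\<exists>z' v. u' = u @ [z, z'] @ v \<and> fst z' = fst z" if "(\<phi>, u') \<in> P" for \<phi> u'
  proof -
    have "(\<phi>, u') \<in> \<Gamma>" "z \<in> set u'" using that by (auto simp: P_def)
    then obtain u2 b where b: "u' = u2 @ z # b" by (meson split_list)
    have "u2 = u" using goodD(8)[OF good] 0(1) \<open>(\<phi>, u') \<in> \<Gamma>\<close> unfolding u b by blast
    obtain y where y: "y \<in> set b" "fst y = fst z" using neg \<open>(\<phi>, u') \<in> \<Gamma>\<close> b by blast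
    then obtain z' v where v: "b = z' # v" by (cases b) auto
    have "sorted (map rank u')" "set u' \<subseteq> names \<gamma>"
      using goodD(7)[OF good] good_idx(3)[OF good] \<open>(\<phi>, u') \<in> \<Gamma>\<close> by auto
    then have "rank z \<le> rank z'" "rank z' \<le> rank y" "fst z' \<in> set xs" "fst z \<in> set xs"
      using y names_vars unfolding b v by (auto simp: sorted_append)
    then have "fst z' = fst z" using y(2) pos_eq_iff[of "fst z'" xs "fst z"] by auto
    then show ?thesis unfolding b v \<open>u2 = u\<close> by simp
  qed
  have "red (w, \<Gamma>) (ResetR z) (still_occurring w (\<Gamma> - P \<union> (\<lambda>(\<phi>, _). (\<phi>, u @ [z])) ` P),
      \<Gamma> - P \<union> (\<lambda>(\<phi>, _). (\<phi>, u @ [z])) ` P)"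
    by (rule red.Reset) (use 0 P in \<open>auto simp: P_def names_of_def\<close>)
  from red_applies[OF this good] have "\<exists>ss. applies \<gamma> xs (ResetR z) (w, \<Gamma>) ss" by blast
  then show False using stuck by (auto simp: applies_def stuck_def elim: logical.cases)
qed

text \<open>Why \<open>len \<gamma>\<close> names suffice: each name of \<open>Z\<close> in use is
  the last name of \<open>Z\<close> in some index, and a stuck sequent has only one index per
  formula. So the names of \<open>Z\<close> inject into the closure, which has fewer than
  \<open>len \<gamma>\<close> elements.\<close>

lemma first_unused_exists:
  assumes good: "good (w, \<Gamma>)" and stuck: "stuck (w, \<Gamma>)" and p: "(PFix Nu Z \<phi>, u) \<in> \<Gamma>"
  shows "\<exists>z. first_unused \<gamma> w Z z"
proof -
  note f = goodD(5)[OF good p]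
  have Z: "Z \<in> set xs" "Z \<in> nu_vars \<gamma>" using clos_PFix[OF f] by (auto simp: nu_vars_iff)
  define N where "N = {z \<in> set w. fst z = Z}"
  have "\<forall>z\<in>N. \<exists>\<phi> a b. (\<phi>, a @ z # b) \<in> \<Gamma> \<and> (\<forall>y\<in>set b. fst y \<noteq> Z)"
    using stuck_last_name[OF good stuck] by (auto simp: N_def)
  then obtain F where F: "\<forall>z\<in>N. \<exists>a b. (F z, a @ z # b) \<in> \<Gamma> \<and> (\<forall>y\<in>set b. fst y \<noteq> Z)" by metis
  have "inj_on F N"
  proof (rule inj_onI)
    fix z z' assume z: "z \<in> N" "z' \<in> N" "F z = F z'"
    obtain a b where ab: "(F z, a @ z # b) \<in> \<Gamma>" "\<forall>y\<in>set b. fst y \<noteq> Z" using F z by blast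
    obtain a' b' where ab': "(F z, a' @ z' # b') \<in> \<Gamma>" "\<forall>y\<in>set b'. fst y \<noteq> Z" using F z by metis
    have eq: "a @ z # b = a' @ z' # b'" using stuck_unique[OF good stuck ab(1) ab'(1)] .
    have "filter (\<lambda>y. fst y = Z) (a @ z # b) = filter (\<lambda>y. fst y = Z) a @ [z]"
      "filter (\<lambda>y. fst y = Z) (a' @ z' # b') = filter (\<lambda>y. fst y = Z) a' @ [z']"
      using z ab(2) ab'(2) by (auto simp: N_def filter_empty_conv)
    then show "z = z'" using eq by simp
  qed
  moreover have "F ` N \<subseteq> clos \<gamma>" using F goodD(5)[OF good] by blast
  ultimately have "card N \<le> card (clos \<gamma>)" using finite_clos card_inj_on_le by blast
  then have card: "card N < len \<gamma>" using card_clos[OF Z(1)] by simp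
  have "\<exists>i. 1 \<le> i \<and> i \<le> len \<gamma> \<and> (Z, i) \<notin> set w"
  proof (rule ccontr)
    assume "\<not> ?thesis"
    then have "Pair Z ` {1..len \<gamma>} \<subseteq> N" by (auto simp: N_def)
    moreover have "card (Pair Z ` {1..len \<gamma>}) = len \<gamma>" by (subst card_image) (auto intro: inj_onI)
    moreover have "finite N" by (simp add: N_def)
    ultimately show False using card card_mono by (metis not_less)
  qed
  then obtain i0 where i0: "1 \<le> i0 \<and> i0 \<le> len \<gamma> \<and> (Z, i0) \<notin> set w" by blast
  define i where "i = (LEAST i. 1 \<le> i \<and> i \<le> len \<gamma> \<and> (Z, i) \<notin> set w)"
  have i: "1 \<le> i \<and> i \<le> len \<gamma> \<and> (Z, i) \<notin> set w" unfolding i_def using i0 by (rule LeastI)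
  have "(Z, j) \<in> set w" if "1 \<le> j" "j < i" for j
    using not_less_Least[of j "\<lambda>i. 1 \<le> i \<and> i \<le> len \<gamma> \<and> (Z, i) \<notin> set w"] that i
    unfolding i_def[symmetric] by auto
  then show ?thesis using i Z by (auto simp: first_unused_def names_def)
qed

lemma irreducible_stuck: "good s \<Longrightarrow> \<not> (\<exists>r s'. red s r s') \<Longrightarrow> stuck s"
  using structural_red unfolding stuck_def by blast

lemma irreducible_formulas:
  assumes "good (w, \<Gamma>)" "\<not> (\<exists>r s'. red (w, \<Gamma>) r s')" "(\<phi>, u) \<in> \<Gamma>"
  shows "\<phi> \<noteq> PConj \<psi> \<chi>" "\<phi> \<noteq> PDisj \<psi> \<chi>" "\<phi> \<noteq> PFix \<sigma> Z \<psi>"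
proof -
  have stuck: "stuck (w, \<Gamma>)" using irreducible_stuck[OF assms(1,2)] .
  have no: "\<not> expands w (\<phi>, u) r Q new" for r Q new
    using red.Logical[OF stuck assms(3) _ refl] assms(2) by blast
  show "\<phi> \<noteq> PConj \<psi> \<chi>" "\<phi> \<noteq> PDisj \<psi> \<chi>" using no by (auto intro: expands.intros)
  show "\<phi> \<noteq> PFix \<sigma> Z \<psi>"
  proof
    assume \<phi>: "\<phi> = PFix \<sigma> Z \<psi>"
    show False
    proof (cases \<sigma>)
      case Mu
      then show False using no \<phi> expands.Mu by blast
    next
      case Nu
      then show False using no \<phi> expands.Nu first_unused_exists[OF assms(1) stuck] assms(3) by blast
    qed
  qed
qed

text \<open>Logical reductions lower the first component, because guarded unfoldings do not raise
  \<open>outer_size\<close>. Structural ones do not raise it and lower the second, where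
  \<open>Suc\<close> lets even the removal of an element with empty index count.\<close>

definition weight :: "('v, 'p, 'a) sequent \<Rightarrow> nat \<times> nat" where
  "weight s = (\<Sum>p\<in>snd s. outer_size (fst p), \<Sum>p\<in>snd s. Suc (length (snd p)))"

abbreviation lighter :: "('v, 'p, 'a) sequent \<Rightarrow> ('v, 'p, 'a) sequent \<Rightarrow> bool" where
  "lighter s' s \<equiv> (weight s', weight s) \<in> less_than <*lex*> less_than"

lemma good_finite: "good (w, \<Gamma>) \<Longrightarrow> finite \<Gamma>"
  by (rule finite_sequent[OF goodD(1)])

lemma sum_Un_le_nat: "finite A \<Longrightarrow> finite B \<Longrightarrow> sum f (A \<union> B) \<le> sum f A + (sum f B :: nat)"
  by (simp add: sum_Un_nat)

lemma red_weight: "red s r s' \<Longrightarrow> good s \<Longrightarrow> lighter s' s"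
proof (induction rule: red.induct)
  case (Thin \<phi> u \<Gamma> v w \<Delta>)
  have "finite \<Gamma>" using good_finite[OF Thin(5)] .
  then have "sum f \<Gamma> = f (\<phi>, v) + sum f \<Delta>" for f :: "_ \<Rightarrow> nat"
    using Thin by (simp add: sum.remove[of \<Gamma> "(\<phi>, v)"])
  then show ?case by (auto simp: weight_def le_less)
next
  case (Reset P \<Gamma> z u \<Delta> w)
  have fin: "finite \<Gamma>" using good_finite[OF Reset(6)] .
  then have finP: "finite P" using Reset(1) finite_subset by blast
  let ?g = "\<lambda>(\<phi>, _). (\<phi>, u @ [z])"
  have split: "sum f \<Gamma> = sum f (\<Gamma> - P) + sum f P" for f :: "_ \<Rightarrow> nat"
    using sum.subset_diff[OF Reset(1) fin] .
  have le: "sum f \<Delta> \<le> sum f (\<Gamma> - P) + sum (f \<circ> ?g) P" for f :: "_ \<Rightarrow> nat"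
  proof -
    have "sum f \<Delta> \<le> sum f (\<Gamma> - P) + sum f (?g ` P)"
      unfolding Reset(5) using fin finP by (intro sum_Un_le_nat) auto
    also have "sum f (?g ` P) \<le> sum (f \<circ> ?g) P" using finP by (intro sum_image_le) auto
    finally show ?thesis by simp
  qed
  have "sum ((\<lambda>p. outer_size (fst p)) \<circ> ?g) P = (\<Sum>p\<in>P. outer_size (fst p))"
    by (rule sum.cong) (auto split: prod.split)
  then have 1: "(\<Sum>p\<in>\<Delta>. outer_size (fst p)) \<le> (\<Sum>p\<in>\<Gamma>. outer_size (fst p))"
    using le[of "\<lambda>p. outer_size (fst p)"] split[of "\<lambda>p. outer_size (fst p)"] by simp
  have "sum ((\<lambda>p. Suc (length (snd p))) \<circ> ?g) P < (\<Sum>p\<in>P. Suc (length (snd p)))"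
  proof (rule sum_strict_mono[OF finP Reset(2)])
    fix p assume "p \<in> P"
    then show "((\<lambda>p. Suc (length (snd p))) \<circ> ?g) p < Suc (length (snd p))"
      using Reset(4)[of "fst p" "snd p"] by (auto simp: case_prod_beta)
  qed
  then have "(\<Sum>p\<in>\<Delta>. Suc (length (snd p))) < (\<Sum>p\<in>\<Gamma>. Suc (length (snd p)))"
    using le[of "\<lambda>p. Suc (length (snd p))"] split[of "\<lambda>p. Suc (length (snd p))"] by linarith
  then show ?case using 1 by (auto simp: weight_def le_less)
next
  case (Logical w \<Gamma> p r Q new \<Delta>)
  have fin: "finite \<Gamma>" using good_finite[OF Logical(5)] .
  have f: "PFix \<sigma> Z \<phi> \<in> clos \<gamma>" if "p = (PFix \<sigma> Z \<phi>, u)" for \<sigma> Z \<phi> u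
    using goodD(5)[OF Logical(5)] Logical(2) that by blast
  have Q: "(\<Sum>p\<in>Q. outer_size (fst p)) < outer_size (fst p) \<and> finite Q"
    using Logical(3)
  proof cases
    case (Disj \<phi> \<psi> u)
    then show ?thesis by (cases "\<phi> = \<psi>") auto
  next
    case (Mu Z \<phi> u)
    then show ?thesis using outer_size_unfold f by simp
  next
    case (Nu Z z \<phi> u)
    then show ?thesis using outer_size_unfold f by simp
  qed auto
  have "(\<Sum>p\<in>\<Delta>. outer_size (fst p)) \<le> (\<Sum>p\<in>\<Gamma> - {p}. outer_size (fst p)) + (\<Sum>p\<in>Q. outer_size (fst p))"
    unfolding Logical(4) using fin Q by (intro sum_Un_le_nat) auto
  also have "\<dots> < (\<Sum>p\<in>\<Gamma>. outer_size (fst p))"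
    using Q sum.remove[OF fin Logical(2), of "\<lambda>p. outer_size (fst p)"] by simp
  finally show ?case by (simp add: weight_def)
qed

section \<open>Traces of names\<close>

text \<open>\<open>index_step w u r X u'\<close>: the index \<open>u\<close> of a formula in a sequent with names \<open>w\<close> becomes \<open>u'\<close>
  through the rule \<open>r\<close>, which unfolds the formula if \<open>X\<close> is the variable of a fixed point.\<close>

inductive index_step ::
  "'v name list \<Rightarrow> 'v name list \<Rightarrow> 'v rule \<Rightarrow> 'v option \<Rightarrow> 'v name list \<Rightarrow> bool" for w u where
  Keep: "index_step w u r None u"
| Thin: "sq_less \<gamma> xs w u' u \<Longrightarrow> index_step w u r None u'"
| Reset: "u = a @ [z, y] @ b \<Longrightarrow> fst y = fst z \<Longrightarrow> index_step w u (ResetR z) None (a @ [z])"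
| Mu: "Y \<in> set xs \<Longrightarrow> op_of Y = Mu \<Longrightarrow> index_step w u r (Some Y) (restrict_names xs u Y)"
| Nu: "Y \<in> set xs \<Longrightarrow> op_of Y = Nu \<Longrightarrow> fst z = Y \<Longrightarrow> z \<notin> set w \<Longrightarrow>
    index_step w u r (Some Y) (restrict_names xs u Y @ [z])"

definition has_name :: "nat \<Rightarrow> nat \<Rightarrow> 'v name list \<Rightarrow> bool" where
  "has_name k n u \<longleftrightarrow> n < length u \<and> rank (u ! n) \<le> k"

lemma nth_restrict_names:
  assumes "set u \<subseteq> names \<gamma>" "X \<in> set xs" "sorted (map rank u)"
  shows "n < length (restrict_names xs u X) \<longleftrightarrow> has_name (pos xs X) n u"
    and "n < length (restrict_names xs u X) \<Longrightarrow> restrict_names xs u X ! n = u ! n"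
proof -
  let ?P = "\<lambda>z. rank z \<le> pos xs X"
  have eq: "restrict_names xs u X = takeWhile ?P u"
    using restrict_names_eq[OF assms(1,2)] sorted_filter_takeWhile[OF assms(3)] by simp
  show "n < length (restrict_names xs u X) \<Longrightarrow> restrict_names xs u X ! n = u ! n"
    unfolding eq by (rule takeWhile_nth)
  show "n < length (restrict_names xs u X) \<longleftrightarrow> has_name (pos xs X) n u"
  proof
    assume n: "n < length (restrict_names xs u X)"
    then have "u ! n \<in> set (takeWhile ?P u)" unfolding eq by (metis nth_mem takeWhile_nth)
    then have "?P (u ! n)" by (rule set_takeWhileD[THEN conjunct2])
    then show "has_name (pos xs X) n u"
      using n length_takeWhile_le[of ?P u] unfolding eq has_name_def by simp
  next
    assume n: "has_name (pos xs X) n u"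
    show "n < length (restrict_names xs u X)"
    proof (rule ccontr)
      assume "\<not> ?thesis"
      then have le: "length (takeWhile ?P u) \<le> n" unfolding eq by simp
      then have len: "length (takeWhile ?P u) < length u" using n by (simp add: has_name_def)
      then have "\<not> ?P (u ! length (takeWhile ?P u))" by (rule nth_length_takeWhile)
      moreover have "rank (u ! length (takeWhile ?P u)) \<le> rank (u ! n)"
        using sorted_nth_mono[OF assms(3), of "length (takeWhile ?P u)" n] le n len
        by (simp add: has_name_def)
      ultimately show False using n by (simp add: has_name_def)
    qed
  qed
qed

text \<open>Assume that the first \<open>n\<close> entries are stable and that nothing before
  \<open>K\<close> in \<open>xs\<close> is unfolded. Unfoldings then cut off only names of larger
  rank than \<open>K\<close>. A Thin step cannot differ before position \<open>n\<close>, and there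
  it moves to an outer variable or an earlier name. A reset that removes entry \<open>n\<close> is a
  reset of the stable entry in front of it.\<close>

lemma index_step_name:
  assumes step: "index_step w u r X u'"
    and w: "distinct w" "set w \<subseteq> names \<gamma>"
    and u: "set u \<subseteq> set w" "sorted (map rank u)"
    and u': "set u' \<subseteq> names \<gamma>" "sorted (map rank u')"
    and K: "K \<in> set xs" "op_of K = Nu"
    and outer: "\<And>Y. X = Some Y \<Longrightarrow> pos xs K \<le> pos xs Y"
    and p: "\<And>j. j < n \<Longrightarrow> has_name (pos xs K) j u \<and> u ! j = p j"
    and p': "\<And>j. j < n \<Longrightarrow> has_name (pos xs K) j u' \<and> u' ! j = p j"
  shows "has_name (pos xs K) n u \<Longrightarrow> \<not> has_name (pos xs K) n u' \<Longrightarrow> n > 0 \<and> r = ResetR (p (n - 1))"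
    and "X = Some K \<Longrightarrow> has_name (pos xs K) n u'"
    and "has_name (pos xs K) n u \<Longrightarrow> has_name (pos xs K) n u' \<Longrightarrow>
      u' ! n = u ! n \<or> rank (u' ! n) < rank (u ! n) \<or>
      rank (u' ! n) = rank (u ! n) \<and> pos w (u' ! n) < pos w (u ! n)"
proof -
  let ?k = "pos xs K"
  let ?H = "has_name ?k n"
  have un: "set u \<subseteq> names \<gamma>" using u w by blast
  have "(?H u \<longrightarrow> \<not> ?H u' \<longrightarrow> n > 0 \<and> r = ResetR (p (n - 1))) \<and> (X = Some K \<longrightarrow> ?H u') \<and>
    (?H u \<longrightarrow> ?H u' \<longrightarrow> u' ! n = u ! n \<or> rank (u' ! n) < rank (u ! n) \<or>
      rank (u' ! n) = rank (u ! n) \<and> pos w (u' ! n) < pos w (u ! n))"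
    using step
  proof cases
    case Keep
    then show ?thesis by simp
  next
    case (Mu Y)
    note R = nth_restrict_names[OF un Mu(3) u(2)]
    have "?k \<le> pos xs Y" "Y \<noteq> K" using outer Mu K by auto
    then have "?H u \<Longrightarrow> n < length u' \<and> u' ! n = u ! n"
      using R[of n] Mu by (auto simp: has_name_def)
    then show ?thesis using Mu \<open>Y \<noteq> K\<close> by (auto simp: has_name_def)
  next
    case (Nu Y z)
    note R = nth_restrict_names[OF un Nu(3) u(2)]
    have "?k \<le> pos xs Y" using outer Nu by auto
    then have 1: "?H u \<Longrightarrow> n < length (restrict_names xs u Y) \<and> u' ! n = u ! n"
      using R[of n] Nu by (auto simp: has_name_def nth_append)
    have "?H u'" if "Y = K"
    proof -
      let ?m = "length (restrict_names xs u Y)"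
      have "j < ?m" if "j < n" for j using R(1)[of j] p[OF that] \<open>Y = K\<close> by simp
      then have "n \<le> ?m" by (meson not_le order_less_irrefl)
      then consider "n < ?m" | "n = ?m" by linarith
      then show ?thesis
      proof cases
        case 1
        then show ?thesis using R[of n] Nu that by (auto simp: has_name_def nth_append)
      next
        case 2
        then show ?thesis using Nu that by (auto simp: has_name_def nth_append)
      qed
    qed
    then show ?thesis using 1 Nu by (auto simp: has_name_def)
  next
    case (Reset a z y b)
    have "n \<le> length u'"
      using p' unfolding has_name_def by (meson not_le order_less_irrefl)
    then consider "n < length u'" | "n = Suc (length a)" using Reset by fastforce
    then show ?thesis
    proof cases
      case 1
      then have "u' ! n = u ! n" using Reset by (auto simp: nth_append less_Suc_eq)
      then show ?thesis using 1 Reset by (auto simp: has_name_def)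
    next
      case 2
      then have "p (n - 1) = z" using p'[of "n - 1"] Reset by (simp add: nth_append)
      then show ?thesis using 2 Reset by (auto simp: has_name_def)
    qed
  next
    case Thin
    have "?H u' \<and> (u' ! n = u ! n \<or> rank (u' ! n) < rank (u ! n) \<or>
      rank (u' ! n) = rank (u ! n) \<and> pos w (u' ! n) < pos w (u ! n))" if H: "?H u"
      using Thin(2) unfolding sq_less_def
    proof (elim disjE bexE)
      assume "less_names w u' u"
      then obtain j where j: "j < length u'" "j < length u" "fst (u' ! j) = fst (u ! j)"
        "precedes w (u' ! j) (u ! j)" "\<forall>i<j. u' ! i = u ! i"
        unfolding less_names_def by blast
      have less: "pos w (u' ! j) < pos w (u ! j)" using j(4) precedes_iff[OF w(1)] by blast
      consider "j < n" | "j = n" | "n < j" by linarith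
      then show ?thesis
      proof cases
        case 1
        then show ?thesis using less p[OF 1] p'[OF 1] by simp
      next
        case 2
        then show ?thesis using H j less by (auto simp: has_name_def)
      next
        case 3
        then show ?thesis using H j by (auto simp: has_name_def)
      qed
    next
      fix Y assume Y: "Y \<in> nu_vars \<gamma>" and sp: "strict_prefix (restrict_names xs u Y) (restrict_names xs u' Y)"
      have Yx: "Y \<in> set xs" using Y nu_vars_iff by blast
      note R = nth_restrict_names[OF un Yx u(2)] and R' = nth_restrict_names[OF u'(1) Yx u'(2)]
      let ?m = "length (restrict_names xs u Y)" and ?m' = "length (restrict_names xs u' Y)"
      have m: "?m < ?m'" using sp by (rule prefix_length_less)
      have same: "u' ! i = u ! i" if "i < ?m" for i
        using sp R(2)[OF that] R'(2)[of i] that m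
        by (auto simp: strict_prefix_def prefix_def nth_append)
      show ?thesis
      proof (cases "n < ?m")
        case True
        then show ?thesis using same[OF True] H R'(1)[of n] m by (auto simp: has_name_def)
      next
        case False
        have "\<not> has_name (pos xs Y) ?m u" using R(1)[of ?m] by simp
        have m'H: "has_name (pos xs Y) ?m u'" using R'(1)[of ?m] m by simp
        \<comment> \<open>At \<open>?m\<close> only \<open>u'\<close> has a name of rank at most
          that of \<open>Y\<close>. Below \<open>n\<close> both indices have the same entries, so
          \<open>?m\<close> cannot be there.\<close>
        have "n = ?m"
        proof (rule ccontr)
          assume "n \<noteq> ?m"
          then have "?m < n" using False by simp
          from p[OF this] p'[OF this] show False
            using \<open>\<not> has_name (pos xs Y) ?m u\<close> m'H by (auto simp: has_name_def)
        qed
        then have "rank (u' ! n) \<le> pos xs Y" "pos xs Y < rank (u ! n)" "n < length u'"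
          using m'H \<open>\<not> has_name (pos xs Y) ?m u\<close> H by (auto simp: has_name_def)
        then show ?thesis using H by (auto simp: has_name_def)
      qed
    qed
    then show ?thesis using Thin by blast
  qed
  then show "?H u \<Longrightarrow> \<not> ?H u' \<Longrightarrow> n > 0 \<and> r = ResetR (p (n - 1))" "X = Some K \<Longrightarrow> ?H u'"
    "?H u \<Longrightarrow> ?H u' \<Longrightarrow> u' ! n = u ! n \<or> rank (u' ! n) < rank (u ! n) \<or>
      rank (u' ! n) = rank (u ! n) \<and> pos w (u' ! n) < pos w (u ! n)"
    by blast+
qed

lemma eventually_constant:
  fixes m :: "nat \<Rightarrow> 'b :: wellorder"
  assumes le: "\<And>i. i \<ge> T \<Longrightarrow> m (Suc i) \<le> m i"
    and less: "\<And>i. i \<ge> T \<Longrightarrow> q (Suc i) \<noteq> q i \<Longrightarrow> m (Suc i) < m i"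
  shows "\<exists>T'\<ge>T. \<forall>i\<ge>T'. q i = q T'"
proof -
  define c where "c = (LEAST c. \<exists>i\<ge>T. m i = c)"
  have "\<exists>i\<ge>T. m i = c" unfolding c_def by (rule LeastI[of _ "m T"]) auto
  then obtain T' where T': "T' \<ge> T" "m T' = c" by blast
  have min: "c \<le> m i" if "i \<ge> T" for i unfolding c_def using that by (auto intro: Least_le)
  have "m i = c \<and> q i = q T'" if "i \<ge> T'" for i
    using that
  proof (induction i rule: dec_induct)
    case (step i)
    then have "m (Suc i) = c" using le[of i] min[of "Suc i"] T' by auto
    then show ?case using step less[of i] T' by auto
  qed (simp add: T')
  then show ?thesis using T' by blast
qed

text \<open>Without such a \<open>z\<close> the stable prefix could be extended forever. A position
  that empties again and again does so by resets of the stable name before it, which would be the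
  desired \<open>z\<close>. A position that stays occupied has its entry move only outwards or
  forwards, hence finitely often. But an index without repetitions is no longer than the number of
  names.\<close>

lemma names_progress:
  assumes w: "\<And>i. distinct (w i)" "\<And>i. set (w i) \<subseteq> names \<gamma>" "\<And>i. evolves (w i) (w (Suc i))"
    and u: "\<And>i. set (u i) \<subseteq> set (w i)" "\<And>i. distinct (u i)" "\<And>i. sorted (map rank (u i))"
    and step: "\<And>i. index_step (w i) (u i) (r i) (X i) (u (Suc i))"
    and K: "K \<in> set xs" "op_of K = Nu" "\<And>i. \<exists>j\<ge>i. X j = Some K"
    and outer: "\<And>i Y. i \<ge> T0 \<Longrightarrow> X i = Some Y \<Longrightarrow> pos xs K \<le> pos xs Y"
  shows "\<exists>z T. (\<forall>i\<ge>T. z \<in> set (u i)) \<and> (\<forall>i. \<exists>j\<ge>i. r j = ResetR z)"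
proof (rule ccontr)
  assume neg: "\<not> ?thesis"
  let ?H = "has_name (pos xs K)"
  note S = index_step_name[OF step w(1,2) u(1,3) _ u(3) K(1,2) outer]
  have un: "set (u i) \<subseteq> names \<gamma>" for i using u(1) w(2) by blast
  have "\<exists>p T. T \<ge> T0 \<and> (\<forall>i\<ge>T. \<forall>j<n. ?H j (u i) \<and> u i ! j = p j)" for n
  proof (induction n)
    case (Suc n)
    then obtain p T where T: "T \<ge> T0" "\<And>i j. i \<ge> T \<Longrightarrow> j < n \<Longrightarrow> ?H j (u i) \<and> u i ! j = p j" by blast
    have A: "n > 0 \<and> r i = ResetR (p (n - 1))" if "i \<ge> T" "?H n (u i)" "\<not> ?H n (u (Suc i))" for i
      by (rule S(1)[where n = n and p = p]) (use that T un in auto)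
    have B: "?H n (u (Suc i))" if "i \<ge> T" "X i = Some K" for i
      by (rule S(2)[where n = n and p = p]) (use that T un in auto)
    have C: "u (Suc i) ! n = u i ! n \<or> rank (u (Suc i) ! n) < rank (u i ! n) \<or>
        rank (u (Suc i) ! n) = rank (u i ! n) \<and> pos (w i) (u (Suc i) ! n) < pos (w i) (u i ! n)"
      if "i \<ge> T" "?H n (u i)" "?H n (u (Suc i))" for i
      by (rule S(3)[where n = n and p = p]) (use that T un in auto)
    have "\<exists>T'\<ge>T. \<forall>i\<ge>T'. ?H n (u i)"
    proof (rule ccontr)
      assume nev: "\<not> ?thesis"
      have drop: "\<exists>j\<ge>i. ?H n (u j) \<and> \<not> ?H n (u (Suc j))" if "i \<ge> T" for i
      proof (rule ccontr)
        assume no: "\<not> ?thesis"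
        obtain j where j: "j \<ge> i" "X j = Some K" using K(3) by blast
        have "?H n (u l)" if "l \<ge> Suc j" for l
          using that
        proof (induction l rule: dec_induct)
          case base
          then show ?case using B[of j] j \<open>i \<ge> T\<close> by simp
        next
          case (step l)
          then show ?case using no j by auto
        qed
        moreover have "Suc j \<ge> T" using j \<open>i \<ge> T\<close> by simp
        ultimately show False using nev by blast
      qed
      have reset: "\<exists>j\<ge>i. r j = ResetR (p (n - 1))" for i
      proof -
        obtain j where j: "j \<ge> max i T" "?H n (u j)" "\<not> ?H n (u (Suc j))"
          using drop[of "max i T"] by auto
        then show ?thesis using A[of j] by auto
      qed
      have "n > 0"
      proof -
        obtain j where j: "j \<ge> T" "?H n (u j)" "\<not> ?H n (u (Suc j))" using drop[of T] by auto
        then show ?thesis using A[of j] by auto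
      qed
      then have "p (n - 1) \<in> set (u i)" if "i \<ge> T" for i
        using T(2)[OF that, of "n - 1"] nth_mem[of "n - 1" "u i"] by (simp add: has_name_def)
      with reset neg show False by blast
    qed
    then obtain T1 where T1: "T1 \<ge> T" "\<And>i. i \<ge> T1 \<Longrightarrow> ?H n (u i)" by blast
    define q where "q i = u i ! n" for i
    have qw: "q i \<in> set (w i)" if "i \<ge> T1" for i
      using T1(2)[OF that] u(1)[of i] by (auto simp: q_def has_name_def)
    have pos: "pos (w (Suc i)) (q (Suc i)) \<le> pos (w i) (q (Suc i))"
      if i: "i \<ge> T1" and qi: "q (Suc i) \<in> set (w i)" for i
    proof -
      have "subseq (takeWhile (\<lambda>y. y \<noteq> q (Suc i)) (w (Suc i))) (takeWhile (\<lambda>y. y \<noteq> q (Suc i)) (w i))"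
        by (rule evolves_takeWhile[OF w(3) qi qw]) (use i in simp)
      then show ?thesis unfolding pos_def by (rule list_emb_length)
    qed
    define f where "f i = (rank (q i), pos (w i) (q i))" for i
    have le: "(q (Suc i) = q i \<and> pos (w (Suc i)) (q (Suc i)) \<le> pos (w i) (q i)) \<or>
        rank (q (Suc i)) < rank (q i) \<or>
        rank (q (Suc i)) = rank (q i) \<and> pos (w (Suc i)) (q (Suc i)) < pos (w i) (q i)"
      if i: "i \<ge> T1" for i
    proof -
      \<comment> \<open>An absent name has position \<open>length (w i)\<close>, so a smaller
        position shows that the new entry was already in \<open>w i\<close> and that
        \<open>evolves\<close> applies to it.\<close>
      have "q (Suc i) \<in> set (w i)" if "pos (w i) (q (Suc i)) < pos (w i) (q i)"
      proof (rule ccontr)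
        assume "q (Suc i) \<notin> set (w i)"
        then have "takeWhile (\<lambda>y. y \<noteq> q (Suc i)) (w i) = w i" by (auto simp: takeWhile_eq_all_conv)
        then have "pos (w i) (q (Suc i)) = length (w i)" by (simp only: pos_def)
        then show False using that pos_less[OF qw[OF i]] by simp
      qed
      moreover have "q (Suc i) = q i \<Longrightarrow> q (Suc i) \<in> set (w i)" using qw[OF i] by simp
      ultimately show ?thesis
        using C[of i] pos[OF i] i T1 unfolding q_def[symmetric] by fastforce
    qed
    have "\<exists>T'\<ge>T1. \<forall>i\<ge>T'. q i = q T'"
    proof -
      \<comment> \<open>\<open>M\<close> exceeds all positions, so \<open>m\<close> below encodes
        the lexicographic pair of rank and position as one number.\<close>
      define M where "M = Suc (card (names \<gamma>))"
      have bound: "pos (w i) (q i) < M" if "i \<ge> T1" for i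
      proof -
        have "pos (w i) (q i) < length (w i)" using qw[OF that] by (rule pos_less)
        also have "length (w i) = card (set (w i))" using w(1) by (simp add: distinct_card)
        also have "\<dots> \<le> card (names \<gamma>)" using finite_names w(2) by (rule card_mono)
        finally show ?thesis by (simp add: M_def)
      qed
      define m where "m i = rank (q i) * M + pos (w i) (q i)" for i
      have lex: "a * M + b < a' * M + b'" if "a < a'" "b < M" for a b a' b'
      proof -
        have "a * M + b < Suc a * M" using that by simp
        also have "\<dots> \<le> a' * M" using that by (intro mult_le_mono1) simp
        finally show ?thesis by simp
      qed
      show ?thesis
      proof (rule eventually_constant[of T1 m])
        fix i assume i: "T1 \<le> i"
        show "m (Suc i) \<le> m i"
          using le[OF i] lex[OF _ bound, of "rank (q (Suc i))" "rank (q i)" "Suc i" "pos (w i) (q i)"] i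
          unfolding m_def by auto
        show "m (Suc i) < m i" if "q (Suc i) \<noteq> q i"
          using le[OF i] lex[OF _ bound, of "rank (q (Suc i))" "rank (q i)" "Suc i" "pos (w i) (q i)"] i that
          unfolding m_def by auto
      qed
    qed
    then obtain T2 where T2: "T2 \<ge> T1" "\<And>i. i \<ge> T2 \<Longrightarrow> q i = q T2" by blast
    show ?case
    proof (intro exI conjI allI impI)
      show "T2 \<ge> T0" using T2 T1 T by simp
      fix i j assume i: "i \<ge> T2" and j: "j < Suc n"
      show "?H j (u i)" using T(2)[of i j] T1 T2 i j by (cases "j = n") auto
      show "u i ! j = (p(n := q T2)) j"
        using T(2)[of i j] T1 T2(1) T2(2)[OF i] i j by (cases "j = n") (auto simp: q_def)
    qed
  qed auto
  then obtain p T where pT: "\<And>i j. i \<ge> T \<Longrightarrow> j < Suc (card (names \<gamma>)) \<Longrightarrow> ?H j (u i) \<and> u i ! j = p j" by blast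
  have "card (names \<gamma>) < length (u T)" using pT[of T "card (names \<gamma>)"] by (simp add: has_name_def)
  moreover have "length (u T) \<le> card (names \<gamma>)"
  proof -
    have "length (u T) = card (set (u T))" using u(2) by (simp add: distinct_card)
    also have "\<dots> \<le> card (names \<gamma>)" using finite_names un by (rule card_mono)
    finally show ?thesis .
  qed
  ultimately show False by simp
qed

section \<open>Traces of formulas\<close>

text \<open>The trace runs through subformulas of \<gamma>, so that closing a loop at a variable,
  where the stage drops, is distinguished from entering a fixed point.\<close>

inductive trace_step ::
  "('v, 'p, 'a) pform \<Rightarrow> ('v \<Rightarrow> 's stage) \<Rightarrow> 'v option \<Rightarrow> ('v, 'p, 'a) pform \<Rightarrow> ('v \<Rightarrow> 's stage) \<Rightarrow> bool"
  for \<psi> \<rho> where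
  Keep: "trace_step \<psi> \<rho> None \<psi> \<rho>"
| Down: "\<psi>' \<in> subformulas \<psi> \<Longrightarrow> len \<psi>' < len \<psi> \<Longrightarrow> trace_step \<psi> \<rho> None \<psi>' \<rho>"
| Unfold: "Y \<in> set xs \<Longrightarrow> \<psi> = PVar Y \<or> \<psi> = PFix (op_of Y) Y (body Y) \<Longrightarrow>
    (\<And>Z. Z \<noteq> Y \<Longrightarrow> \<rho>' Z = \<rho> Z) \<Longrightarrow> (op_of Y \<noteq> Mu \<Longrightarrow> \<rho>' = \<rho>) \<Longrightarrow>
    (op_of Y = Mu \<Longrightarrow> \<psi> = PVar Y \<Longrightarrow> \<rho>' Y < \<rho> Y) \<Longrightarrow> trace_step \<psi> \<rho> (Some Y) (body Y) \<rho>'"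

text \<open>Let \<open>K\<close> come first in \<open>xs\<close> among the variables unfolded
  infinitely often. If it were a \<mu>-variable, the trace would eventually stay inside its body.
  There every unfolding of \<open>K\<close> happens at the variable and lowers its stage, which
  unfoldings of inner variables leave alone: an infinite descent.\<close>

lemma outermost_nu:
  fixes \<rho> :: "nat \<Rightarrow> 'v \<Rightarrow> 's stage"
  assumes sub: "\<And>i. \<psi> i \<in> subformulas \<gamma>"
    and step: "\<And>i. trace_step (\<psi> i) (\<rho> i) (X i) (\<psi> (Suc i)) (\<rho> (Suc i))"
    and progress: "\<And>i. \<exists>j\<ge>i. X j \<noteq> None \<or> len (\<psi> (Suc j)) < len (\<psi> j)"
  shows "\<exists>K\<in>set xs. op_of K = Nu \<and> (\<forall>i. \<exists>j\<ge>i. X j = Some K) \<and>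
    (\<exists>T. \<forall>i\<ge>T. \<forall>Y. X i = Some Y \<longrightarrow> pos xs K \<le> pos xs Y)"
proof -
  have X: "Y \<in> set xs" if "X i = Some Y" for i Y
    using step[of i] that by (auto elim: trace_step.cases)
  have unfolds: "\<exists>j\<ge>i. X j \<noteq> None" for i
  proof (rule ccontr)
    assume no: "\<not> ?thesis"
    have "len (\<psi> (Suc j)) \<le> len (\<psi> j)" if "j \<ge> i" for j
      using step[of j] no that by cases auto
    moreover have "len (\<psi> (Suc j)) < len (\<psi> j)" if "j \<ge> i" "\<psi> (Suc j) \<noteq> \<psi> j" for j
      using step[of j] no that by cases auto
    ultimately obtain T where T: "T \<ge> i" "\<forall>j\<ge>T. \<psi> j = \<psi> T"
      using eventually_constant[of i "\<lambda>j. len (\<psi> j)" \<psi>] by blast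
    obtain j where j: "j \<ge> T" "len (\<psi> (Suc j)) < len (\<psi> j)" using progress[of T] no T(1) by auto
    have "\<psi> (Suc j) = \<psi> j" using T(2) j(1) by (metis le_SucI)
    then show False using j(2) by simp
  qed
  define U where "U = {Y \<in> set xs. \<forall>i. \<exists>j\<ge>i. X j = Some Y}"
  have fin: "\<exists>T. \<forall>i\<ge>T. \<forall>Y\<in>set xs - U. X i \<noteq> Some Y"
  proof -
    have "\<forall>Y\<in>set xs - U. \<forall>\<^sub>F i in sequentially. X i \<noteq> Some Y"
      unfolding U_def eventually_sequentially by auto
    then have "\<forall>\<^sub>F i in sequentially. \<forall>Y\<in>set xs - U. X i \<noteq> Some Y"
      by (intro eventually_ball_finite) auto
    then show ?thesis unfolding eventually_sequentially .
  qed
  then obtain T where T: "\<And>i Y. i \<ge> T \<Longrightarrow> X i = Some Y \<Longrightarrow> Y \<in> U" using X by blast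
  obtain t where "t \<ge> T" "X t \<noteq> None" using unfolds by blast
  then have "\<exists>Y. Y \<in> U" using T by auto
  then obtain K where K: "K \<in> U" "\<And>Y. Y \<in> U \<Longrightarrow> pos xs K \<le> pos xs Y"
    using ex_has_least_nat[of "\<lambda>Y. Y \<in> U" _ "pos xs"] by blast
  have Kx: "K \<in> set xs" and inf: "\<exists>j\<ge>i. X j = Some K" for i using K(1) by (auto simp: U_def)
  have outer: "pos xs K \<le> pos xs Y" if "i \<ge> T" "X i = Some Y" for i Y using K(2) T that by blast
  have "op_of K = Nu"
  proof (rule ccontr)
    assume "op_of K \<noteq> Nu"
    then have Mu: "op_of K = Mu" by (cases "op_of K") auto
    obtain t where t: "t \<ge> T" "X t = Some K" using inf by blast
    have inside: "\<psi> i \<in> subformulas (body K)" if "i \<ge> Suc t" for i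
      using that
    proof (induction i rule: dec_induct)
      case base
      show ?case using step[of t] t(2) by cases auto
    next
      case (step i)
      from \<open>trace_step (\<psi> i) (\<rho> i) (X i) (\<psi> (Suc i)) (\<rho> (Suc i))\<close> show ?case
      proof cases
        case (Unfold Y)
        have le: "pos xs K \<le> pos xs Y" using outer[of i Y] Unfold step.hyps t by simp
        show ?thesis
        proof (cases "\<psi> i = PVar Y \<and> Y \<noteq> K")
          case True
          \<comment> \<open>If \<open>Y\<close> were free in the body of \<open>K\<close>, it would
            precede \<open>K\<close> in \<open>xs\<close> and no longer be unfolded. So
            \<open>Y\<close> is bound inside this body, and its own body lies there too.\<close>
          then have "Y \<in> free_vars (body K) \<or> (\<exists>\<sigma> \<chi>. PFix \<sigma> Y \<chi> \<in> subformulas (body K))"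
            using free_var_scope[OF step.IH, of Y] by auto
          then show ?thesis
          proof
            assume "Y \<in> free_vars (body K)"
            then show ?thesis using free_vars_body(2)[OF Kx, of Y] True le by simp
          next
            assume "\<exists>\<sigma> \<chi>. PFix \<sigma> Y \<chi> \<in> subformulas (body K)"
            then obtain \<sigma> \<chi> where f: "PFix \<sigma> Y \<chi> \<in> subformulas (body K)" by blast
            then have "\<chi> = body Y"
              using PFix_subformula(3) subformulas_trans[OF body_subformula[OF Kx]] by blast
            then show ?thesis using subformulas_trans[OF f, of \<chi>] Unfold by simp
          qed
        next
          case False
          then consider "Y = K" | "\<psi> i = PFix (op_of Y) Y (body Y)" using Unfold by auto
          then show ?thesis
          proof cases
            case 2
            then show ?thesis using subformulas_trans[OF step.IH, of "body Y"] Unfold by simp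
          qed (use Unfold in simp)
        qed
      qed (use step.IH subformulas_trans in auto)
    qed
    have stage: "\<rho> (Suc i) K \<le> \<rho> i K" "X i = Some K \<Longrightarrow> \<rho> (Suc i) K < \<rho> i K" if "i \<ge> Suc t" for i
    proof -
      have "\<rho> (Suc i) K \<le> \<rho> i K \<and> (X i = Some K \<longrightarrow> \<rho> (Suc i) K < \<rho> i K)"
        using step[of i]
      proof cases
        case (Unfold Y)
        show ?thesis
        proof (cases "Y = K")
          case True
          \<comment> \<open>The binding formula of \<open>K\<close> is longer than its body and
            cannot occur in it.\<close>
          have "\<psi> i \<noteq> PFix (op_of K) K (body K)"
            using len_subformulas[OF inside[OF that]] by auto
          then show ?thesis using Unfold True Mu by auto
        next
          case False
          then show ?thesis using Unfold by auto
        qed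
      qed auto
      then show "\<rho> (Suc i) K \<le> \<rho> i K" "X i = Some K \<Longrightarrow> \<rho> (Suc i) K < \<rho> i K" by auto
    qed
    obtain T' where T': "T' \<ge> Suc t" "\<forall>i\<ge>T'. \<rho> i K = \<rho> T' K"
      using eventually_constant[of "Suc t" "\<lambda>i. \<rho> i K" "\<lambda>i. \<rho> i K"] stage(1) by (auto simp: le_less)
    obtain j where j: "j \<ge> T'" "X j = Some K" using inf by blast
    have "\<rho> (Suc j) K = \<rho> j K" using T'(2) j(1) by (metis le_SucI)
    then show False using stage(2)[of j] j T'(1) by simp
  qed
  then show ?thesis using Kx inf outer by blast
qed

section \<open>True formulas along reductions\<close>

definition true_at ::
  "('s, 'p, 'a) kripke \<Rightarrow> 's \<Rightarrow> ('v, 'p, 'a) pform \<Rightarrow> ('v \<Rightarrow> 's stage) \<Rightarrow> bool" where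
  "true_at T s \<psi> \<rho> \<longleftrightarrow> \<psi> \<in> subformulas \<gamma> \<and> s \<in> gsem True T (val True T \<rho>) \<psi>"

lemma true_at_unfold:
  assumes "true_at T s \<psi> \<rho>" "expand \<psi> = PFix \<sigma> Z \<phi>"
  shows "\<exists>\<rho>'. true_at T s (body Z) \<rho>' \<and> trace_step \<psi> \<rho> (Some Z) (body Z) \<rho>' \<and>
    unfold_fix \<sigma> Z \<phi> = expand (body Z)"
proof -
  have \<psi>: "\<psi> \<in> subformulas \<gamma>" and s: "s \<in> gsem True T (val True T \<rho>) \<psi>"
    using assms(1) by (auto simp: true_at_def)
  note Z = expand_PFixD[OF \<psi> assms(2)]
  from gsem_unfold[OF Z(1,3) s] obtain \<rho>'
    where "s \<in> gsem True T (val True T \<rho>') (body Z)" "\<forall>Y. Y \<noteq> Z \<longrightarrow> \<rho>' Y = \<rho> Y"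
      "op_of Z \<noteq> Mu \<longrightarrow> \<rho>' = \<rho>" "op_of Z = Mu \<and> \<psi> = PVar Z \<longrightarrow> \<rho>' Z < \<rho> Z"
    by (auto simp: least_op_def)
  then show ?thesis using Z body_subformula[OF Z(1)]
    by (intro exI[of _ \<rho>'] conjI trace_step.Unfold) (auto simp: true_at_def)
qed

text \<open>At a disjunction the trace picks a true disjunct. At a conjunction it follows whichever
  conjunct the reduction kept, as both are true. An element that is not principal is simply carried
  along.\<close>

lemma true_at_red:
  assumes red: "red (w, \<Gamma>) r (w', \<Gamma>')" and good: "good (w, \<Gamma>)"
    and mem: "(expand \<psi>, u) \<in> \<Gamma>" and true: "true_at T s \<psi> \<rho>"
  shows "\<exists>\<psi>' \<rho>' u' X. (expand \<psi>', u') \<in> \<Gamma>' \<and> true_at T s \<psi>' \<rho>' \<and>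
    index_step w u r X u' \<and> trace_step \<psi> \<rho> X \<psi>' \<rho>'"
proof -
  have keep: ?thesis if "(expand \<psi>, u') \<in> \<Gamma>'" "index_step w u r None u'" for u'
    using that true trace_step.Keep by blast
  from red show ?thesis
  proof cases
    case (Thin \<phi> u1 v)
    show ?thesis
    proof (cases "(expand \<psi>, u) = (\<phi>, v)")
      case True
      have "u1 \<noteq> v" using Thin sq_less_irrefl goodD(2)[OF good] by blast
      then show ?thesis using keep[of u1] index_step.Thin Thin True by auto
    next
      case False
      then show ?thesis using keep[of u] index_step.Keep Thin mem by auto
    qed
  next
    case (Reset P z v)
    show ?thesis
    proof (cases "(expand \<psi>, u) \<in> P")
      case True
      then obtain z' b where "u = v @ [z, z'] @ b" "fst z' = fst z" using Reset by blast
      then have "index_step w u r None (v @ [z])" using Reset(1) index_step.Reset by blast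
      moreover have "(expand \<psi>, v @ [z]) \<in> \<Gamma>'" using True Reset by force
      ultimately show ?thesis using keep by blast
    next
      case False
      then show ?thesis using keep[of u] index_step.Keep Reset mem by auto
    qed
  next
    case (Logical p Q new)
    show ?thesis
    proof (cases "p = (expand \<psi>, u)")
      case False
      then show ?thesis using keep[of u] index_step.Keep Logical mem by auto
    next
      case True
      have \<psi>: "\<psi> \<in> subformulas \<gamma>" using true by (simp add: true_at_def)
      have down: ?thesis if "(expand \<psi>', u) \<in> Q" "true_at T s \<psi>' \<rho>" "\<psi>' \<in> subformulas \<psi>"
        "len \<psi>' < len \<psi>" for \<psi>'
        using that Logical index_step.Keep trace_step.Down by blast
      from Logical(4) show ?thesis
      proof cases
        case (Disj \<phi>1 \<phi>2 u0)
        then have "expand \<psi> = PDisj \<phi>1 \<phi>2" "u0 = u" using True by auto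
        from expand_PDisjD[OF \<psi> this(1)] obtain \<psi>1 \<psi>2
          where *: "\<psi> = PDisj \<psi>1 \<psi>2" "\<phi>1 = expand \<psi>1" "\<phi>2 = expand \<psi>2" by blast
        then have "true_at T s \<psi>1 \<rho> \<or> true_at T s \<psi>2 \<rho>"
          using true sub_componentsD(2)[of \<psi>1 \<psi>2] by (auto simp: true_at_def)
        then show ?thesis using down[of \<psi>1] down[of \<psi>2] * Disj \<open>u0 = u\<close> by auto
      next
        case (Conj1 \<phi>1 \<phi>2 u0)
        then have "expand \<psi> = PConj \<phi>1 \<phi>2" "u0 = u" using True by auto
        from expand_PConjD[OF \<psi> this(1)] obtain \<psi>1 \<psi>2
          where *: "\<psi> = PConj \<psi>1 \<psi>2" "\<phi>1 = expand \<psi>1" "\<phi>2 = expand \<psi>2" by blast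
        then have "true_at T s \<psi>1 \<rho>"
          using true sub_componentsD(1)[of \<psi>1 \<psi>2] by (auto simp: true_at_def)
        then show ?thesis using down[of \<psi>1] * Conj1 \<open>u0 = u\<close> by auto
      next
        case (Conj2 \<phi>1 \<phi>2 u0)
        then have "expand \<psi> = PConj \<phi>1 \<phi>2" "u0 = u" using True by auto
        from expand_PConjD[OF \<psi> this(1)] obtain \<psi>1 \<psi>2
          where *: "\<psi> = PConj \<psi>1 \<psi>2" "\<phi>1 = expand \<psi>1" "\<phi>2 = expand \<psi>2" by blast
        then have "true_at T s \<psi>2 \<rho>"
          using true sub_componentsD(1)[of \<psi>1 \<psi>2] by (auto simp: true_at_def)
        then show ?thesis using down[of \<psi>2] * Conj2 \<open>u0 = u\<close> by auto
      next
        case (Mu Z \<phi> u0)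
        then have e: "expand \<psi> = PFix Mu Z \<phi>" "u0 = u" using True by auto
        note Z = expand_PFixD(1,2)[OF \<psi> e(1)]
        have "index_step w u r (Some Z) (restrict_names xs u Z)"
          using Z by (intro index_step.Mu) auto
        moreover obtain \<rho>' where \<rho>': "true_at T s (body Z) \<rho>'" "trace_step \<psi> \<rho> (Some Z) (body Z) \<rho>'"
          "unfold_fix Mu Z \<phi> = expand (body Z)"
          using true_at_unfold[OF true e(1)] by blast
        moreover have "(expand (body Z), restrict_names xs u Z) \<in> \<Gamma>'"
          using Mu Logical \<rho>'(3) e by auto
        ultimately show ?thesis by blast
      next
        case (Nu Z z \<phi> u0)
        then have e: "expand \<psi> = PFix Nu Z \<phi>" "u0 = u" using True by auto
        note Z = expand_PFixD(1,2)[OF \<psi> e(1)]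
        have "index_step w u r (Some Z) (restrict_names xs u Z @ [z])"
          using Z first_unusedD[OF Nu(5)] by (intro index_step.Nu) auto
        moreover obtain \<rho>' where \<rho>': "true_at T s (body Z) \<rho>'" "trace_step \<psi> \<rho> (Some Z) (body Z) \<rho>'"
          "unfold_fix Nu Z \<phi> = expand (body Z)"
          using true_at_unfold[OF true e(1)] by blast
        moreover have "(expand (body Z), restrict_names xs u Z @ [z]) \<in> \<Gamma>'"
          using Nu Logical \<rho>'(3) e by auto
        ultimately show ?thesis by blast
      qed
    qed
  qed
qed

lemma red_evolves: "red (w, \<Gamma>) r (w', \<Gamma>') \<Longrightarrow> evolves w w'"
  by (auto simp: still_occurring_def intro!: evolves_snoc dest!: first_unusedD elim!: red.cases expands.cases)

lemma modal_child_evolves: "modal_child (w, \<Gamma>) a \<phi> u = (w', \<Gamma>') \<Longrightarrow> evolves w w'"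
  by (auto simp: modal_child_def Let_def still_occurring_def)

end

section \<open>The refutation graph\<close>

text \<open>Vertices are unprovable sequents together with their ancestors in a proof search; instead of
  reaching an unsuccessful repeat, the search continues at its companion.\<close>

type_synonym ('v', 'p', 'a') vertex =
  "(('v', 'p', 'a') sequent \<times> 'v' rule) list \<times> ('v', 'p', 'a') sequent"

context mu_formula
begin

text \<open>Provability is relative to the history \<open>h\<close>, since leaves below may repeat
  sequents from it.\<close>

definition node :: "(('v, 'p, 'a) sequent \<times> 'v rule) list \<Rightarrow> ('v, 'p, 'a) sequent \<Rightarrow> bool" where
  "node h s \<longleftrightarrow> good s \<and> \<not> is_repeat h s \<and> \<not> (\<exists>t. label t = s \<and> proof_below \<gamma> xs h t)"

definition all_rules :: "'v rule set" where
  "all_rules = {OrR, AndR, ModalR, MuR, NuR, ThinR} \<union> ResetR ` names \<gamma>"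

definition hist :: "(('v, 'p, 'a) sequent \<times> 'v rule) list \<Rightarrow> bool" where
  "hist h \<longleftrightarrow> (\<forall>h1 s r h2. h = h1 @ (s, r) # h2 \<longrightarrow> node h1 s \<and> r \<in> all_rules)"

definition vertex :: "('v, 'p, 'a) vertex \<Rightarrow> bool" where
  "vertex = (\<lambda>(h, s). hist h \<and> node h s)"

definition edge :: "('v, 'p, 'a) vertex \<Rightarrow> 'v rule \<Rightarrow> ('v, 'p, 'a) vertex \<Rightarrow> bool" where
  "edge = (\<lambda>(h, s) r (h', s'). h' = h @ [(s, r)] \<or>
     (\<exists>r' h2. h @ [(s, r)] = h' @ (s', r') # h2 \<and> \<not> successful_repeat (h @ [(s, r)]) s'))"

lemma histD: "hist h \<Longrightarrow> h = h1 @ (s, r) # h2 \<Longrightarrow> node h1 s \<and> r \<in> all_rules"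
  unfolding hist_def by blast

lemma hist_snoc: "hist h \<Longrightarrow> node h s \<Longrightarrow> r \<in> all_rules \<Longrightarrow> hist (h @ [(s, r)])"
  unfolding hist_def[of "h @ [(s, r)]"]
proof (intro allI impI)
  fix h1 s1 r1 h2
  assume "hist h" "node h s" "r \<in> all_rules" "h @ [(s, r)] = h1 @ (s1, r1) # h2"
  then show "node h1 s1 \<and> r1 \<in> all_rules"
    using histD[of h h1 s1 r1] by (cases h2 rule: rev_cases) auto
qed

lemma hist_append: "hist (h1 @ h2) \<Longrightarrow> hist h1"
  unfolding hist_def[of h1] using histD[of "h1 @ h2" _ _ _ "_ @ h2"] by auto

lemma hist_distinct: "hist h \<Longrightarrow> distinct (map fst h) \<and> set h \<subseteq> {s. is_sequent \<gamma> s} \<times> all_rules"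
proof (induction h rule: rev_induct)
  case (snoc x h)
  obtain s r where x: "x = (s, r)" by (cases x)
  have "node h s" "r \<in> all_rules" using histD[OF snoc.prems, of h s r "[]"] x by auto
  moreover have "is_sequent \<gamma> s" using \<open>node h s\<close> goodD(1) by (cases s) (auto simp: node_def)
  ultimately show ?case using snoc.IH hist_append[OF snoc.prems] x
    by (auto simp: node_def is_repeat_def image_iff)
qed simp

lemma hist_length: "hist h \<Longrightarrow> length h \<le> card {s. is_sequent \<gamma> s}"
proof -
  assume h: "hist h"
  have "length h = card (set (map fst h))" using hist_distinct[OF h] by (metis distinct_card length_map)
  also have "\<dots> \<le> card {s. is_sequent \<gamma> s}"
    using hist_distinct[OF h] by (intro card_mono[OF finite_sequents]) auto
  finally show ?thesis .
qed

text \<open>Nodes are not repeats, so the sequents of a history are distinct, which bounds its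
  length. Resets occur only for the finitely many names of \<gamma>.\<close>

lemma finite_vertices: "finite {x. vertex x}"
proof (rule finite_subset)
  let ?S = "{s. is_sequent \<gamma> s}"
  have "h \<in> {h. set h \<subseteq> ?S \<times> all_rules \<and> length h \<le> card ?S} \<and> s \<in> ?S" if "vertex (h, s)" for h s
    using that hist_distinct hist_length goodD(1) by (cases s) (auto simp: vertex_def node_def)
  then show "{x. vertex x} \<subseteq> {h. set h \<subseteq> ?S \<times> all_rules \<and> length h \<le> card ?S} \<times> ?S" by auto
  have "finite all_rules" using finite_names by (simp add: all_rules_def)
  then show "finite ({h. set h \<subseteq> ?S \<times> all_rules \<and> length h \<le> card ?S} \<times> ?S)"
    using finite_sequents by (intro finite_cartesian_product finite_lists_length_le)
qed

lemma vertex_step: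
  assumes x: "vertex (h, s)" and app: "applies \<gamma> xs r s ss" and good: "\<And>s'. s' \<in> set ss \<Longrightarrow> good s'"
    and r: "r \<in> all_rules"
  shows "\<exists>s'\<in>set ss. \<exists>h'. edge (h, s) r (h', s') \<and> vertex (h', s')"
proof -
  let ?h = "h @ [(s, r)]"
  have node: "node h s" and hist: "hist h" using x by (auto simp: vertex_def)
  have hist': "hist ?h" using hist node r by (rule hist_snoc)
  have seq: "is_sequent \<gamma> s" if "good s" for s using that goodD(1) by (cases s) auto
  have "\<exists>s'\<in>set ss. \<not> (\<exists>t. label t = s' \<and> proof_below \<gamma> xs ?h t)"
  proof (rule ccontr)
    assume "\<not> ?thesis"
    then have "\<forall>s'\<in>set ss. \<exists>t. label t = s' \<and> proof_below \<gamma> xs ?h t" by blast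
    then obtain f where f: "\<forall>s'\<in>set ss. label (f s') = s' \<and> proof_below \<gamma> xs ?h (f s')" by metis
    have "map label (map f ss) = ss" using f by (simp add: map_idI)
    then have "proof_below \<gamma> xs h (Node s r (map f ss))"
      using app f node seq by (intro proof_below.node) (auto simp: node_def)
    then show False using node by (auto simp: node_def)
  qed
  then obtain s' where s': "s' \<in> set ss" "\<not> (\<exists>t. label t = s' \<and> proof_below \<gamma> xs ?h t)" by blast
  show ?thesis
  proof (cases "is_repeat ?h s'")
    case False
    then have "vertex (?h, s')" using hist' s' good by (simp add: vertex_def node_def)
    then show ?thesis using s'(1) by (auto simp: edge_def)
  next
    case True
    then obtain h' r' h2 where split: "?h = h' @ (s', r') # h2"
      by (auto simp: is_repeat_def dest!: split_list)
    \<comment> \<open>A successful repeat would be provable as a leaf.\<close>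
    have unsucc: "\<not> successful_repeat ?h s'"
      using s'(2) proof_below.leaf[OF seq[OF good[OF s'(1)]], of ?h xs] by (metis label.simps(1))
    have "edge (h, s) r (h', s')" using split unsucc unfolding edge_def by auto
    moreover have "vertex (h', s')"
      using hist' histD[OF hist' split] hist_append[of h'] by (simp add: split vertex_def)
    ultimately show ?thesis using s'(1) by blast
  qed
qed

text \<open>Below the shortest history that recurs, every jump back to a companion skips only sequents
  visited since.\<close>

lemma no_successful_walk:
  assumes vert: "\<And>i. vertex (h i, s i)" and edge: "\<And>i. edge (h i, s i) (r i) (h (Suc i), s (Suc i))"
    and z: "\<And>i. i \<ge> T \<Longrightarrow> z \<in> set (fst (s i))" and reset: "\<And>i. \<exists>j\<ge>i. r j = ResetR z"
  shows False
proof -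
  define N where "N = card {s. is_sequent \<gamma> s}"
  have bound: "length (h i) \<le> N" for i
    using hist_length vert[of i] by (auto simp: vertex_def N_def)
  define rec where "rec l \<longleftrightarrow> (\<forall>i. \<exists>j\<ge>i. length (h j) = l)" for l
  have ev: "\<exists>T'. \<forall>i\<ge>T'. \<forall>l\<in>{l. l \<le> m \<and> \<not> rec l}. length (h i) \<noteq> l" for m
  proof -
    have "\<forall>l\<in>{l. l \<le> m \<and> \<not> rec l}. \<forall>\<^sub>F i in sequentially. length (h i) \<noteq> l"
      unfolding rec_def eventually_sequentially by auto
    then have "\<forall>\<^sub>F i in sequentially. \<forall>l\<in>{l. l \<le> m \<and> \<not> rec l}. length (h i) \<noteq> l"
      by (intro eventually_ball_finite) auto
    then show ?thesis unfolding eventually_sequentially .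
  qed
  have "\<exists>l. rec l" using ev[of N] bound by (metis (mono_tags, lifting) mem_Collect_eq order_refl)
  \<comment> \<open>From \<open>T1\<close> on no history is shorter than \<open>L\<close>, and
    length \<open>L\<close> recurs. Everything beyond the first \<open>L\<close> entries of a
    history after \<open>t0\<close> was therefore visited at a time when \<open>z\<close> was
    present.\<close>
  define L where "L = (LEAST l. rec l)"
  have L: "rec L" unfolding L_def using \<open>\<exists>l. rec l\<close> by (auto intro: LeastI)
  have "\<not> rec l" if "l < L" for l using that not_less_Least unfolding L_def by blast
  then obtain T1 where T1: "\<And>i. i \<ge> T1 \<Longrightarrow> length (h i) \<ge> L"
    using ev[of L] by (metis (mono_tags, lifting) mem_Collect_eq not_le less_imp_le)
  obtain t0 where t0: "t0 \<ge> max T T1" "length (h t0) = L" using L unfolding rec_def by blast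
  have visited: "\<forall>(s', r')\<in>set (drop L (h i)). z \<in> set (fst s')" if "i \<ge> t0" for i
    using that
  proof (induction i rule: dec_induct)
    case base
    then show ?case using t0 by simp
  next
    case (step i)
    have si: "z \<in> set (fst (s i))" using z[of i] step.hyps t0 by simp
    from edge[of i] consider "h (Suc i) = h i @ [(s i, r i)]"
      | r' h2 where "h i @ [(s i, r i)] = h (Suc i) @ (s (Suc i), r') # h2"
      unfolding edge_def by auto
    then show ?case
    proof cases
      case 1
      have "L \<le> length (h i)" using T1 step.hyps t0 by simp
      then show ?thesis using 1 step.IH si by auto
    next
      case 2
      then have "prefix (h (Suc i)) (h i)"
        by (cases h2 rule: rev_cases) (auto simp: prefix_def)
      then have "set (drop L (h (Suc i))) \<subseteq> set (drop L (h i))" by (auto simp: prefix_def)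
      then show ?thesis using step.IH by blast
    qed
  qed
  obtain i where i: "i \<ge> t0" "r i = ResetR z" using reset by blast
  \<comment> \<open>The history just after a reset of \<open>z\<close>. As the length returns to
    \<open>L\<close>, some first jump leaves \<open>p\<close>. Its companion lies at or above the
    node of the reset, so this reset is among the rules between companion and repeat.\<close>
  define p where "p = h i @ [(s i, r i)]"
  have "\<exists>m\<ge>i. \<not> prefix p (h (Suc m))"
  proof -
    obtain j where j: "j \<ge> Suc i" "length (h j) = L" using L unfolding rec_def by blast
    have "L < length p" using T1[of i] i t0 by (simp add: p_def)
    then have "\<not> prefix p (h j)" using j(2) prefix_length_le by fastforce
    then show ?thesis using j(1) by (intro exI[of _ "j - 1"]) auto
  qed
  then obtain m0 where m0: "m0 \<ge> i \<and> \<not> prefix p (h (Suc m0))" by blast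
  define m where "m = (LEAST m. m \<ge> i \<and> \<not> prefix p (h (Suc m)))"
  have m: "m \<ge> i \<and> \<not> prefix p (h (Suc m))" unfolding m_def using m0 by (rule LeastI)
  have p: "prefix p (h m @ [(s m, r m)])"
  proof (cases "m = i")
    case False
    then have "prefix p (h (Suc (m - 1)))"
      using m not_less_Least[of "m - 1" "\<lambda>m. m \<ge> i \<and> \<not> prefix p (h (Suc m))"]
      unfolding m_def[symmetric] by fastforce
    then show ?thesis using m False by (simp add: prefix_prefix)
  qed (simp add: p_def)
  from edge[of m] m p obtain r' h2 where jump: "h m @ [(s m, r m)] = h (Suc m) @ (s (Suc m), r') # h2"
    and fail: "\<not> successful_repeat (h m @ [(s m, r m)]) (s (Suc m))"
    unfolding edge_def by auto
  have hm: "L \<le> length (h (Suc m))" "L \<le> length (h m)" using T1 m i t0 by auto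
  have "prefix (h (Suc m)) (h i)"
  proof -
    have "prefix (h (Suc m)) p \<or> prefix p (h (Suc m))"
      using p jump prefix_same_cases by (metis prefixI)
    then have "prefix (h (Suc m)) p" "h (Suc m) \<noteq> p" using m by auto
    then show ?thesis unfolding p_def by simp
  qed
  then obtain h3 where h3: "h i = h (Suc m) @ h3" by (auto simp: prefix_def)
  have "(s i, r i) \<in> set ((s (Suc m), r') # h2)"
    using p unfolding jump p_def h3 prefix_def by (cases h3) auto
  then have 1: "ResetR z \<in> snd ` set ((s (Suc m), r') # h2)" using i(2) by force
  have "set h2 \<subseteq> set (drop L (h m)) \<union> {(s m, r m)}"
  proof -
    have "set h2 \<subseteq> set (drop L (h (Suc m) @ (s (Suc m), r') # h2))" using hm(1) by auto
    then show ?thesis unfolding jump[symmetric] using hm(2) by auto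
  qed
  moreover have "z \<in> set (fst (s m))" "z \<in> set (fst (s (Suc m)))" "m \<ge> t0"
    using m i(1) t0(1) z by auto
  ultimately have "z \<in> set (fst s')" if "s' \<in> insert (s (Suc m)) (fst ` set h2)" for s'
    using that visited[of m] by fastforce
  then have 2: "\<forall>(w, \<Sigma>)\<in>insert (s (Suc m)) (fst ` set h2). z \<in> set w"
    unfolding case_prod_beta by blast
  show False using fail jump 1 2 unfolding successful_repeat_def by blast
qed

definition names_at :: "('v, 'p, 'a) vertex \<Rightarrow> 'v name list" where "names_at x = fst (snd x)"

definition elems_at :: "('v, 'p, 'a) vertex \<Rightarrow> ('v, 'p, 'a) iform set" where "elems_at x = snd (snd x)"

lemma vertex_good: "vertex x \<Longrightarrow> good (names_at x, elems_at x)"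
  by (auto simp: vertex_def node_def names_at_def elems_at_def)

lemma vertex_no_axiom:
  assumes "vertex x"
  shows "\<not> is_axiom (names_at x, elems_at x)"
proof
  assume ax: "is_axiom (names_at x, elems_at x)"
  have "is_sequent \<gamma> (names_at x, elems_at x)" using goodD(1)[OF vertex_good[OF assms]] .
  then have "proof_below \<gamma> xs (fst x) (Leaf (snd x))"
    using ax proof_below.leaf[of \<gamma> "snd x" "fst x" xs] by (simp add: names_at_def elems_at_def)
  then show False using assms by (cases x) (auto simp: vertex_def node_def dest: spec[of _ "Leaf (snd x)"])
qed

definition reducible :: "('v, 'p, 'a) vertex \<Rightarrow> bool" where
  "reducible x \<longleftrightarrow> (\<exists>r s'. red (snd x) r s')"

text \<open>Fixing one unprovable successor per reducible vertex gives each vertex a single state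
  \<open>final\<close> at which its formulas are evaluated.\<close>

definition next_vertex :: "('v, 'p, 'a) vertex \<Rightarrow> ('v, 'p, 'a) vertex" where
  "next_vertex x = (SOME y. \<exists>r. red (snd x) r (snd y) \<and> edge x r y \<and> vertex y)"

definition final :: "('v, 'p, 'a) vertex \<Rightarrow> ('v, 'p, 'a) vertex" where
  "final = while reducible next_vertex"

lemma red_rule: "red s r s' \<Longrightarrow> good s \<Longrightarrow> r \<in> all_rules"
proof (induction rule: red.induct)
  case (Reset P \<Gamma> z u \<Delta> w)
  then obtain \<phi> u' where P: "(\<phi>, u') \<in> P" by auto
  then have "z \<in> set u'" "(\<phi>, u') \<in> \<Gamma>" using Reset(1) Reset(4)[OF P] by auto
  then show ?case using good_idx(3)[OF Reset(6)] by (auto simp: all_rules_def)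
qed (auto simp: all_rules_def elim: expands.cases)

lemma next_vertex:
  assumes x: "vertex x" and red: "reducible x"
  shows "\<exists>r. red (snd x) r (snd (next_vertex x)) \<and> edge x r (next_vertex x) \<and> vertex (next_vertex x)"
  unfolding next_vertex_def
proof (rule someI_ex)
  obtain h s where xs: "x = (h, s)" by (cases x)
  obtain r s' where rs: "red s r s'" using red xs by (auto simp: reducible_def)
  have good: "good s" using x xs by (simp add: vertex_def node_def)
  obtain ss where ss: "applies \<gamma> xs r s ss" "\<forall>s''\<in>set ss. red s r s''"
    using red_applies[OF rs good] by blast
  have "good s''" if "s'' \<in> set ss" for s'' using red_good ss(2) that good by blast
  from vertex_step[OF x[unfolded xs] ss(1) this red_rule[OF rs good]]
  obtain s'' h' where "s'' \<in> set ss" "edge (h, s) r (h', s'')" "vertex (h', s'')" by blast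
  then show "\<exists>y r. red (snd x) r (snd y) \<and> edge x r y \<and> vertex y"
    using ss(2) xs by (intro exI[of _ "(h', s'')"]) auto
qed

lemma final_irreducible: "\<not> reducible x \<Longrightarrow> final x = x"
  by (simp add: final_def while_unfold)

lemma final_next: "reducible x \<Longrightarrow> final x = final (next_vertex x)"
  by (subst final_def, subst while_unfold) (simp add: final_def)

lemma final_vertex: "vertex x \<Longrightarrow> vertex (final x) \<and> \<not> reducible (final x)"
proof (induction "weight (snd x)" arbitrary: x rule: wf_induct_rule[OF wf_lex_prod[OF wf_less_than wf_less_than]])
  case (1 x)
  show ?case
  proof (cases "reducible x")
    case True
    from next_vertex[OF 1(2) True] obtain r
      where r: "red (snd x) r (snd (next_vertex x))" "vertex (next_vertex x)" by blast
    have "good (snd x)" using 1(2) by (auto simp: vertex_def node_def)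
    then have "lighter (snd (next_vertex x)) (snd x)"
      using red_weight r(1) by blast
    then show ?thesis using 1(1)[OF _ r(2)] final_next[OF True] by simp
  next
    case False
    then show ?thesis using final_irreducible 1(2) by simp
  qed
qed


section \<open>The countermodel\<close>

text \<open>Listed atoms are made false, and unprovable sequents contain no axiom, so listed negated
  atoms are false as well. Validity refers to a fixed state type, into which \<open>enc\<close>
  carries the vertices.\<close>

definition model :: "(('v, 'p, 'a) vertex \<Rightarrow> 's) \<Rightarrow> ('s, 'p, 'a) kripke" where
  "model enc = \<lparr>states = enc ` {x. vertex x \<and> \<not> reducible x},
     steps = (\<lambda>a. {(enc x, enc (final y)) | x y. vertex x \<and> \<not> reducible x \<and> vertex y \<and> edge x ModalR y \<and>
       (\<exists>\<psi> u. (PBox a \<psi>, u) \<in> elems_at x \<and> snd y = modal_child (snd x) a \<psi> u)}),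
     vprop = (\<lambda>P. enc ` {x. vertex x \<and> \<not> reducible x \<and> (\<forall>u. (PProp P, u) \<notin> elems_at x)})\<rparr>"

lemma kripke_model: "kripke_structure (model enc)"
  using final_vertex by (auto simp: kripke_structure_def model_def)

lemma modal_step:
  assumes x: "vertex x" "\<not> reducible x" and box: "(PBox a \<psi>, u) \<in> elems_at x"
  shows "\<exists>y. vertex y \<and> edge x ModalR y \<and> snd y = modal_child (snd x) a \<psi> u"
proof -
  obtain h w \<Gamma> where hs: "x = (h, (w, \<Gamma>))" by (cases x) auto
  have good: "good (w, \<Gamma>)" using vertex_good[OF x(1)] by (simp add: hs names_at_def elems_at_def)
  have stuck: "stuck (w, \<Gamma>)" using irreducible_stuck[OF good] x(2) by (simp add: hs reducible_def)
  have box': "(PBox a \<psi>, u) \<in> \<Gamma>" using box by (simp add: hs elems_at_def)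
  from vertex_step[OF x(1)[unfolded hs] modal_child_applies[OF stuck box']]
  obtain h' where "edge (h, (w, \<Gamma>)) ModalR (h', modal_child (w, \<Gamma>) a \<psi> u)"
    "vertex (h', modal_child (w, \<Gamma>) a \<psi> u)"
    using modal_child_good[OF good box'] by (auto simp: all_rules_def)
  then show ?thesis unfolding hs by (intro exI[of _ "(h', modal_child (w, \<Gamma>) a \<psi> u)"]) simp
qed

text \<open>Reductions do not change \<open>final\<close>. At an irreducible vertex only modal
  elements can be true: a box is followed into its own modal child, and a diamond into any child for
  the same action, since \<open>modal_child\<close> collects the bodies of all diamonds for it. The
  last disjunction prevents the trace from idling.\<close>

lemma true_at_walk:
  fixes enc :: "('v, 'p, 'a) vertex \<Rightarrow> 's"
  assumes inj: "inj_on enc {x. vertex x}" and x: "vertex x"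
    and mem: "(expand \<psi>, u) \<in> elems_at x" and true: "true_at (model enc) (enc (final x)) \<psi> \<rho>"
  shows "\<exists>x' u' \<psi>' \<rho>' r X. vertex x' \<and> edge x r x' \<and> (expand \<psi>', u') \<in> elems_at x' \<and>
    true_at (model enc) (enc (final x')) \<psi>' \<rho>' \<and> evolves (names_at x) (names_at x') \<and>
    index_step (names_at x) u r X u' \<and> trace_step \<psi> \<rho> X \<psi>' \<rho>' \<and>
    (lighter (snd x') (snd x) \<or> len \<psi>' < len \<psi>)"
proof (cases "reducible x")
  case True
  let ?y = "next_vertex x"
  from next_vertex[OF x True] obtain r where r: "red (snd x) r (snd ?y)" "edge x r ?y" "vertex ?y" by blast
  have red: "red (names_at x, elems_at x) r (names_at ?y, elems_at ?y)"
    using r(1) by (simp add: names_at_def elems_at_def)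
  have "true_at (model enc) (enc (final ?y)) \<psi> \<rho>" using true final_next[OF True] by simp
  from true_at_red[OF red vertex_good[OF x] mem this] obtain \<psi>' \<rho>' u' X
    where "(expand \<psi>', u') \<in> elems_at ?y" "true_at (model enc) (enc (final ?y)) \<psi>' \<rho>'"
      "index_step (names_at x) u r X u'" "trace_step \<psi> \<rho> X \<psi>' \<rho>'" by blast
  moreover have "lighter (snd ?y) (snd x)"
    using red_weight[OF r(1)] vertex_good[OF x] by (simp add: names_at_def elems_at_def)
  ultimately show ?thesis using r red_evolves[OF red] by blast
next
  case False
  have irr: "\<not> (\<exists>r s'. red (names_at x, elems_at x) r s')"
    using False by (simp add: reducible_def names_at_def elems_at_def)
  have fin: "final x = x" using final_irreducible[OF False] .
  have \<psi>: "\<psi> \<in> subformulas \<gamma>" and s: "enc x \<in> gsem True (model enc) (val True (model enc) \<rho>) \<psi>"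
    using true fin by (auto simp: true_at_def)
  note form = irreducible_formulas[OF vertex_good[OF x] irr mem]
  have dec: "y = x" if "enc y = enc x" "vertex y" for y
    using inj_onD[OF inj that(1)] that(2) x by simp
  have noax: "\<not> is_axiom (names_at x, elems_at x)" using vertex_no_axiom[OF x] .
  have step: ?thesis
    if child: "vertex y" "edge x ModalR y" "snd y = modal_child (snd x) a \<chi> u0"
      and \<psi>': "(expand \<psi>', u) \<in> elems_at y" "true_at (model enc) (enc (final y)) \<psi>' \<rho>"
        "\<psi>' \<in> subformulas \<psi>" "len \<psi>' < len \<psi>" for y a \<chi> u0 \<psi>'
  proof -
    have "evolves (names_at x) (names_at y)"
      using child(3) modal_child_evolves[of "names_at x" "elems_at x"]
      by (simp add: names_at_def elems_at_def) (metis prod.collapse)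
    then show ?thesis using that index_step.Keep trace_step.Down by blast
  qed
  have child_elems: "elems_at y = {(\<phi>, v). (PDia a \<phi>, v) \<in> elems_at x} \<union> {(\<chi>, u0)}"
    if "snd y = modal_child (snd x) a \<chi> u0" for y a \<chi> u0
    using that by (cases x) (auto simp: modal_child_def elems_at_def Let_def)
  show ?thesis
  proof (cases \<psi>)
    case (PVar Y)
    then show ?thesis using expand_PVar \<psi> form(3) by blast
  next
    case (PProp P)
    then have "enc x \<in> vprop (model enc) P" using s by simp
    then obtain y where "enc x = enc y" "vertex y" "\<forall>u. (PProp P, u) \<notin> elems_at y"
      by (auto simp: model_def)
    then show ?thesis using dec[of y] mem PProp by (auto simp: expand_def)
  next
    case (PNeg P)
    then have "enc x \<notin> vprop (model enc) P" using s by simp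
    then obtain v where "(PProp P, v) \<in> elems_at x" using x False by (auto simp: model_def)
    then show ?thesis using noax mem PNeg by (auto simp: is_axiom_def expand_def)
  next
    case PTrue
    then show ?thesis using noax mem by (auto simp: is_axiom_def expand_def)
  next
    case PFalse
    then show ?thesis using s by simp
  next
    case (PConj \<psi>1 \<psi>2)
    then show ?thesis using form(1)[of "expand \<psi>1" "expand \<psi>2"] by (simp add: expand_def)
  next
    case (PDisj \<psi>1 \<psi>2)
    then show ?thesis using form(2)[of "expand \<psi>1" "expand \<psi>2"] by (simp add: expand_def)
  next
    case (PFix \<sigma> Y \<psi>1)
    then show ?thesis using form(3)[of \<sigma> Y "msubst (\<theta>(Y := PVar Y)) \<psi>1"] by (simp add: expand_def)
  next
    case (PBox a \<psi>')
    then have box: "(PBox a (expand \<psi>'), u) \<in> elems_at x" using mem by (simp add: expand_def)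
    from modal_step[OF x False this] obtain y
      where y: "vertex y" "edge x ModalR y" "snd y = modal_child (snd x) a (expand \<psi>') u" by blast
    have "(enc x, enc (final y)) \<in> steps (model enc) a"
      unfolding model_def kripke.select_convs mem_Collect_eq using x False y box by blast
    then have "true_at (model enc) (enc (final y)) \<psi>' \<rho>"
      using s PBox sub_componentsD(3)[of a \<psi>'] \<psi> by (auto simp: true_at_def)
    then show ?thesis using step[OF y, of \<psi>'] child_elems[OF y(3)] PBox by simp
  next
    case (PDia a \<psi>')
    then have dia: "(PDia a (expand \<psi>'), u) \<in> elems_at x" using mem by (simp add: expand_def)
    from s PDia obtain t where t: "(enc x, t) \<in> steps (model enc) a"
      "t \<in> gsem True (model enc) (val True (model enc) \<rho>) \<psi>'" by auto
    then obtain x0 y \<chi> u0 where y: "enc x = enc x0" "t = enc (final y)" "vertex x0" "vertex y"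
      "edge x0 ModalR y" "snd y = modal_child (snd x0) a \<chi> u0" unfolding model_def by auto
    have "x0 = x" using dec y by simp
    note y = y[unfolded this]
    have "true_at (model enc) (enc (final y)) \<psi>' \<rho>"
      using t(2) y(2) PDia sub_componentsD(4)[of a \<psi>'] \<psi> by (auto simp: true_at_def)
    then show ?thesis using step[OF y(4-6), of \<psi>'] child_elems[OF y(6)] PDia dia by simp
  qed
qed

lemma completeness:
  assumes inf: "infinite (UNIV :: 's set)" and valid: "valid TYPE('s) (form_of \<gamma>)"
  shows "\<exists>t. proof_tree \<gamma> xs t"
proof (rule ccontr)
  assume noproof: "\<not> ?thesis"
  have "good ([], {(\<gamma>, [])})"
    by (auto simp: good_def is_sequent_def names_of_def intro: clos.intros(1))
  then have root: "vertex ([], ([], {(\<gamma>, [])}))"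
    using noproof by (auto simp: vertex_def node_def hist_def is_repeat_def proof_tree_def)
  obtain A :: "'s set" where "finite A" "card A = card {x. vertex x}"
    using infinite_arbitrarily_large[OF inf] by blast
  then obtain enc :: "('v, 'p, 'a) vertex \<Rightarrow> 's" where enc: "inj_on enc {x. vertex x}"
    using finite_same_card_bij[OF finite_vertices] by (metis bij_betw_def)
  let ?T = "model enc" and ?root = "([], ([], {(\<gamma>, [])}))"
  have expand: "expand \<gamma> = \<gamma>" using closed by (simp add: expand_def msubst_closed closed_pform_def)
  have "enc (final ?root) \<in> states ?T" using final_vertex[OF root] by (simp add: model_def)
  also have "states ?T = sem ?T (\<lambda>_. {}) (form_of \<gamma>)"
    using valid[unfolded valid_def, rule_format, OF kripke_model[of enc], of "\<lambda>_. {}"] by simp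
  also have "\<dots> = gsem True ?T (\<lambda>_. {}) \<gamma>" by (rule gsem_True[OF kripke_model, symmetric]) simp
  also have "\<dots> = gsem True ?T (val True ?T \<rho>) \<gamma>" for \<rho>
    using closed by (intro gsem_cong) (simp add: closed_pform_def)
  finally have true: "true_at ?T (enc (final ?root)) \<gamma> \<rho>" for \<rho> by (simp add: true_at_def)
  define ok where "ok = (\<lambda>(x, u, \<psi>, \<rho>).
    vertex x \<and> (expand \<psi>, u) \<in> elems_at x \<and> true_at ?T (enc (final x)) \<psi> \<rho>)"
  define nx where "nx = (\<lambda>(x, u, \<psi>, \<rho> :: 'v \<Rightarrow> 's stage) (x', u', \<psi>', \<rho>'). \<exists>r X. edge x r x' \<and>
    evolves (names_at x) (names_at x') \<and> index_step (names_at x) u r X u' \<and> trace_step \<psi> \<rho> X \<psi>' \<rho>' \<and>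
    (lighter (snd x') (snd x) \<or> len \<psi>' < len \<psi>))"
  have "\<exists>f. \<forall>n. ok (f n) \<and> nx (f n) (f (Suc n))"
  proof (rule dependent_nat_choice)
    \<comment> \<open>As \<gamma> is closed, it is true under arbitrary initial stages.\<close>
    show "\<exists>c. ok c"
      using root true expand
      by (intro exI[of _ "(?root, [], \<gamma>, undefined)"]) (auto simp: ok_def elems_at_def)
    show "\<exists>c'. ok c' \<and> nx c c'" if "ok c" for c and n :: nat
    proof -
      obtain x u \<psi> \<rho> where c: "c = (x, u, \<psi>, \<rho>)" by (cases c)
      with that true_at_walk[OF enc, of x \<psi> u \<rho>] obtain x' u' \<psi>' \<rho>' r X
        where "vertex x'" "edge x r x'" "(expand \<psi>', u') \<in> elems_at x'"
          "true_at ?T (enc (final x')) \<psi>' \<rho>'" "evolves (names_at x) (names_at x')"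
          "index_step (names_at x) u r X u'" "trace_step \<psi> \<rho> X \<psi>' \<rho>'"
          "lighter (snd x') (snd x) \<or> len \<psi>' < len \<psi>"
        by (auto simp: ok_def)
      then show ?thesis unfolding c ok_def nx_def by (intro exI[of _ "(x', u', \<psi>', \<rho>')"]) auto
    qed
  qed
  then obtain f where f: "\<And>n. ok (f n)" "\<And>n. nx (f n) (f (Suc n))" by blast
  define x where "x n = fst (f n)" for n
  define u where "u n = fst (snd (f n))" for n
  define \<psi> where "\<psi> n = fst (snd (snd (f n)))" for n
  define \<rho> where "\<rho> n = snd (snd (snd (f n)))" for n
  have fn: "f n = (x n, u n, \<psi> n, \<rho> n)" for n by (simp add: x_def u_def \<psi>_def \<rho>_def)
  have ok: "vertex (x n)" "(expand (\<psi> n), u n) \<in> elems_at (x n)" "\<psi> n \<in> subformulas \<gamma>" for n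
    using f(1)[of n] by (auto simp: ok_def fn true_at_def)
  have "\<forall>n. \<exists>r X. edge (x n) r (x (Suc n)) \<and> evolves (names_at (x n)) (names_at (x (Suc n))) \<and>
    index_step (names_at (x n)) (u n) r X (u (Suc n)) \<and>
    trace_step (\<psi> n) (\<rho> n) X (\<psi> (Suc n)) (\<rho> (Suc n)) \<and>
    (lighter (snd (x (Suc n))) (snd (x n)) \<or>
      len (\<psi> (Suc n)) < len (\<psi> n))"
    using f(2) by (simp add: nx_def fn)
  then obtain r X where st: "\<And>n. edge (x n) (r n) (x (Suc n))"
    "\<And>n. evolves (names_at (x n)) (names_at (x (Suc n)))"
    "\<And>n. index_step (names_at (x n)) (u n) (r n) (X n) (u (Suc n))"
    "\<And>n. trace_step (\<psi> n) (\<rho> n) (X n) (\<psi> (Suc n)) (\<rho> (Suc n))"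
    "\<And>n. lighter (snd (x (Suc n))) (snd (x n)) \<or>
      len (\<psi> (Suc n)) < len (\<psi> n)"
    by metis
  have progress: "\<exists>j\<ge>i. X j \<noteq> None \<or> len (\<psi> (Suc j)) < len (\<psi> j)" for i
  proof (rule ccontr)
    assume no: "\<not> ?thesis"
    \<comment> \<open>If no formula shrank from \<open>i\<close> on, each step would be a reduction
      of the sequent, and weights would decrease forever.\<close>
    have "(weight (snd (x (Suc (i + n)))), weight (snd (x (i + n)))) \<in> less_than <*lex*> less_than" for n
      using st(5)[of "i + n"] no by auto
    then have "\<exists>g. \<forall>n. (g (Suc n), g n) \<in> less_than <*lex*> less_than"
      by (intro exI[of _ "\<lambda>n. weight (snd (x (i + n)))"]) simp
    then show False
      using wf_lex_prod[OF wf_less_than wf_less_than] unfolding wf_iff_no_infinite_down_chain by blast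
  qed
  from outermost_nu[OF ok(3) st(4) progress] obtain K T0
    where K: "K \<in> set xs" "op_of K = Nu" "\<And>i. \<exists>j\<ge>i. X j = Some K"
      "\<And>i Y. i \<ge> T0 \<Longrightarrow> X i = Some Y \<Longrightarrow> pos xs K \<le> pos xs Y" by blast
  have good: "good (names_at (x n), elems_at (x n))" for n using vertex_good[OF ok(1)] .
  note idx = good_idx[OF good ok(2)] goodD(7)[OF good ok(2)]
  have "\<exists>z T. (\<forall>i\<ge>T. z \<in> set (u i)) \<and> (\<forall>i. \<exists>j\<ge>i. r j = ResetR z)"
    by (rule names_progress[of "\<lambda>n. names_at (x n)" u r X K T0])
      ((rule goodD(2)[OF good] goodD(3)[OF good] st(2) idx(1) idx(2) idx(4) st(3) K | assumption)+)
  then obtain z T where z: "\<And>i. i \<ge> T \<Longrightarrow> z \<in> set (u i)" "\<And>i. \<exists>j\<ge>i. r j = ResetR z" by blast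
  show False
  proof (rule no_successful_walk[of "\<lambda>n. fst (x n)" "\<lambda>n. snd (x n)" r T z])
    show "vertex (fst (x i), snd (x i))" for i using ok(1) by simp
    show "edge (fst (x i), snd (x i)) (r i) (fst (x (Suc i)), snd (x (Suc i)))" for i using st(1) by simp
    show "z \<in> set (fst (snd (x i)))" if "i \<ge> T" for i
      using z(1)[OF that] idx(1)[of i] by (auto simp: names_at_def)
    show "\<exists>j\<ge>i. r j = ResetR z" for i by (rule z(2))
  qed
qed

end

theorem theorem4:
  fixes \<gamma> :: "('v, 'p, 'a) pform" and xs :: "'v list"
  assumes "infinite (UNIV :: 'v set)"
    and "infinite (UNIV :: 's set)"
    and "closed_pform \<gamma>"
    and "guarded \<gamma>"
    and "positive_normal_form \<gamma>"
    and "var_order \<gamma> xs"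
  shows "valid TYPE('s) (form_of \<gamma>) \<longleftrightarrow> (\<exists>t. proof_tree \<gamma> xs t)"
proof -
  interpret mu_formula \<gamma> xs using assms(3-6) by unfold_locales
  show ?thesis using completeness[OF assms(2)] soundness by blast
qed

end
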